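(* Let $\boldsymbol n=\boldsymbol n(n)$ be type sequences with $\sum_in_i=n$ satisfying (a) $n_i/n\to p_i$ for all $i\ge1$, $\sum_ip_i=1$, and (b) $\ell_{\boldsymbol n}/n\to\sum_iip_i<\infty$, where $p_1>0$ and $\sum_iip_i>2$. Then, as $n\to\infty$, \[|\mathscr{C}^c_{\boldsymbol n}|=\mathrm{e}^{-K(\boldsymbol p)n+o(n)}|\mathscr{C}_{\boldsymbol n}|,\] and if additionally (c) $\sum_ii^2n_i/n\to\sum_ii^2p_i<\infty$ holds, then \[|\mathscr{S}^c_{\boldsymbol n}|=\mathrm{e}^{-K(\boldsymbol p)n+o(n)}|\mathscr{C}_{\boldsymbol n}|.\]
   Context: A type sequence $\boldsymbol m=(m_i)_{i\ge1}$ is a sequence of nonnegative integers with $\sum_im_i<\infty$ and $\ell_{\boldsymbol m}=\sum_iim_i$ even; vertex set $[m]$, $m=\sum_im_i$, vertex $j$ of degree $d'_j=\min\{k:\sum_{i\le k}m_i\ge j\}$. $\mathscr{C}_{\boldsymbol m}$ is the set of perfect matchings (configurations) of $\{(j,h):j\in[m],h\in[d'_j]\}$, each giving a multigraph on $[m]$; $\mathscr{C}^c_{\boldsymbol m}$: connected ones; $\mathscr{S}_{\boldsymbol m}$: those without self-loops and multiple edges; $\mathscr{S}^c_{\boldsymbol m}=\mathscr{S}_{\boldsymbol m}\cap\mathscr{C}^c_{\boldsymbol m}$. $\beta(\boldsymbol p)$ is the unique solution in $(0,1)$ of $\sum_kkp_k=(1-\beta^2)\sum_k\frac{kp_k}{1-\beta^k}$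 and $K(\boldsymbol p)=(\frac12\sum_kkp_k)\log(1-\beta(\boldsymbol p)^2)-\sum_kp_k\log(1-\beta(\boldsymbol p)^k)$. $a_n=\mathrm{e}^{-Kn+o(n)}b_n$ means $a_n=\mathrm{e}^{-Kn+\varepsilon_nn}b_n$ with $\varepsilon_n\to0$. *)

theory Defs
  imports "HOL-Analysis.Analysis" "HOL-Library.Multiset" "HOL-Library.Disjoint_Sets"
begin

text \<open>
  A sequence indexed by \<open>i \<ge> 1\<close> is a function on \<open>nat\<close> whose value at \<open>0\<close> is never used:
  all sums and quantifiers below range over \<open>i \<ge> 1\<close> only.
\<close>

definition tsupp :: "(nat \<Rightarrow> nat) \<Rightarrow> nat set" where
  "tsupp m = {i. 1 \<le> i \<and> m i \<noteq> 0}"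

definition tsize :: "(nat \<Rightarrow> nat) \<Rightarrow> nat" where
  "tsize m = (\<Sum>i\<in>tsupp m. m i)"

definition tell :: "(nat \<Rightarrow> nat) \<Rightarrow> nat" where
  "tell m = (\<Sum>i\<in>tsupp m. i * m i)"

text \<open>For nonnegative integers, \<open>\<Sum>\<^sub>i m\<^sub>i < \<infinity>\<close> says that the support is finite.\<close>

definition type_sequence :: "(nat \<Rightarrow> nat) \<Rightarrow> bool" where
  "type_sequence m \<longleftrightarrow> finite (tsupp m) \<and> even (tell m)"

definition vertices :: "(nat \<Rightarrow> nat) \<Rightarrow> nat set" where
  "vertices m = {1..tsize m}"

definition tdegree :: "(nat \<Rightarrow> nat) \<Rightarrow> nat \<Rightarrow> nat" where
  "tdegree m j = (LEAST k. j \<le> (\<Sum>i=1..k. m i))"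

definition half_edges :: "(nat \<Rightarrow> nat) \<Rightarrow> (nat \<times> nat) set" where
  "half_edges m = (SIGMA j:vertices m. {1..tdegree m j})"

text \<open>A perfect matching of a set is a partition of it into two-element blocks.\<close>

definition configurations :: "(nat \<Rightarrow> nat) \<Rightarrow> (nat \<times> nat) set set set" where
  "configurations m = {M. partition_on (half_edges m) M \<and> (\<forall>e\<in>M. card e = 2)}"

text \<open>
  The multigraph of a configuration is given by its multiset of edges, an edge being the set of its
  endpoints; a self-loop at \<open>j\<close> is therefore the singleton \<open>{j}\<close>.
\<close>

definition multigraph :: "(nat \<times> nat) set set \<Rightarrow> nat set multiset" where
  "multigraph M = image_mset (\<lambda>e. fst ` e) (mset_set M)"

definition connected_multigraph :: "'a set \<Rightarrow> 'a set multiset \<Rightarrow> bool" where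
  "connected_multigraph V E \<longleftrightarrow> (\<forall>u\<in>V. \<forall>v\<in>V. (u, v) \<in> {(x, y). {x, y} \<in># E}\<^sup>*)"

definition simple_multigraph :: "'a set multiset \<Rightarrow> bool" where
  "simple_multigraph E \<longleftrightarrow> (\<forall>j. {j} \<notin># E) \<and> (\<forall>e. count E e \<le> 1)"

definition connected_configurations :: "(nat \<Rightarrow> nat) \<Rightarrow> (nat \<times> nat) set set set" where
  "connected_configurations m =
     {M \<in> configurations m. connected_multigraph (vertices m) (multigraph M)}"

definition simple_configurations :: "(nat \<Rightarrow> nat) \<Rightarrow> (nat \<times> nat) set set set" where
  "simple_configurations m = {M \<in> configurations m. simple_multigraph (multigraph M)}"

definition simple_connected_configurations :: "(nat \<Rightarrow> nat) \<Rightarrow> (nat \<times> nat) set set set" where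
  "simple_connected_configurations m = simple_configurations m \<inter> connected_configurations m"

text \<open>
  The solution exists and is unique if \<open>p\<close> is a probability distribution on \<open>{1..}\<close> with
  \<open>p\<^sub>1 > 0\<close> and finite mean greater than \<open>2\<close>.
\<close>

definition beta_of :: "(nat \<Rightarrow> real) \<Rightarrow> real" where
  "beta_of p = (THE b. 0 < b \<and> b < 1 \<and>
     (\<Sum>\<^sub>\<infinity>k\<in>{1..}. real k * p k) = (1 - b\<^sup>2) * (\<Sum>\<^sub>\<infinity>k\<in>{1..}. real k * p k / (1 - b ^ k)))"

definition K_of :: "(nat \<Rightarrow> real) \<Rightarrow> real" where
  "K_of p = (1/2 * (\<Sum>\<^sub>\<infinity>k\<in>{1..}. real k * p k)) * ln (1 - (beta_of p)\<^sup>2)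
            - (\<Sum>\<^sub>\<infinity>k\<in>{1..}. p k * ln (1 - beta_of p ^ k))"

text \<open>
  \<open>a\<^sub>n = exp (- K n + o(n)) b\<^sub>n\<close> as \<open>n \<rightarrow> \<infinity>\<close>. The identity is required for all large \<open>n\<close> only:
  for small \<open>n\<close> one of the two counts may vanish.
\<close>

definition exp_asymp :: "real \<Rightarrow> (nat \<Rightarrow> real) \<Rightarrow> (nat \<Rightarrow> real) \<Rightarrow> bool" where
  "exp_asymp K a b \<longleftrightarrow> (\<exists>\<epsilon>. \<epsilon> \<longlonglongrightarrow> 0 \<and>
     (\<forall>\<^sub>F n in sequentially. a n = exp (- K * real n + \<epsilon> n * real n) * b n))"

end

theory Submission
  imports Defs "HOL-Real_Asymp.Real_Asymp"
begin

text \<open>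
  Upper bound. Add to the \<open>n\<close> vertices about \<open>n p\<^sub>k \<beta>\<^sup>k / (1 - \<beta>\<^sup>k)\<close> vertices of each degree \<open>k\<close>.
  A configuration of the larger system has at most as many components as vertices, so counting
  pairs of a component of type \<open>\<^bold>n\<close> and a configuration of the remaining vertices bounds
  \<open>|\<C>\<^sup>c|\<close>; the equation for \<open>\<beta>\<close> makes the resulting rate equal to \<open>K\<close>.

  Lower bound. Label at each vertex a nonempty set of its half-edges, thought of as those leading to
  infinity in the giant component of the larger system: each half-edge is labelled with probability
  \<open>1 - \<beta>\<close>, conditioned on at least one label. A vertex with exactly one label is a tree vertex, whose
  labelled half-edge (its tip) is matched with an unlabelled half-edge (a slot); the remaining
  vertices form the core, whose labelled half-edges are matched among themselves. If the tips are
  attached without cycles and the core is connected, the configuration is connected and determines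
  its labels. With \<open>T\<close> tips and \<open>2 k\<close> core half-edges there are at least \<open>(T - 1)!\<close> acyclic
  attachments and \<open>2\<^sup>k\<^sup>-\<^sup>1 (k - 1)!\<close> connected core matchings, and counting the labellings with the
  expected frequencies gives the rate \<open>K\<close> again.

  Simple graphs. The number of loops and surplus parallel edges of a core matching has bounded mean,
  whereas connectedness only costs a factor of order \<open>n\<^sup>1\<^sup>/\<^sup>2\<close>. So most connected core matchings have
  at most \<open>n\<^sup>3\<^sup>/\<^sup>4\<close> such edges, and these are removed by switchings, of which there are only
  polynomially many.
\<close>

subsection \<open>Perfect matchings\<close>

text \<open>The given degrees are to look like those of the giant component of the larger system. If
  half-edges fail to lead to infinity independently with probability \<beta>, a vertex of degree k
  lies in that component with probability 1 - \<beta>^k, so p_k is blown up to p_k / (1 -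
  \<beta>^k), and the surplus is what is added. An edge misses the component with probability
  \<beta>^2; equating this with the share of added half-edges is exactly the equation for \<beta>.
  The same equation makes the expected numbers of tips and slots agree.

  Convergence of the frequencies is given degree by degree. The counts therefore use finitely many
  types, of degree at most \<open>k0\<close>, to which Stirling's formula applies, and treat
  vertices of larger degree wholesale: in the upper bound they all belong to the component, in the
  lower bound all their half-edges are labelled. The rates tend to -K as \<open>k0\<close> grows.
  Truncation and rounding destroy the exact balance of tips and slots, and restoring it at vanishing
  cost in the rate is the obstacle that shapes the lower bound.\<close>

definition perfect_matchings :: "'h set \<Rightarrow> 'h set set set" where
  "perfect_matchings H = {M. partition_on H M \<and> (\<forall>e\<in>M. card e = 2)}"

text \<open>This is the double factorial (2k-1)!!, the number of perfect matchings of 2k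
  points.\<close>

primrec odd_fact :: "nat \<Rightarrow> nat" where
  "odd_fact 0 = 1"
| "odd_fact (Suc k) = (2 * k + 1) * odd_fact k"

lemma finite_perfect_matchings: "finite H \<Longrightarrow> finite (perfect_matchings H)"
  by (rule finite_subset[of _ "Pow (Pow H)"]) (auto simp: perfect_matchings_def partition_on_def)

lemma finite_of_perfect_matchings: "finite H \<Longrightarrow> M \<in> perfect_matchings H \<Longrightarrow> finite M"
  by (rule finite_subset[of _ "Pow H"]) (auto simp: perfect_matchings_def partition_on_def)

lemma perfect_matchings_edge_subset: "M \<in> perfect_matchings H \<Longrightarrow> e \<in> M \<Longrightarrow> e \<subseteq> H"
  by (auto simp: perfect_matchings_def partition_on_def)

lemma perfect_matchings_edge_card: "M \<in> perfect_matchings H \<Longrightarrow> e \<in> M \<Longrightarrow> card e = 2"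
  by (auto simp: perfect_matchings_def)

lemma perfect_matchings_edge_unique: "M \<in> perfect_matchings H \<Longrightarrow> e \<in> M \<Longrightarrow> f \<in> M \<Longrightarrow> x \<in> e \<Longrightarrow> x \<in> f \<Longrightarrow> e = f"
  by (auto simp: perfect_matchings_def partition_on_def disjoint_def)

lemma perfect_matchings_edge_ex: "M \<in> perfect_matchings H \<Longrightarrow> x \<in> H \<Longrightarrow> \<exists>e\<in>M. x \<in> e"
  by (auto simp: perfect_matchings_def partition_on_def)

lemma pmsI:
  assumes "\<And>e. e \<in> M \<Longrightarrow> e \<subseteq> H" "\<And>e. e \<in> M \<Longrightarrow> card e = 2"
    "\<And>x. x \<in> H \<Longrightarrow> \<exists>e\<in>M. x \<in> e"
    "\<And>e f x. e \<in> M \<Longrightarrow> f \<in> M \<Longrightarrow> x \<in> e \<Longrightarrow> x \<in> f \<Longrightarrow> e = f"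
  shows "M \<in> perfect_matchings H"
proof -
  have "disjoint M" using assms(4) unfolding disjoint_def by blast
  moreover have "\<Union>M = H" using assms(1,3) by blast
  moreover have "{} \<notin> M" using assms(2) by force
  ultimately show ?thesis unfolding perfect_matchings_def partition_on_def using assms(2) by blast
qed

lemma perfect_matchings_insert:
  assumes "M \<in> perfect_matchings (H - e)" "e \<subseteq> H" "card e = 2"
  shows "insert e M \<in> perfect_matchings H"
proof (rule pmsI)
  show "f \<subseteq> H" if "f \<in> insert e M" for f using that assms perfect_matchings_edge_subset[OF assms(1)] by blast
  show "card f = 2" if "f \<in> insert e M" for f using that assms perfect_matchings_edge_card[OF assms(1)] by blast
  show "\<exists>f\<in>insert e M. x \<in> f" if "x \<in> H" for x
    using perfect_matchings_edge_ex[OF assms(1), of x] that by blast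
  show "f = g" if "f \<in> insert e M" "g \<in> insert e M" "x \<in> f" "x \<in> g" for f g x
    using that perfect_matchings_edge_subset[OF assms(1)] perfect_matchings_edge_unique[OF assms(1)] by blast
qed

lemma perfect_matchings_remove:
  assumes "M \<in> perfect_matchings H" "e \<in> M"
  shows "M - {e} \<in> perfect_matchings (H - e)"
proof (rule pmsI)
  show "f \<subseteq> H - e" if "f \<in> M - {e}" for f
    using that perfect_matchings_edge_subset[OF assms(1)] perfect_matchings_edge_unique[OF assms(1)] assms(2) by blast
  show "card f = 2" if "f \<in> M - {e}" for f using that perfect_matchings_edge_card[OF assms(1)] by blast
  show "\<exists>f\<in>M - {e}. x \<in> f" if "x \<in> H - e" for x
    using perfect_matchings_edge_ex[OF assms(1), of x] that by blast
  show "f = g" if "f \<in> M - {e}" "g \<in> M - {e}" "x \<in> f" "x \<in> g" for f g x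
    using that perfect_matchings_edge_unique[OF assms(1)] by blast
qed

lemma card_perfect_matchings_edge:
  assumes "e \<subseteq> H" "card e = 2"
  shows "card {M \<in> perfect_matchings H. e \<in> M \<and> P M} = card {M \<in> perfect_matchings (H - e). P (insert e M)}"
proof -
  have ne: "e \<noteq> {}" using assms by auto
  have notin: "e \<notin> M" if "M \<in> perfect_matchings (H - e)" for M
    using perfect_matchings_edge_subset[OF that] ne by blast
  have "{M \<in> perfect_matchings H. e \<in> M \<and> P M} = insert e ` {M \<in> perfect_matchings (H - e). P (insert e M)}"
  proof (intro set_eqI iffI)
    fix M assume "M \<in> {M \<in> perfect_matchings H. e \<in> M \<and> P M}"
    then have "M - {e} \<in> perfect_matchings (H - e)" "insert e (M - {e}) = M" "P M"
      using perfect_matchings_remove by auto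
    then show "M \<in> insert e ` {M \<in> perfect_matchings (H - e). P (insert e M)}"
      by (metis (mono_tags, lifting) imageI mem_Collect_eq)
  qed (use perfect_matchings_insert assms in auto)
  moreover have "inj_on (insert e) {M \<in> perfect_matchings (H - e). P (insert e M)}"
    using notin by (auto simp: inj_on_def) (metis insert_ident)+
  ultimately show ?thesis by (simp add: card_image)
qed

text \<open>Expose the partner of one half-edge \<open>h\<close>: exactly one of the edges
  \<open>{h, h'}\<close> occurs. The arbitrary predicate \<open>P\<close> lets the same recursion
  serve the total count and the connected one.\<close>

lemma card_perfect_matchings_step:
  assumes "finite H" "h \<in> H"
  shows "card {M \<in> perfect_matchings H. P M} =
    (\<Sum>h'\<in>H - {h}. card {M \<in> perfect_matchings (H - {h, h'}). P (insert {h, h'} M)})"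
proof -
  have ex: "\<exists>h'\<in>H - {h}. {h, h'} \<in> M" if M: "M \<in> perfect_matchings H" for M
  proof -
    obtain e where e: "e \<in> M" "h \<in> e" using perfect_matchings_edge_ex[OF M assms(2)] by blast
    obtain h' where "e = {h, h'}" "h' \<noteq> h"
      using e perfect_matchings_edge_card[OF M] by (metis card_2_iff doubleton_eq_iff insertE singletonD)
    then show ?thesis using e perfect_matchings_edge_subset[OF M] by blast
  qed
  have "{M \<in> perfect_matchings H. P M} = (\<Union>h'\<in>H - {h}. {M \<in> perfect_matchings H. {h, h'} \<in> M \<and> P M})"
    using ex by auto
  also have "card \<dots> = (\<Sum>h'\<in>H - {h}. card {M \<in> perfect_matchings H. {h, h'} \<in> M \<and> P M})"
  proof (rule card_UN_disjoint)
    show "\<forall>i\<in>H - {h}. \<forall>j\<in>H - {h}. i \<noteq> j \<longrightarrow>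
        {M \<in> perfect_matchings H. {h, i} \<in> M \<and> P M} \<inter> {M \<in> perfect_matchings H. {h, j} \<in> M \<and> P M} = {}"
    proof (intro ballI impI equals0I)
      fix i j M assume ij: "i \<in> H - {h}" "j \<in> H - {h}" "i \<noteq> j"
        and "M \<in> {M \<in> perfect_matchings H. {h, i} \<in> M \<and> P M} \<inter> {M \<in> perfect_matchings H. {h, j} \<in> M \<and> P M}"
      then have "{h, i} = {h, j}" using perfect_matchings_edge_unique[of M H "{h,i}" "{h,j}" h] by simp
      then show False using ij by (auto simp: doubleton_eq_iff)
    qed
  next
    show "finite (H - {h})" using assms by simp
    show "\<forall>i\<in>H - {h}. finite {M \<in> perfect_matchings H. {h, i} \<in> M \<and> P M}"
      using finite_perfect_matchings[OF assms(1)] by simp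
  qed
  also have "\<dots> = (\<Sum>h'\<in>H - {h}. card {M \<in> perfect_matchings (H - {h, h'}). P (insert {h, h'} M)})"
    by (rule sum.cong[OF refl], rule card_perfect_matchings_edge) (use assms in auto)
  finally show ?thesis .
qed

lemma card_perfect_matchings:
  assumes "finite H" "card H = 2 * k"
  shows "card (perfect_matchings H) = odd_fact k"
  using assms
proof (induction k arbitrary: H)
  case 0
  then have "perfect_matchings H = {{}}"
    by (auto simp: perfect_matchings_def partition_on_def)
  then show ?case by simp
next
  case (Suc k)
  then obtain h where h: "h \<in> H" by fastforce
  have "card {M \<in> perfect_matchings H. True} = (\<Sum>h'\<in>H - {h}. card {M \<in> perfect_matchings (H - {h, h'}). True})"
    by (rule card_perfect_matchings_step) (use Suc h in auto)
  also have "\<dots> = (\<Sum>h'\<in>H - {h}. odd_fact k)"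
  proof (rule sum.cong[OF refl])
    fix h' assume h': "h' \<in> H - {h}"
    then have "card {h, h'} = 2" by auto
    then have "card (H - {h, h'}) = 2 * k" using Suc.prems h h' by (simp add: card_Diff_subset)
    then show "card {M \<in> perfect_matchings (H - {h, h'}). True} = odd_fact k" using Suc by simp
  qed
  finally show ?case using Suc.prems h by simp
qed

lemma odd_fact_fact: "odd_fact k * (2 ^ k * fact k) = fact (2 * k)"
proof (induction k)
  case (Suc k)
  have "odd_fact (Suc k) * (2 ^ Suc k * fact (Suc k)) = (2 * k + 2) * ((2 * k + 1) * (odd_fact k * (2 ^ k * fact k)))"
    by (simp add: algebra_simps)
  also have "\<dots> = fact (2 * Suc k)" unfolding Suc by (simp add: algebra_simps)
  finally show ?case .
qed simp

section \<open>Connected matchings\<close>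

definition edge_rel :: "('h \<Rightarrow> 'v) \<Rightarrow> 'h set set \<Rightarrow> ('v \<times> 'v) set" where
  "edge_rel \<pi> M = {(x, y). \<exists>e\<in>M. \<pi> ` e = {x, y}}"

text \<open>Vertices enter only through the projection \<open>\<pi>\<close> of half-edges, so
  contracting an edge is a change of \<open>\<pi>\<close> and leaves the remaining half-edges as
  they are.\<close>

definition linked :: "('h \<Rightarrow> 'v) \<Rightarrow> 'v set \<Rightarrow> 'h set set \<Rightarrow> bool" where
  "linked \<pi> V M \<longleftrightarrow> (\<forall>u\<in>V. \<forall>v\<in>V. (u, v) \<in> (edge_rel \<pi> M)\<^sup>*)"

lemma sym_edge_rel: "sym (edge_rel \<pi> M)"
  by (auto simp: sym_def edge_rel_def insert_commute)

lemma edge_rel_rtrancl_sym: "(x, y) \<in> (edge_rel \<pi> M)\<^sup>* \<Longrightarrow> (y, x) \<in> (edge_rel \<pi> M)\<^sup>*"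
  using sym_rtrancl[OF sym_edge_rel] by (metis symD)

lemma edge_relI: "{h, h'} \<in> M \<Longrightarrow> (\<pi> h, \<pi> h') \<in> edge_rel \<pi> M"
  unfolding edge_rel_def by (auto intro!: bexI[of _ "{h,h'}"])

lemma edge_relE:
  assumes "(x, y) \<in> edge_rel \<pi> M" "\<And>e. e \<in> M \<Longrightarrow> card e = 2"
  obtains h h' where "{h, h'} \<in> M" "\<pi> h = x" "\<pi> h' = y"
proof -
  obtain e where e: "e \<in> M" "\<pi> ` e = {x, y}" using assms by (auto simp: edge_rel_def)
  obtain a b where ab: "e = {a, b}" using assms(2)[OF e(1)] by (auto simp: card_2_iff)
  then have "(\<pi> a = x \<and> \<pi> b = y) \<or> (\<pi> b = x \<and> \<pi> a = y)"
    using e(2) by (auto simp: doubleton_eq_iff)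
  then show ?thesis using that e(1) ab by (metis insert_commute)
qed

text \<open>Contracting the edge \<open>{h, h'}\<close> identifies its end \<open>\<pi> h'\<close> with \<open>\<pi> h\<close>.\<close>

lemma linked_contract:
  assumes "linked (\<lambda>x. if \<pi> x = \<pi> h' then \<pi> h else \<pi> x) (insert (\<pi> h) (V - {\<pi> h'})) M"
    and "\<And>e. e \<in> M \<Longrightarrow> card e = 2"
  shows "linked \<pi> V (insert {h, h'} M)"
proof -
  define \<pi>' where "\<pi>' = (\<lambda>x. if \<pi> x = \<pi> h' then \<pi> h else \<pi> x)"
  define R where "R = edge_rel \<pi> (insert {h, h'} M)"
  have "(\<pi> h, \<pi> h') \<in> R" unfolding R_def by (rule edge_relI) simp
  then have R1: "(\<pi> h, \<pi> h') \<in> R\<^sup>*" "(\<pi> h', \<pi> h) \<in> R\<^sup>*"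
    using edge_rel_rtrancl_sym[of "\<pi> h" "\<pi> h'"] unfolding R_def by auto
  have R2: "(\<pi> a, \<pi>' a) \<in> R\<^sup>*" "(\<pi>' a, \<pi> a) \<in> R\<^sup>*" for a
    using R1 unfolding \<pi>'_def by auto
  have "edge_rel \<pi>' M \<subseteq> R\<^sup>*"
  proof clarify
    fix x y assume "(x, y) \<in> edge_rel \<pi>' M"
    then obtain a b where ab: "{a, b} \<in> M" "\<pi>' a = x" "\<pi>' b = y"
      using assms(2) by (metis edge_relE)
    then have "(\<pi> a, \<pi> b) \<in> R" unfolding R_def by (intro edge_relI) auto
    then show "(x, y) \<in> R\<^sup>*" using R2[of a] R2[of b] ab by (metis rtrancl.rtrancl_into_rtrancl rtrancl_trans)
  qed
  then have sub: "(edge_rel \<pi>' M)\<^sup>* \<subseteq> R\<^sup>*" by (metis rtrancl_subset_rtrancl)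
  have "(u, \<pi> h) \<in> R\<^sup>*" if "u \<in> V" for u
  proof (cases "u = \<pi> h'")
    case False
    then have "(u, \<pi> h) \<in> (edge_rel \<pi>' M)\<^sup>*"
      using assms(1) that unfolding linked_def \<pi>'_def by blast
    then show ?thesis using sub by blast
  qed (use R1 in auto)
  note to = this
  show ?thesis unfolding linked_def
  proof (intro ballI)
    fix u v assume "u \<in> V" "v \<in> V"
    then have "(u, \<pi> h) \<in> R\<^sup>*" "(\<pi> h, v) \<in> R\<^sup>*"
      using to edge_rel_rtrancl_sym[of v "\<pi> h"] unfolding R_def by auto
    then show "(u, v) \<in> (edge_rel \<pi> (insert {h, h'} M))\<^sup>*"
      unfolding R_def by (rule rtrancl_trans)
  qed
qed

text \<open>
  Grow the component of \<open>v0\<close> by matching one of its free half-edges and contracting the new edge.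
  Only the choice that exhausts the free half-edges of \<open>v0\<close> is forbidden, so \<open>2 * j - 2\<close> choices
  remain when \<open>2 * j\<close> half-edges are left; all other vertices need degree at least 2, as
  otherwise the contraction could exhaust them.
\<close>

lemma card_linked_matchings_ge:
  assumes "finite H" "card H = 2 * Suc k" "\<pi> ` H \<subseteq> V" "v0 \<in> V" "\<exists>h\<in>H. \<pi> h = v0"
    and "\<And>v. v \<in> V \<Longrightarrow> v \<noteq> v0 \<Longrightarrow> 2 \<le> card {h\<in>H. \<pi> h = v}"
  shows "2 ^ k * fact k \<le> card {M \<in> perfect_matchings H. linked \<pi> V M}"
  using assms
proof (induction k arbitrary: H V \<pi>)
  case 0
  obtain h where h: "h \<in> H" "\<pi> h = v0" using 0 by blast
  \<comment> \<open>One of the two half-edges sits at \<open>v0\<close>, so at most one is left for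
    another vertex, which would have to carry two.\<close>
  have V: "V = {v0}"
  proof (rule ccontr)
    assume "V \<noteq> {v0}"
    then obtain v where v: "v \<in> V" "v \<noteq> v0" using 0 by blast
    have "{x\<in>H. \<pi> x = v} \<subseteq> H - {h}" using h v by auto
    then have "card {x\<in>H. \<pi> x = v} \<le> card (H - {h})" using 0 by (intro card_mono) auto
    then show False using 0(6)[OF v] 0(1,2) h by simp
  qed
  have "perfect_matchings H = {M \<in> perfect_matchings H. linked \<pi> V M}"
    unfolding V linked_def by auto
  then show ?case using card_perfect_matchings[OF 0(1,2)] by simp
next
  case (Suc k)
  obtain h where h: "h \<in> H" "\<pi> h = v0" using Suc.prems by blast
  define F where "F = {x\<in>H. \<pi> x = v0}"
  define Y where "Y = {h'\<in>H - {h}. \<not> (\<pi> h' = v0 \<and> card F = 2)}"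
  have finF: "finite F" unfolding F_def using Suc.prems by auto
  have cardY: "2 * Suc k \<le> card Y"
  proof (cases "card F = 2")
    case True
    have "Y = H - F" unfolding Y_def F_def using True h by (auto simp: F_def)
    then show ?thesis using True finF Suc.prems(1,2) by (subst \<open>Y = H - F\<close>, subst card_Diff_subset) (auto simp: F_def)
  next
    case False
    then have "Y = H - {h}" unfolding Y_def by auto
    then show ?thesis using Suc.prems h by simp
  qed
  have step: "2 ^ k * fact k \<le> card {M \<in> perfect_matchings (H - {h, h'}). linked \<pi> V (insert {h, h'} M)}"
    if h': "h' \<in> Y" for h'
  proof -
    have h'H: "h' \<in> H" "h' \<noteq> h" using h' unfolding Y_def by auto
    define \<pi>' where "\<pi>' = (\<lambda>x. if \<pi> x = \<pi> h' then \<pi> h else \<pi> x)"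
    define V' where "V' = insert (\<pi> h) (V - {\<pi> h'})"
    define H' where "H' = H - {h, h'}"
    have le: "2 ^ k * fact k \<le> card {M \<in> perfect_matchings H'. linked \<pi>' V' M}"
    proof (rule Suc.IH)
      show "finite H'" "card H' = 2 * Suc k"
        unfolding H'_def using Suc.prems h h'H by (auto simp: card_Diff_subset card_2_iff')
      show "\<pi>' ` H' \<subseteq> V'" using Suc.prems(3) h unfolding \<pi>'_def H'_def V'_def by auto
      show "v0 \<in> V'" unfolding V'_def using h by simp
      show "\<exists>x\<in>H'. \<pi>' x = v0"
      proof (cases "\<pi> h' = v0")
        case True
        then have "{h, h'} \<subseteq> F" "card F \<noteq> 2" using h h'H h' unfolding F_def Y_def by auto
        then have "F \<noteq> {h, h'}" using h'H by auto
        then obtain x where "x \<in> F" "x \<notin> {h, h'}" using \<open>{h, h'} \<subseteq> F\<close> by blast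
        then show ?thesis unfolding F_def H'_def \<pi>'_def using h by (intro bexI[of _ x]) auto
      next
        case False
        \<comment> \<open>The absorbed vertex brings at least one further half-edge along, which is
          now free at \<open>v0\<close>.\<close>
        then have "2 \<le> card {x\<in>H. \<pi> x = \<pi> h'}" using Suc.prems(3,6) h'H by auto
        then have "{x\<in>H. \<pi> x = \<pi> h'} \<noteq> {h'}" by auto
        then obtain x where "x \<in> H" "\<pi> x = \<pi> h'" "x \<noteq> h'" using h'H by blast
        then show ?thesis unfolding H'_def \<pi>'_def using h False by (intro bexI[of _ x]) auto
      qed
      show "2 \<le> card {x \<in> H'. \<pi>' x = v}" if "v \<in> V'" "v \<noteq> v0" for v
      proof -
        have "v \<in> V" "v \<noteq> \<pi> h'" using that h unfolding V'_def by auto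
        then have "{x \<in> H'. \<pi>' x = v} = {x \<in> H. \<pi> x = v}"
          using that h unfolding H'_def \<pi>'_def by auto
        then show ?thesis using Suc.prems(6) \<open>v \<in> V\<close> that by simp
      qed
    qed
    also have "\<dots> \<le> card {M \<in> perfect_matchings H'. linked \<pi> V (insert {h, h'} M)}"
    proof (rule card_mono)
      show "finite {M \<in> perfect_matchings H'. linked \<pi> V (insert {h, h'} M)}"
        unfolding H'_def by (rule finite_subset[OF _ finite_perfect_matchings[of "H - {h, h'}"]]) (use Suc.prems(1) in auto)
      show "{M \<in> perfect_matchings H'. linked \<pi>' V' M} \<subseteq> {M \<in> perfect_matchings H'. linked \<pi> V (insert {h, h'} M)}"
        using linked_contract[of \<pi> h' h V] perfect_matchings_edge_card unfolding \<pi>'_def V'_def by blast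
    qed
    finally show ?thesis unfolding H'_def .
  qed
  have "2 ^ Suc k * fact (Suc k) = 2 * Suc k * (2 ^ k * fact k)" by (simp add: algebra_simps)
  also have "\<dots> \<le> card Y * (2 ^ k * fact k)" using cardY by (intro mult_right_mono) auto
  also have "\<dots> = (\<Sum>h'\<in>Y. 2 ^ k * fact k)" by simp
  also have "\<dots> \<le> (\<Sum>h'\<in>Y. card {M \<in> perfect_matchings (H - {h, h'}). linked \<pi> V (insert {h, h'} M)})"
    using step by (rule sum_mono)
  also have "\<dots> \<le> (\<Sum>h'\<in>H - {h}. card {M \<in> perfect_matchings (H - {h, h'}). linked \<pi> V (insert {h, h'} M)})"
    by (rule sum_mono2) (use Suc.prems(1) in \<open>auto simp: Y_def\<close>)
  also have "\<dots> = card {M \<in> perfect_matchings H. linked \<pi> V M}"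
    by (rule card_perfect_matchings_step[symmetric]) (use Suc.prems h in auto)
  finally show ?case .
qed

text \<open>A Wallis type comparison of (2k+1)!! with (2k)!!; the induction step is (2k+1)(2k+3)
  \<le> (2k+2)^2. Under the degree condition of the preceding bound, connected matchings thus form
  at least a fraction 1/sqrt(2k+1) of all.\<close>

lemma odd_fact_sq_le: "(odd_fact (Suc k))\<^sup>2 \<le> (2 * k + 1) * (2 ^ k * fact k)\<^sup>2"
proof (induction k)
  case (Suc k)
  have "(odd_fact (Suc (Suc k)))\<^sup>2 = (2 * k + 3)\<^sup>2 * (odd_fact (Suc k))\<^sup>2"
    by (simp add: power2_eq_square algebra_simps)
  also have "\<dots> \<le> (2 * k + 3)\<^sup>2 * ((2 * k + 1) * (2 ^ k * fact k)\<^sup>2)"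
    using Suc by (intro mult_left_mono) auto
  also have "\<dots> = (2 * k + 3) * ((2 * k + 3) * (2 * k + 1)) * (2 ^ k * fact k)\<^sup>2"
    by (simp only: power2_eq_square mult_ac)
  also have "\<dots> \<le> (2 * k + 3) * (2 * Suc k)\<^sup>2 * (2 ^ k * fact k)\<^sup>2"
    by (intro mult_right_mono mult_left_mono) (auto simp: power2_eq_square algebra_simps)
  also have "\<dots> = (2 * Suc k + 1) * (2 ^ Suc k * fact (Suc k))\<^sup>2"
    by (simp add: power2_eq_square algebra_simps)
  finally show ?case .
qed simp

section \<open>Acyclic attachments of tree vertices to slots\<close>

definition attachments :: "'v set \<Rightarrow> 'w set \<Rightarrow> ('w \<Rightarrow> 'v) \<Rightarrow> ('v \<Rightarrow> 'w) set" where
  "attachments U W own = {g \<in> U \<rightarrow>\<^sub>E W. bij_betw g U W \<and>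
     (\<exists>r :: 'v \<Rightarrow> nat. \<forall>u\<in>U. own (g u) \<in> U \<longrightarrow> r (own (g u)) < r u)}"

lemma finite_attachments: "finite U \<Longrightarrow> finite W \<Longrightarrow> finite (attachments U W own)"
  unfolding attachments_def by (rule finite_subset[OF _ finite_PiE]) auto

text \<open>A slot owned outside \<open>U\<close> leaves too few slots for every element of
  \<open>U\<close> to own one, so some \<open>v\<close> owns none and can serve as a leaf. It may
  take any slot other than \<open>w0\<close>; keeping \<open>w0\<close> preserves the last
  hypothesis for the rest.\<close>

lemma card_attachments_ge:
  assumes "finite U" "finite W" "card U = Suc t" "card W = Suc t" "\<exists>w\<in>W. own w \<notin> U"
  shows "fact t \<le> card (attachments U W own)"
  using assms
proof (induction t arbitrary: U W)
  case 0
  obtain v w where vw: "U = {v}" "W = {w}" using 0 by (auto simp: card_1_singleton_iff)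
  have "(\<lambda>x\<in>U. w) \<in> attachments U W own"
    unfolding attachments_def vw using 0 vw by (auto simp: bij_betw_def)
  then have "attachments U W own \<noteq> {}" by blast
  then show ?case using finite_attachments[OF 0(1,2), of own]
    by (simp add: Suc_le_eq card_gt_0_iff)
next
  case (Suc t)
  obtain w0 where w0: "w0 \<in> W" "own w0 \<notin> U" using Suc by blast
  have "\<exists>v\<in>U. \<forall>w\<in>W. own w \<noteq> v"
  proof (rule ccontr)
    assume "\<not> ?thesis"
    then have "U \<subseteq> own ` (W - {w0})" using w0 by force
    then have "card U \<le> card (own ` (W - {w0}))" using Suc by (intro card_mono) auto
    also have "\<dots> \<le> card (W - {w0})" using Suc by (intro card_image_le) auto
    finally show False using Suc w0 by simp
  qed
  then obtain v where v: "v \<in> U" "\<And>w. w \<in> W \<Longrightarrow> own w \<noteq> v" by blast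
  define A where "A = (SIGMA w:W - {w0}. attachments (U - {v}) (W - {w}) own)"
  define \<Phi> where "\<Phi> = (\<lambda>(w, g). g(v := w) :: 'a \<Rightarrow> 'b)"
  have "fact (Suc t) = (\<Sum>w\<in>W - {w0}. fact t)" using Suc w0 by simp
  also have "\<dots> \<le> (\<Sum>w\<in>W - {w0}. card (attachments (U - {v}) (W - {w}) own))"
  proof (rule sum_mono)
    fix w assume "w \<in> W - {w0}"
    then show "fact t \<le> card (attachments (U - {v}) (W - {w}) own)"
      using Suc.prems v w0 by (intro Suc.IH) auto
  qed
  also have "\<dots> = card A" unfolding A_def using Suc
    by (subst card_SigmaI) (auto intro!: finite_attachments)
  also have "\<dots> \<le> card (attachments U W own)"
  proof (rule card_inj_on_le)
    show "inj_on \<Phi> A"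
    proof (rule inj_onI, clarify)
      fix w g w' g' assume a: "(w, g) \<in> A" "(w', g') \<in> A" "\<Phi> (w, g) = \<Phi> (w', g')"
      then have eq: "g(v := w) = g'(v := w')" unfolding \<Phi>_def by simp
      have "g v = undefined" "g' v = undefined"
        using a unfolding A_def attachments_def PiE_def extensional_def by auto
      then have "g = g'" using eq by (metis fun_upd_triv fun_upd_upd)
      then show "w = w' \<and> g = g'" using eq by (metis fun_upd_same)
    qed
    show "\<Phi> ` A \<subseteq> attachments U W own"
    proof clarify
      fix w g assume "(w, g) \<in> A"
      then have w: "w \<in> W" "w \<noteq> w0" and g: "g \<in> (U - {v}) \<rightarrow>\<^sub>E (W - {w})" "bij_betw g (U - {v}) (W - {w})"
        unfolding A_def attachments_def by auto
      obtain r :: "'a \<Rightarrow> nat" where r: "\<And>u. u \<in> U - {v} \<Longrightarrow> own (g u) \<in> U - {v} \<Longrightarrow> r (own (g u)) < r u"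
        using \<open>(w, g) \<in> A\<close> unfolding A_def attachments_def by auto
      have "g(v := w) \<in> insert v (U - {v}) \<rightarrow>\<^sub>E W"
        using g w by (auto simp: PiE_def Pi_def extensional_def)
      then have 1: "g(v := w) \<in> U \<rightarrow>\<^sub>E W" using v by (simp add: insert_absorb)
      have "bij_betw (g(v := w)) (U - {v}) (W - {w})"
        using g(2) by (rule bij_betw_cong[THEN iffD1, rotated]) auto
      then have "bij_betw (g(v := w)) (insert v (U - {v})) (insert w (W - {w}))"
        using bij_betw_combine[of _ "U - {v}" "W - {w}" "{v}" "{w}"] by (auto simp: bij_betw_def)
      then have 2: "bij_betw (g(v := w)) U W" using v w by (simp add: insert_absorb)
      \<comment> \<open>\<open>v\<close> owns no slot, so nothing is attached to it, and its rank
        can be set above that of its parent without disturbing the others.\<close>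
      define r' where "r' = r(v := Suc (r (own w)))"
      have ow: "own w \<noteq> v" using v w by auto
      have "r' (own ((g(v := w)) u)) < r' u" if "u \<in> U" "own ((g(v := w)) u) \<in> U" for u
      proof (cases "u = v")
        case True then show ?thesis using ow by (simp add: r'_def)
      next
        case False
        then have "g u \<in> W" using g that by auto
        then have "own (g u) \<noteq> v" using v by auto
        then show ?thesis using False r[of u] that by (simp add: r'_def)
      qed
      then have "\<exists>r :: 'a \<Rightarrow> nat. \<forall>u\<in>U. own ((g(v := w)) u) \<in> U \<longrightarrow> r (own ((g(v := w)) u)) < r u"
        by (intro exI[of _ r']) simp
      then show "\<Phi> (w, g) \<in> attachments U W own"
        unfolding attachments_def \<Phi>_def prod.case using 1 2 by (intro CollectI conjI)
    qed
    show "finite (attachments U W own)" using Suc finite_attachments by blast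
  qed
  finally show ?case .
qed

subsection \<open>Labelled structures\<close>

text \<open>Loops plus surplus parallel edges: the edges in excess of the distinct non-loop
  adjacencies. For finite \<open>M\<close> the subtraction never truncates, and the defect vanishes
  exactly for simple multigraphs.\<close>

definition defect :: "('h \<Rightarrow> 'v) \<Rightarrow> 'h set set \<Rightarrow> nat" where
  "defect \<pi> M = card M - card {p \<in> (`) \<pi> ` M. card p = 2}"

text \<open>Half-edges over an arbitrary vertex set and degree function, so that subsets of the
  vertices and relabelled copies are covered as well.\<close>

definition darts :: "'v set \<Rightarrow> ('v \<Rightarrow> nat) \<Rightarrow> ('v \<times> nat) set" where
  "darts V d = (SIGMA v:V. {1..d v})"

lemma finite_darts: "finite V \<Longrightarrow> finite (darts V d)"
  by (simp add: darts_def)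

lemma card_darts: "finite V \<Longrightarrow> card (darts V d) = (\<Sum>v\<in>V. d v)"
  by (simp add: darts_def)

definition labelling :: "'v set \<Rightarrow> ('v \<Rightarrow> nat) \<Rightarrow> ('v \<Rightarrow> nat set) \<Rightarrow> bool" where
  "labelling V d L \<longleftrightarrow> finite V \<and> (\<forall>v\<in>V. L v \<subseteq> {1..d v} \<and> L v \<noteq> {})"

definition tree_vs :: "'v set \<Rightarrow> ('v \<Rightarrow> nat set) \<Rightarrow> 'v set" where
  "tree_vs V L = {v \<in> V. card (L v) = 1}"

definition core_vs :: "'v set \<Rightarrow> ('v \<Rightarrow> nat set) \<Rightarrow> 'v set" where
  "core_vs V L = {v \<in> V. 2 \<le> card (L v)}"

definition core_he :: "'v set \<Rightarrow> ('v \<Rightarrow> nat set) \<Rightarrow> ('v \<times> nat) set" where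
  "core_he V L = Sigma (core_vs V L) L"

definition slots :: "'v set \<Rightarrow> ('v \<Rightarrow> nat) \<Rightarrow> ('v \<Rightarrow> nat set) \<Rightarrow> ('v \<times> nat) set" where
  "slots V d L = (SIGMA v:V. {1..d v} - L v)"

text \<open>Meaningful at tree vertices only, where the label set is a singleton.\<close>

definition tip :: "('v \<Rightarrow> nat set) \<Rightarrow> 'v \<Rightarrow> 'v \<times> nat" where
  "tip L v = (v, the_elem (L v))"

definition glue :: "'v set \<Rightarrow> ('v \<Rightarrow> nat set) \<Rightarrow> ('v \<Rightarrow> 'v \<times> nat) \<Rightarrow> ('v \<times> nat) set set \<Rightarrow> ('v \<times> nat) set set" where
  "glue V L g C = C \<union> (\<lambda>u. {tip L u, g u}) ` tree_vs V L"

text \<open>The rank \<open>r\<close> decreases towards the core, so that the tree vertices form a forest.\<close>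

definition fits :: "'v set \<Rightarrow> ('v \<Rightarrow> nat) \<Rightarrow> ('v \<Rightarrow> nat set) \<Rightarrow> ('v \<times> nat) set set \<Rightarrow> ('v \<Rightarrow> nat) \<Rightarrow> bool" where
  "fits V d L M r \<longleftrightarrow> (\<forall>e\<in>M. e \<subseteq> core_he V L \<or>
     (\<exists>u\<in>tree_vs V L. \<exists>w\<in>slots V d L. e = {tip L u, w} \<and>
        (fst w \<in> tree_vs V L \<longrightarrow> r (fst w) < r u)))"

lemma fst_tip [simp]: "fst (tip L v) = v"
  by (simp add: tip_def)

lemma tip_tree:
  assumes "u \<in> tree_vs V L"
  shows "L u = {snd (tip L u)}"
proof -
  obtain i where "L u = {i}" using assms by (auto simp: tree_vs_def card_1_singleton_iff)
  then show ?thesis by (simp add: tip_def)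
qed

lemma labelling_cases:
  assumes "labelling V d L" "v \<in> V"
  shows "v \<in> tree_vs V L \<or> v \<in> core_vs V L"
proof -
  have "finite (L v)" "L v \<noteq> {}"
    using assms finite_subset[of "L v" "{1..d v}"] by (auto simp: labelling_def)
  then have "card (L v) \<noteq> 0" by simp
  then show ?thesis using assms unfolding tree_vs_def core_vs_def by auto
qed

lemma snd_tip: "u \<in> tree_vs V L \<Longrightarrow> snd (tip L u) \<in> L u"
  using tip_tree by (metis insertI1)

lemma tip_in_darts: "labelling V d L \<Longrightarrow> u \<in> tree_vs V L \<Longrightarrow> tip L u \<in> darts V d"
  using snd_tip[of u V L] unfolding labelling_def tree_vs_def darts_def
  by (metis (no_types, lifting) fst_tip mem_Collect_eq mem_Sigma_iff prod.collapse subsetD)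

lemma core_subset_darts: "labelling V d L \<Longrightarrow> core_he V L \<subseteq> darts V d"
  by (auto simp: labelling_def core_he_def core_vs_def darts_def)

lemma slots_subset_darts: "slots V d L \<subseteq> darts V d"
  by (auto simp: slots_def darts_def)

lemma tip_notin_slots: "u \<in> tree_vs V L \<Longrightarrow> tip L u \<notin> slots V d L"
  using snd_tip[of u V L] unfolding slots_def
  by (metis DiffD2 fst_tip mem_Sigma_iff prod.collapse)

lemma tip_notin_core: "u \<in> tree_vs V L \<Longrightarrow> tip L u \<notin> core_he V L"
  by (auto simp: core_he_def core_vs_def tip_def tree_vs_def)

lemma core_disj_slots: "x \<in> core_he V L \<Longrightarrow> x \<notin> slots V d L"
  by (auto simp: core_he_def slots_def)

lemma core_disj_tree: "v \<in> core_vs V L \<Longrightarrow> v \<notin> tree_vs V L"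
  by (auto simp: core_vs_def tree_vs_def)

lemma labelling_tree_eq: "labelling V d L \<Longrightarrow> tree_vs V L = V - core_vs V L"
  using labelling_cases[of V d L] core_disj_tree[of _ V L] by (auto simp: tree_vs_def)

lemma tip_inj: "tip L u = tip L v \<Longrightarrow> u = v"
  by (simp add: tip_def)

lemma darts_cases:
  assumes "labelling V d L" "x \<in> darts V d"
  obtains "x \<in> core_he V L" | u where "u \<in> tree_vs V L" "x = tip L u" | "x \<in> slots V d L"
proof -
  obtain v i where x: "x = (v, i)" "v \<in> V" "i \<in> {1..d v}" using assms by (auto simp: darts_def)
  consider "i \<notin> L v" | "i \<in> L v" "v \<in> tree_vs V L" | "i \<in> L v" "v \<in> core_vs V L"
    using labelling_cases[OF assms(1) x(2)] by blast
  then show ?thesis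
  proof cases
    case 1 then show ?thesis using that(3) x by (simp add: slots_def)
  next
    case 2
    then have "i = snd (tip L v)" using tip_tree[OF 2(2)] by (metis singletonD)
    then have "x = tip L v" using x(1) by (simp add: tip_def)
    then show ?thesis using that(2) 2 by blast
  next
    case 3 then show ?thesis using that(1) x by (simp add: core_he_def)
  qed
qed

section \<open>Uniqueness of the labels\<close>

lemma fits_core:
  assumes "fits V d L M r" "{h, h'} \<in> M" "h \<in> core_he V L"
  shows "h' \<in> core_he V L"
  using assms tip_notin_core core_disj_slots unfolding fits_def
  by (metis doubleton_eq_iff insert_subset)

lemma fits_slot:
  assumes "fits V d L M r" "{h, h'} \<in> M" "h \<in> slots V d L"
  shows "\<exists>y\<in>tree_vs V L. h' = tip L y \<and> (fst h \<in> tree_vs V L \<longrightarrow> r (fst h) < r y)"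
proof -
  have "h \<notin> core_he V L" using core_disj_slots assms(3) by blast
  then obtain u w where uw: "u \<in> tree_vs V L" "w \<in> slots V d L" "{h, h'} = {tip L u, w}"
    "fst w \<in> tree_vs V L \<longrightarrow> r (fst w) < r u"
    using assms(1,2) unfolding fits_def by (metis insert_subset)
  moreover have "h \<noteq> tip L u" using tip_notin_slots[OF uw(1)] assms(3) by metis
  ultimately show ?thesis by (auto simp: doubleton_eq_iff)
qed

lemma fits_tip:
  assumes "fits V d L M r" "{tip L u, h'} \<in> M" "u \<in> tree_vs V L"
  shows "h' \<in> slots V d L" "fst h' \<in> tree_vs V L \<Longrightarrow> r (fst h') < r u"
proof -
  have "tip L u \<notin> core_he V L" by (rule tip_notin_core[OF assms(3)])
  then obtain v w where uw: "v \<in> tree_vs V L" "w \<in> slots V d L" "{tip L u, h'} = {tip L v, w}"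
    "fst w \<in> tree_vs V L \<longrightarrow> r (fst w) < r v"
    using assms(1,2) unfolding fits_def by (metis insert_subset)
  moreover have "tip L u \<noteq> w" using tip_notin_slots[OF assms(3)] uw(2) by metis
  ultimately have "u = v \<and> h' = w" by (auto simp: doubleton_eq_iff dest: tip_inj)
  then show "h' \<in> slots V d L" "fst h' \<in> tree_vs V L \<Longrightarrow> r (fst h') < r u" using uw by auto
qed

lemma perfect_matchings_partner:
  assumes "M \<in> perfect_matchings H" "h \<in> H"
  obtains h' where "{h, h'} \<in> M" "h' \<noteq> h" "h' \<in> H"
proof -
  obtain e where e: "e \<in> M" "h \<in> e" using perfect_matchings_edge_ex assms by metis
  obtain h' where "e = {h, h'}" "h' \<noteq> h"
    using e perfect_matchings_edge_card[OF assms(1)] by (metis card_2_iff doubleton_eq_iff insertE singletonD)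
  then show ?thesis using that e perfect_matchings_edge_subset[OF assms(1)] by blast
qed

text \<open>
  Of the vertices in the first core but not in the second, one of maximal rank has a child in the
  second forest that is again in the first core, contradicting maximality.
\<close>

lemma fits_core_subset:
  assumes L: "labelling V d L" "labelling V d L'" and M: "M \<in> perfect_matchings (darts V d)"
    and f: "fits V d L M r" "fits V d L' M r'"
  shows "core_vs V L \<subseteq> core_vs V L'"
proof (rule ccontr)
  assume neg: "\<not> core_vs V L \<subseteq> core_vs V L'"
  define X where "X = core_vs V L - core_vs V L'"
  have X: "finite X" "X \<noteq> {}"
    using neg L unfolding X_def by (auto simp: core_vs_def labelling_def)
  obtain x where x: "x \<in> X" and max: "\<And>y. y \<in> X \<Longrightarrow> r' y \<le> r' x"
    by (metis (no_types, lifting) obtains_MAX[OF X, of r'] Max_ge[OF finite_imageI[OF X(1)]] imageI)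
  have xV: "x \<in> V" "2 \<le> card (L x)" using x unfolding X_def core_vs_def by auto
  have xT: "x \<in> tree_vs V L'" using labelling_cases[OF L(2) xV(1)] x unfolding X_def by blast
  have "\<not> L x \<subseteq> L' x"
  proof
    assume "L x \<subseteq> L' x"
    then have "L x \<subseteq> {snd (tip L' x)}" using tip_tree[OF xT] by simp
    then have "card (L x) \<le> 1" using card_mono[of "{snd (tip L' x)}" "L x"] by simp
    then show False using xV(2) by simp
  qed
  then obtain i where i: "i \<in> L x" "i \<notin> L' x" by blast
  have hc: "(x, i) \<in> core_he V L" using i x by (simp add: core_he_def X_def)
  then have hHE: "(x, i) \<in> darts V d" using core_subset_darts L by blast
  then have hs: "(x, i) \<in> slots V d L'" using i by (simp add: slots_def darts_def)
  obtain h' where h': "{(x, i), h'} \<in> M" using perfect_matchings_partner[OF M hHE] by blast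
  obtain y where y: "y \<in> tree_vs V L'" "h' = tip L' y" "r' x < r' y"
    using fits_slot[OF f(2) h' hs] xT by auto
  have "h' \<in> core_he V L" using fits_core[OF f(1) h' hc] .
  then have "y \<in> core_vs V L" using y by (auto simp: core_he_def tip_def)
  then have "y \<in> X" unfolding X_def using y core_disj_tree[of y V L'] by blast
  then show False using max y by fastforce
qed

text \<open>Equal cores leave equal sets of tree vertices. In the core, a half-edge labelled by only
  one of the two would be matched with a tip at a core vertex. At a tree vertex \<open>x\<close>
  with two different tips, the tip of \<open>L'\<close> is a slot of \<open>L\<close>, and its
  partner sits at a vertex of smaller rank \<open>r'\<close> where the labels differ again.\<close>

lemma fits_unique:
  assumes L: "labelling V d L" "labelling V d L'" and M: "M \<in> perfect_matchings (darts V d)"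
    and f: "fits V d L M r" "fits V d L' M r'" and v: "v \<in> V"
  shows "L v = L' v"
proof -
  have K: "core_vs V L = core_vs V L'"
    using fits_core_subset[OF L M f] fits_core_subset[OF L(2,1) M f(2,1)] by blast
  have U: "tree_vs V L = tree_vs V L'"
    using K labelling_tree_eq[OF L(1)] labelling_tree_eq[OF L(2)] by simp
  have coreE: "i \<in> L2 x" if hyp: "x \<in> core_vs V L1" "i \<in> L1 x" "core_vs V L1 = core_vs V L2"
      "labelling V d L1" "labelling V d L2" "fits V d L1 M r1" "fits V d L2 M r2"
    for L1 L2 :: "'a \<Rightarrow> nat set" and r1 r2 x i
  proof (rule ccontr)
    assume "i \<notin> L2 x"
    have hc: "(x, i) \<in> core_he V L1" using hyp by (simp add: core_he_def)
    then have hHE: "(x, i) \<in> darts V d" using core_subset_darts hyp by blast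
    then have hs: "(x, i) \<in> slots V d L2" using \<open>i \<notin> L2 x\<close> by (simp add: slots_def darts_def)
    obtain h' where h': "{(x, i), h'} \<in> M" using perfect_matchings_partner[OF M hHE] by blast
    obtain y where y: "y \<in> tree_vs V L2" "h' = tip L2 y"
      using fits_slot[OF hyp(7) h' hs] by auto
    have "h' \<in> core_he V L1" using fits_core[OF hyp(6) h' hc] .
    then have "y \<in> core_vs V L2" using y hyp(3) by (auto simp: core_he_def tip_def)
    then show False using y core_disj_tree[of y V L2] by blast
  qed
  have treeE: "L x = L' x" if "x \<in> tree_vs V L" for x
    using that
  proof (induction "r' x" arbitrary: x rule: less_induct)
    case less
    show ?case
    proof (rule ccontr)
      assume ne: "L x \<noteq> L' x"
      have xU: "x \<in> tree_vs V L'" using less U by simp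
      have tHE: "tip L' x \<in> darts V d" using tip_in_darts[OF L(2) xU] .
      have "tip L' x \<in> slots V d L"
      proof -
        obtain i j where ij: "L x = {i}" "L' x = {j}" using tip_tree[OF xU] tip_tree[OF less.prems] by blast
        then have "tip L' x = (x, j)" "j \<notin> L x" using ne by (auto simp: tip_def)
        then show ?thesis using tHE by (simp add: slots_def darts_def)
      qed
      moreover obtain h' where h': "{tip L' x, h'} \<in> M" using perfect_matchings_partner[OF M tHE] by blast
      ultimately obtain y where y: "y \<in> tree_vs V L" "h' = tip L y"
        using fits_slot[OF f(1)] by blast
      have "h' \<in> slots V d L'" "y \<in> tree_vs V L' \<Longrightarrow> r' y < r' x"
        using fits_tip[OF f(2) h' xU] y by auto
      moreover have "y \<in> tree_vs V L'" using y U by simp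
      ultimately show False using less.hyps[of y] y tip_notin_slots[of y V L' d] by (simp add: tip_def)
    qed
  qed
  show ?thesis
    using labelling_cases[OF L(1) v]
  proof
    assume "v \<in> core_vs V L"
    then show ?thesis using coreE[of v L _ L' r r'] coreE[of v L' _ L r' r] K L f by blast
  qed (use treeE in auto)
qed

section \<open>Gluing a forest to a core matching\<close>

lemma glue_in_perfect_matchings:
  assumes L: "labelling V d L" and g: "bij_betw g (tree_vs V L) (slots V d L)"
    and C: "C \<in> perfect_matchings (core_he V L)"
  shows "glue V L g C \<in> perfect_matchings (darts V d)"
proof (rule pmsI)
  have gs: "g u \<in> slots V d L" if "u \<in> tree_vs V L" for u using g that by (auto simp: bij_betw_def)
  have ne: "tip L u \<noteq> g v" if "u \<in> tree_vs V L" "v \<in> tree_vs V L" for u v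
    using gs[of v] that tip_notin_slots[of u V L d] by metis
  show "e \<subseteq> darts V d" if e: "e \<in> glue V L g C" for e
  proof -
    consider "e \<in> C" | u where "u \<in> tree_vs V L" "e = {tip L u, g u}" using e unfolding glue_def by blast
    then show ?thesis
    proof cases
      case 1 then show ?thesis using core_subset_darts[OF L] perfect_matchings_edge_subset[OF C] by blast
    next
      case 2 then show ?thesis using gs[of u] tip_in_darts[OF L, of u] slots_subset_darts[of V d L] by blast
    qed
  qed
  show "card e = 2" if "e \<in> glue V L g C" for e
    using that ne perfect_matchings_edge_card[OF C] unfolding glue_def by auto
  show "\<exists>e\<in>glue V L g C. x \<in> e" if "x \<in> darts V d" for x
  proof (rule darts_cases[OF L that])
    assume "x \<in> core_he V L" then show ?thesis using perfect_matchings_edge_ex[OF C] unfolding glue_def by blast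
  next
    fix u assume "u \<in> tree_vs V L" "x = tip L u"
    then show ?thesis unfolding glue_def by blast
  next
    assume "x \<in> slots V d L"
    then obtain u where "u \<in> tree_vs V L" "x = g u" using g by (auto simp: bij_betw_def)
    then show ?thesis unfolding glue_def by blast
  qed
  have cross: False if "e \<in> C" "x \<in> e" "u \<in> tree_vs V L" "x \<in> {tip L u, g u}" for e x u
  proof -
    have "x \<in> core_he V L" using that perfect_matchings_edge_subset[OF C] by blast
    then show False using that(3,4) gs[of u] core_disj_slots[of x V L d] tip_notin_core[of u V L] by auto
  qed
  have tt: "u = v" if "u \<in> tree_vs V L" "v \<in> tree_vs V L" "x \<in> {tip L u, g u}" "x \<in> {tip L v, g v}" for u v x
    using that ne[of u v] ne[of v u] bij_betw_imp_inj_on[OF g, THEN inj_onD, of u v]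
    by (auto dest: tip_inj)
  show "e = f" if ef: "e \<in> glue V L g C" "f \<in> glue V L g C" "x \<in> e" "x \<in> f" for e f x
  proof -
    consider "e \<in> C" "f \<in> C" | u where "e \<in> C" "u \<in> tree_vs V L" "f = {tip L u, g u}"
      | u where "f \<in> C" "u \<in> tree_vs V L" "e = {tip L u, g u}"
      | u v where "u \<in> tree_vs V L" "v \<in> tree_vs V L" "e = {tip L u, g u}" "f = {tip L v, g v}"
      using ef(1,2) unfolding glue_def by blast
    then show ?thesis
    proof cases
      case 1 then show ?thesis using perfect_matchings_edge_unique[OF C] ef(3,4) by metis
    next
      case 2 then show ?thesis using cross[of e x u] ef by simp
    next
      case 3 then show ?thesis using cross[of f x u] ef by simp
    next
      case 4 then show ?thesis using tt[of u v x] ef by simp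
    qed
  qed
qed

lemma fits_glue:
  assumes "bij_betw g (tree_vs V L) (slots V d L)" "C \<in> perfect_matchings (core_he V L)"
    and "\<And>u. u \<in> tree_vs V L \<Longrightarrow> fst (g u) \<in> tree_vs V L \<Longrightarrow> r (fst (g u)) < r u"
  shows "fits V d L (glue V L g C) r"
  unfolding fits_def
proof
  fix e assume "e \<in> glue V L g C"
  then consider "e \<in> C" | u where "u \<in> tree_vs V L" "e = {tip L u, g u}" unfolding glue_def by blast
  then show "e \<subseteq> core_he V L \<or> (\<exists>u\<in>tree_vs V L. \<exists>w\<in>slots V d L. e = {tip L u, w} \<and>
        (fst w \<in> tree_vs V L \<longrightarrow> r (fst w) < r u))"
  proof cases
    case 1 then show ?thesis using perfect_matchings_edge_subset[OF assms(2)] by blast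
  next
    case 2
    then have "g u \<in> slots V d L" using assms(1) by (auto simp: bij_betw_def)
    then show ?thesis using 2 assms(3) by blast
  qed
qed

lemma edge_rel_mono: "M \<subseteq> M' \<Longrightarrow> edge_rel \<pi> M \<subseteq> edge_rel \<pi> M'"
  unfolding edge_rel_def by blast

text \<open>Along the tips the ranks drop until the core is reached, and the core is connected by
  itself.\<close>

lemma linked_glue:
  assumes L: "labelling V d L" and g: "bij_betw g (tree_vs V L) (slots V d L)"
    and C: "linked fst (core_vs V L) C"
    and r: "\<And>u. u \<in> tree_vs V L \<Longrightarrow> fst (g u) \<in> tree_vs V L \<Longrightarrow> (r (fst (g u)) :: nat) < r u"
  shows "linked fst V (glue V L g C)"
proof -
  define R where "R = edge_rel fst (glue V L g C)"
  have tree: "\<exists>k\<in>core_vs V L. (v, k) \<in> R\<^sup>*" if "v \<in> tree_vs V L" for v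
    using that
  proof (induction "r v" arbitrary: v rule: less_induct)
    case less
    have "(fst (tip L v), fst (g v)) \<in> R" unfolding R_def
      by (rule edge_relI) (use less in \<open>auto simp: glue_def\<close>)
    then have step: "(v, fst (g v)) \<in> R" by simp
    have "g v \<in> slots V d L" using g less.prems by (auto simp: bij_betw_def)
    then have "fst (g v) \<in> V" by (auto simp: slots_def)
    then consider "fst (g v) \<in> tree_vs V L" | "fst (g v) \<in> core_vs V L" using labelling_cases[OF L] by blast
    then show ?case
    proof cases
      case 1
      then obtain k where "k \<in> core_vs V L" "(fst (g v), k) \<in> R\<^sup>*" using less r by blast
      then show ?thesis using step by (meson converse_rtrancl_into_rtrancl)
    next
      case 2 then show ?thesis using step by blast
    qed
  qed
  have ex: "\<exists>k\<in>core_vs V L. (v, k) \<in> R\<^sup>*" if "v \<in> V" for v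
    using tree labelling_cases[OF L that] by blast
  have sub: "(edge_rel fst C)\<^sup>* \<subseteq> R\<^sup>*"
    unfolding R_def by (intro rtrancl_mono edge_rel_mono) (auto simp: glue_def)
  show ?thesis unfolding linked_def
  proof (intro ballI)
    fix u v assume "u \<in> V" "v \<in> V"
    then obtain k l where kl: "k \<in> core_vs V L" "l \<in> core_vs V L" "(u, k) \<in> R\<^sup>*" "(v, l) \<in> R\<^sup>*"
      using ex by blast
    have "(k, l) \<in> R\<^sup>*" using C kl sub unfolding linked_def by blast
    moreover have "(l, v) \<in> R\<^sup>*" using kl(4) edge_rel_rtrancl_sym unfolding R_def by metis
    ultimately show "(u, v) \<in> (edge_rel fst (glue V L g C))\<^sup>*" using kl(3) unfolding R_def by simp
  qed
qed

text \<open>Trees create neither loops nor parallel edges: the ranks forbid a vertex to be its own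
  parent and two vertices to be parents of each other, and a tree edge has an end outside the core.
  So every new edge brings a new adjacency.\<close>

lemma defect_glue:
  assumes L: "labelling V d L" and g: "bij_betw g (tree_vs V L) (slots V d L)"
    and C: "C \<in> perfect_matchings (core_he V L)"
    and r: "\<And>u. u \<in> tree_vs V L \<Longrightarrow> fst (g u) \<in> tree_vs V L \<Longrightarrow> (r (fst (g u)) :: nat) < r u"
  shows "defect fst (glue V L g C) \<le> defect fst C"
proof -
  define U where "U = tree_vs V L"
  define D where "D = {p \<in> (`) fst ` C. card p = 2}"
  define D' where "D' = {p \<in> (`) fst ` glue V L g C. card p = 2}"
  define B where "B = (\<lambda>u. {u, fst (g u)}) ` U"
  have finU: "finite U" using L unfolding U_def by (simp add: labelling_def tree_vs_def)
  have finV: "finite V" using L by (simp add: labelling_def)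
  have "finite C" using finite_of_perfect_matchings[OF _ C] finite_subset[OF core_subset_darts[OF L] finite_darts[OF finV]] by blast
  then have fin: "finite C" "finite D" "finite D'" "finite B"
    using finU unfolding D_def D'_def B_def glue_def U_def by auto
  have ne: "u \<noteq> fst (g u)" if "u \<in> U" for u
  proof
    assume a: "u = fst (g u)"
    show False using r[of u] that unfolding U_def[symmetric] using a[symmetric] by simp
  qed
  have injB: "inj_on (\<lambda>u. {u, fst (g u)}) U"
  proof (rule inj_onI, rule ccontr)
    fix u v assume uv: "u \<in> U" "v \<in> U" "{u, fst (g u)} = {v, fst (g v)}" "u \<noteq> v"
    then have "u = fst (g v)" "v = fst (g u)" by (auto simp: doubleton_eq_iff)
    then show False using r[of u] r[of v] uv unfolding U_def by (metis order_less_asym)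
  qed
  have "B \<subseteq> D'"
  proof
    fix p assume "p \<in> B"
    then obtain u where u: "u \<in> U" "p = {u, fst (g u)}" unfolding B_def by blast
    then have "p = fst ` {tip L u, g u}" "{tip L u, g u} \<in> glue V L g C" by (auto simp: glue_def U_def)
    moreover have "card p = 2" using ne[OF u(1)] unfolding u(2) by (simp add: card_insert_if)
    ultimately show "p \<in> D'" unfolding D'_def by blast
  qed
  moreover have "D \<subseteq> D'" unfolding D_def D'_def glue_def by auto
  moreover have "D \<inter> B = {}"
  proof (rule equals0I)
    fix p assume p: "p \<in> D \<inter> B"
    then obtain e u where e: "e \<in> C" "p = fst ` e" "u \<in> U" "p = {u, fst (g u)}" unfolding D_def B_def by auto
    have "u \<in> fst ` e" using e(2,4) by (metis insertI1)
    then have "u \<in> fst ` core_he V L" using perfect_matchings_edge_subset[OF C e(1)] by blast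
    then have "u \<in> core_vs V L" by (auto simp: core_he_def)
    then show False using e(3) core_disj_tree[of u V L] unfolding U_def by blast
  qed
  ultimately have "card D + card B \<le> card D'"
    using fin card_mono[of D' "D \<union> B"] by (simp add: card_Un_disjoint)
  moreover have "card B = card U" unfolding B_def using injB by (rule card_image)
  moreover have "card (glue V L g C) \<le> card C + card U"
    unfolding glue_def U_def[symmetric]
    using card_Un_le[of C "(\<lambda>u. {tip L u, g u}) ` U"] card_image_le[OF finU, of "\<lambda>u. {tip L u, g u}"] by linarith
  ultimately show ?thesis unfolding defect_def D_def[symmetric] D'_def[symmetric] by linarith
qed

text \<open>The pair is recovered from the result: the core matching consists of the edges inside
  the core, and \<open>g u\<close> is the partner of the tip at \<open>u\<close>.\<close>

lemma card_glue_ge: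
  assumes L: "labelling V d L"
    and T: "card (tree_vs V L) = Suc t" "card (slots V d L) = Suc t"
    and w: "\<exists>w\<in>slots V d L. fst w \<notin> tree_vs V L"
  shows "fact t * card {C \<in> perfect_matchings (core_he V L). linked fst (core_vs V L) C \<and> defect fst C \<le> b}
    \<le> card {M \<in> perfect_matchings (darts V d). linked fst V M \<and> defect fst M \<le> b \<and> (\<exists>r. fits V d L M r)}"
    (is "_ * card ?X \<le> card ?Y")
proof -
  define U where "U = tree_vs V L"
  define W where "W = slots V d L"
  define A where "A = attachments U W fst"
  have finV: "finite V" using L by (simp add: labelling_def)
  have finU: "finite U" unfolding U_def tree_vs_def using finV by simp
  have finW: "finite W" unfolding W_def using finite_subset[OF slots_subset_darts finite_darts[OF finV]] .
  have "fact t * card ?X \<le> card A * card ?X"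
    unfolding A_def using card_attachments_ge[OF finU finW] T w unfolding U_def W_def
    by (intro mult_right_mono) auto
  also have "\<dots> = card (A \<times> ?X)" by (simp add: card_cartesian_product)
  also have "\<dots> \<le> card ?Y"
  proof (rule card_inj_on_le)
    show "finite ?Y" using finite_perfect_matchings[OF finite_darts[OF finV]] by simp
    show "(\<lambda>(g, C). glue V L g C) ` (A \<times> ?X) \<subseteq> ?Y"
    proof clarify
      fix g C assume g: "g \<in> A" and C: "C \<in> perfect_matchings (core_he V L)" "linked fst (core_vs V L) C" "defect fst C \<le> b"
      then obtain r :: "'a \<Rightarrow> nat" where bij: "bij_betw g U W"
        and r: "\<And>u. u \<in> U \<Longrightarrow> fst (g u) \<in> U \<Longrightarrow> r (fst (g u)) < r u"
        unfolding A_def attachments_def by auto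
      note bij' = bij[unfolded U_def W_def] and r' = r[unfolded U_def]
      show "glue V L g C \<in> perfect_matchings (darts V d) \<and> linked fst V (glue V L g C) \<and> defect fst (glue V L g C) \<le> b
          \<and> (\<exists>r. fits V d L (glue V L g C) r)"
        using glue_in_perfect_matchings[OF L bij' C(1)] linked_glue[OF L bij' C(2), of r] r'
          fits_glue[OF bij' C(1), of r] defect_glue[OF L bij' C(1), of r] C(3) by fastforce
    qed
    show "inj_on (\<lambda>(g, C). glue V L g C) (A \<times> ?X)"
    proof (rule inj_onI, clarify)
      fix g C g' C'
      assume g: "g \<in> A" "g' \<in> A" and C: "C \<in> perfect_matchings (core_he V L)" "C' \<in> perfect_matchings (core_he V L)"
        and eq: "glue V L g C = glue V L g' C'"
      have bij: "bij_betw g U W" "bij_betw g' U W" and ext: "g \<in> U \<rightarrow>\<^sub>E W" "g' \<in> U \<rightarrow>\<^sub>E W"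
        using g unfolding A_def attachments_def by auto
      have Ceq: "C1 = {e \<in> glue V L g1 C1. e \<subseteq> core_he V L}" if "C1 \<in> perfect_matchings (core_he V L)" for g1 C1
      proof -
        have "\<not> {tip L u, w} \<subseteq> core_he V L" if "u \<in> tree_vs V L" for u w
          using tip_notin_core[OF that] by simp
        then show ?thesis using perfect_matchings_edge_subset[OF that] unfolding glue_def by blast
      qed
      have "C = C'" using Ceq[OF C(1), of g] Ceq[OF C(2), of g'] eq by simp
      moreover have "g = g'"
      proof (rule PiE_ext[OF ext])
        fix u assume u: "u \<in> U"
        have "{tip L u, g u} \<in> glue V L g C" "{tip L u, g' u} \<in> glue V L g C"
          using u eq unfolding U_def glue_def by auto
        then have "{tip L u, g u} = {tip L u, g' u}"
          using perfect_matchings_edge_unique[OF glue_in_perfect_matchings[OF L bij(1)[unfolded U_def W_def] C(1)]] by (metis insertI1)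
        moreover have "g u \<noteq> tip L u" "g' u \<noteq> tip L u"
          using bij u tip_notin_slots[of u V L d] unfolding U_def W_def bij_betw_def by force+
        ultimately show "g u = g' u" by (auto simp: doubleton_eq_iff)
      qed
      ultimately show "g = g' \<and> C = C'" by simp
    qed
  qed
  finally show ?thesis .
qed

text \<open>By \<open>fits_unique\<close> the matchings belonging to different labellings are
  disjoint, so their numbers add up. As that lemma compares labels on \<open>V\<close> only, the
  labellings are taken extensional.\<close>

lemma card_linked_ge_labellings:
  assumes finV: "finite V" and fin: "finite \<L>" and ext: "\<And>L. L \<in> \<L> \<Longrightarrow> L \<in> extensional V \<and> labelling V d L"
    and ge: "\<And>L. L \<in> \<L> \<Longrightarrow> x \<le>
      card {M \<in> perfect_matchings (darts V d). linked fst V M \<and> defect fst M \<le> b \<and> (\<exists>r. fits V d L M r)}"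
  shows "card \<L> * x \<le> card {M \<in> perfect_matchings (darts V d). linked fst V M \<and> defect fst M \<le> b}"
proof -
  define Y where "Y = (\<lambda>L. {M \<in> perfect_matchings (darts V d). linked fst V M \<and> defect fst M \<le> b \<and> (\<exists>r. fits V d L M r)})"
  have fp: "finite (perfect_matchings (darts V d))" using finite_perfect_matchings finite_darts finV by blast
  have "card \<L> * x = (\<Sum>L\<in>\<L>. x)" by simp
  also have "\<dots> \<le> (\<Sum>L\<in>\<L>. card (Y L))" unfolding Y_def using ge by (rule sum_mono)
  also have "\<dots> = card (\<Union>L\<in>\<L>. Y L)"
  proof (rule card_UN_disjoint[symmetric, OF fin])
    show "\<forall>L\<in>\<L>. finite (Y L)" unfolding Y_def using fp by simp
    show "\<forall>L\<in>\<L>. \<forall>L'\<in>\<L>. L \<noteq> L' \<longrightarrow> Y L \<inter> Y L' = {}"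
    proof (intro ballI impI equals0I)
      fix L L' M assume a: "L \<in> \<L>" "L' \<in> \<L>" "L \<noteq> L'" "M \<in> Y L \<inter> Y L'"
      then obtain r r' where "fits V d L M r" "fits V d L' M r'" "M \<in> perfect_matchings (darts V d)" unfolding Y_def by blast
      then have "L v = L' v" if "v \<in> V" for v
        using fits_unique[OF _ _ _ _ _ that] ext a(1,2) by blast
      then have "L = L'" using ext a(1,2) by (meson extensionalityI)
      then show False using a by simp
    qed
  qed
  also have "\<dots> \<le> card {M \<in> perfect_matchings (darts V d). linked fst V M \<and> defect fst M \<le> b}"
    by (rule card_mono) (use fp in \<open>auto simp: Y_def\<close>)
  finally show ?thesis .
qed

subsection \<open>Loops and parallel edges\<close>

definition links :: "('h \<Rightarrow> 'v) \<Rightarrow> 'h set set \<Rightarrow> 'v set set" where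
  "links \<pi> M = {p \<in> (`) \<pi> ` M. card p = 2}"

lemma finite_links: "finite M \<Longrightarrow> finite (links \<pi> M)"
  by (simp add: links_def)

lemma defect_links: "defect \<pi> M = card M - card (links \<pi> M)"
  by (simp add: defect_def links_def)

lemma defect_pos_cases:
  assumes "finite M" "0 < defect \<pi> M"
  obtains e where "e \<in> M" "card (\<pi> ` e) \<noteq> 2"
  | e e' where "e \<in> M" "e' \<in> M" "e' \<noteq> e" "\<pi> ` e' = \<pi> ` e"
proof -
  have "\<not> (inj_on ((`) \<pi>) M \<and> (\<forall>e\<in>M. card (\<pi> ` e) = 2))"
  proof
    assume a: "inj_on ((`) \<pi>) M \<and> (\<forall>e\<in>M. card (\<pi> ` e) = 2)"
    then have "links \<pi> M = (`) \<pi> ` M" unfolding links_def by auto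
    then have "card (links \<pi> M) = card M" using a card_image by metis
    then show False using assms by (simp add: defect_links)
  qed
  then show ?thesis using that unfolding inj_on_def by metis
qed

definition switches :: "'h set \<Rightarrow> 'h set set \<Rightarrow> 'h set set set" where
  "switches H M = (\<lambda>((e, f), (e', f')). (M - {e', f'}) \<union> {e, f}) `
     (({e \<in> Pow H. card e = 2} \<times> {e \<in> Pow H. card e = 2}) \<times> ({e \<in> Pow H. card e = 2} \<times> {e \<in> Pow H. card e = 2}))"

lemma card_pairs_le: "finite H \<Longrightarrow> card {e \<in> Pow H. card e = 2} \<le> (card H)\<^sup>2"
proof -
  assume fin: "finite H"
  have "{e \<in> Pow H. card e = 2} \<subseteq> (\<lambda>(a, b). {a, b}) ` (H \<times> H)"
    by (force simp: card_2_iff)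
  then have "card {e \<in> Pow H. card e = 2} \<le> card ((\<lambda>(a, b). {a, b}) ` (H \<times> H))"
    using fin by (intro card_mono) auto
  also have "\<dots> \<le> card (H \<times> H)" using fin by (intro card_image_le) auto
  finally show ?thesis by (simp add: power2_eq_square card_cartesian_product)
qed

lemma finite_switches: "finite H \<Longrightarrow> finite (switches H M)"
  by (simp add: switches_def)

lemma card_switches_le: "finite H \<Longrightarrow> card (switches H M) \<le> (card H) ^ 8"
proof -
  assume fin: "finite H"
  define E where "E = {e \<in> Pow H. card e = 2}"
  have "card (switches H M) \<le> card ((E \<times> E) \<times> (E \<times> E))"
    unfolding switches_def E_def[symmetric] using fin by (intro card_image_le) (auto simp: E_def)
  also have "\<dots> = card E ^ 4" by (simp add: power4_eq_xxxx mult.assoc card_cartesian_product)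
  also have "\<dots> \<le> ((card H)\<^sup>2) ^ 4" unfolding E_def using card_pairs_le[OF fin] by (rule power_mono) simp
  finally show ?thesis by (simp flip: power_mult)
qed

text \<open>
  A loop or surplus parallel edge \<open>{h, h'}\<close> is switched with an edge \<open>{k, k'}\<close> far from it, to
  \<open>{h, k}\<close> and \<open>{h', k'}\<close>. This keeps the multigraph connected, as the ends of \<open>{h, h'}\<close> are
  connected without it.
\<close>

lemma switch_exists:
  fixes \<pi> :: "'h \<Rightarrow> 'v"
  assumes fin: "finite H" and M: "M \<in> perfect_matchings H" and lk: "linked \<pi> V M" and pos: "0 < defect \<pi> M"
    and deg: "\<And>v. card {h \<in> H. \<pi> h = v} \<le> \<Delta>" and large: "2 * ((\<Delta> + 1) * \<Delta>) < card H"
  shows "\<exists>M'\<in>perfect_matchings H. linked \<pi> V M' \<and> defect \<pi> M' < defect \<pi> M \<and> M \<in> switches H M'"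
proof -
  have finM: "finite M" using finite_of_perfect_matchings[OF fin M] .
  obtain e where e: "e \<in> M" and bad: "card (\<pi> ` e) \<noteq> 2 \<or> (\<exists>e'\<in>M. e' \<noteq> e \<and> \<pi> ` e' = \<pi> ` e)"
    by (rule defect_pos_cases[OF finM pos]) blast+
  obtain h h' where hh: "e = {h, h'}" "h \<noteq> h'" using perfect_matchings_edge_card[OF M e] by (auto simp: card_2_iff)
  have hH: "h \<in> H" "h' \<in> H" using perfect_matchings_edge_subset[OF M e] hh by auto
  have "\<forall>k\<in>H. \<exists>k'. {k, k'} \<in> M \<and> k' \<noteq> k \<and> k' \<in> H" using perfect_matchings_partner[OF M] by metis
  then obtain pt where pt: "\<And>k. k \<in> H \<Longrightarrow> {k, pt k} \<in> M" "\<And>k. k \<in> H \<Longrightarrow> pt k \<noteq> k" "\<And>k. k \<in> H \<Longrightarrow> pt k \<in> H"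
    by metis
  have pt_eq: "pt k = k'" if "{k, k'} \<in> M" for k k'
  proof -
    have k: "k \<in> H" using perfect_matchings_edge_subset[OF M that] by simp
    have "{k, pt k} = {k, k'}" using perfect_matchings_edge_unique[OF M pt(1)[OF k] that, of k] by simp
    then show ?thesis using pt(2)[OF k] by (auto simp: doubleton_eq_iff)
  qed
  have inj: "inj_on pt H"
  proof (rule inj_onI)
    fix a b assume ab: "a \<in> H" "b \<in> H" "pt a = pt b"
    have inv: "pt (pt c) = c" if "c \<in> H" for c
      using pt_eq[of "pt c" c] pt(1)[OF that] by (simp add: insert_commute)
    show "a = b" using inv[OF ab(1)] inv[OF ab(2)] ab(3) by metis
  qed
  \<comment> \<open>\<open>Nb z\<close> is the closed neighbourhood of \<open>z\<close>, and
    \<open>A z\<close> below consists of the half-edges sitting at it.\<close>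
  define Nb where "Nb = (\<lambda>z. insert z ((\<lambda>k. \<pi> (pt k)) ` {k \<in> H. \<pi> k = z}))"
  have NbI: "\<pi> b \<in> Nb (\<pi> a)" if "{a, b} \<in> M" for a b
    using pt_eq[OF that] perfect_matchings_edge_subset[OF M that] unfolding Nb_def by auto
  have NbI2: "q \<in> Nb z" if "g \<in> M" "\<pi> ` g = {z, q}" for g z q
  proof -
    have "(z, q) \<in> edge_rel \<pi> M" using that unfolding edge_rel_def by blast
    then show ?thesis using NbI perfect_matchings_edge_card[OF M] by (metis edge_relE)
  qed
  have cardN: "card (Nb z) \<le> \<Delta> + 1" "finite (Nb z)" for z
  proof -
    have "card ((\<lambda>k. \<pi> (pt k)) ` {k \<in> H. \<pi> k = z}) \<le> \<Delta>"
      using deg[of z] fin card_image_le[of "{k \<in> H. \<pi> k = z}" "\<lambda>k. \<pi> (pt k)"] by simp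
    then show "card (Nb z) \<le> \<Delta> + 1" unfolding Nb_def using fin by (simp add: card_insert_if)
    show "finite (Nb z)" unfolding Nb_def using fin by simp
  qed
  define A where "A = (\<lambda>z. {k \<in> H. \<pi> k \<in> Nb z})"
  have cardA: "card (A z) \<le> (\<Delta> + 1) * \<Delta>" for z
  proof -
    have "A z = (\<Union>q\<in>Nb z. {k \<in> H. \<pi> k = q})" unfolding A_def by auto
    then have "card (A z) \<le> (\<Sum>q\<in>Nb z. card {k \<in> H. \<pi> k = q})" using card_UN_le[OF cardN(2)] by metis
    also have "\<dots> \<le> (\<Sum>q\<in>Nb z. \<Delta>)" using deg by (intro sum_mono) auto
    also have "\<dots> = card (Nb z) * \<Delta>" by simp
    also have "\<dots> \<le> (\<Delta> + 1) * \<Delta>" using cardN(1)[of z] by (rule mult_right_mono) simp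
    finally show ?thesis .
  qed
  define x y where xy: "x = \<pi> h" "y = \<pi> h'"
  \<comment> \<open>A closed neighbourhood carries at most \<open>(\<Delta> + 1) * \<Delta>\<close>
    half-edges. Avoiding that of \<open>x\<close> for \<open>k\<close> and that of \<open>y\<close>
    for its partner excludes at most twice as many choices, whence the hypothesis
    \<open>large\<close>.\<close>
  have "\<exists>k\<in>H. k \<notin> A x \<and> pt k \<notin> A y"
  proof (rule ccontr)
    assume "\<not> ?thesis"
    then have sub: "H \<subseteq> A x \<union> {k \<in> H. pt k \<in> A y}" by auto
    have "card {k \<in> H. pt k \<in> A y} \<le> card (A y)"
      by (rule card_inj_on_le[of pt]) (use inj fin in \<open>auto simp: inj_on_def A_def\<close>)
    then have "card (A x \<union> {k \<in> H. pt k \<in> A y}) \<le> (\<Delta> + 1) * \<Delta> + (\<Delta> + 1) * \<Delta>"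
      using card_Un_le[of "A x" "{k \<in> H. pt k \<in> A y}"] cardA[of x] cardA[of y] by linarith
    moreover have "card H \<le> card (A x \<union> {k \<in> H. pt k \<in> A y})"
      using sub fin by (intro card_mono) (auto simp: A_def)
    ultimately show False using large by linarith
  qed
  then obtain k where k: "k \<in> H" "k \<notin> A x" "pt k \<notin> A y" by blast
  define k' where "k' = pt k"
  define f where "f = {k, k'}"
  have kk: "k' \<in> H" "k' \<noteq> k" "f \<in> M" using pt k unfolding k'_def f_def by auto
  have far: "\<pi> k \<notin> Nb x" "\<pi> k' \<notin> Nb y" using k kk unfolding A_def k'_def by auto
  have selfN: "z \<in> Nb z" for z unfolding Nb_def by simp
  have yx: "y \<in> Nb x" "x \<in> Nb y" using NbI[of h h'] NbI[of h' h] e hh by (auto simp: xy insert_commute)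
  have kxy: "\<pi> k \<noteq> x" "\<pi> k \<noteq> y" "\<pi> k' \<noteq> y" "\<pi> k' \<noteq> x" using far yx selfN by metis+
  have dist: "k \<noteq> h" "k \<noteq> h'" "k' \<noteq> h" "k' \<noteq> h'" using kxy xy by auto
  define M0 where "M0 = M - {e} - {f}"
  define e' f' where ef': "e' = {h, k}" "f' = {h', k'}"
  have fe: "f \<noteq> e" using dist hh unfolding f_def by (auto simp: doubleton_eq_iff)
  have M0: "M0 \<in> perfect_matchings (H - e - f)"
    unfolding M0_def using perfect_matchings_remove[OF perfect_matchings_remove[OF M e], of f] kk fe by simp
  have HH: "H - e - f = H - e' - f'" unfolding hh f_def ef' by auto
  have c2: "card e' = 2" "card f' = 2" unfolding ef' using dist by (auto simp: card_insert_if)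
  define M' where "M' = insert e' (insert f' M0)"
  have "f' \<subseteq> H - e'" unfolding ef' using hH kk k(1) dist hh by auto
  then have "insert f' M0 \<in> perfect_matchings (H - e')" using perfect_matchings_insert[of M0 "H - e'" f'] M0 HH c2 by simp
  then have M': "M' \<in> perfect_matchings H" unfolding M'_def using perfect_matchings_insert[of _ H e'] c2 k(1) hH by (simp add: ef')
  have notin: "e' \<notin> M0" "f' \<notin> M0" using perfect_matchings_edge_subset[OF M0] unfolding ef' hh f_def by blast+
  have ef_ne: "e' \<noteq> f'" unfolding ef' using dist hh by (auto simp: doubleton_eq_iff)
  have Meq: "M = (M' - {e', f'}) \<union> {e, f}" using notin e kk(3) unfolding M'_def M0_def by blast
  have sub: "e \<in> {e \<in> Pow H. card e = 2}" "f \<in> {e \<in> Pow H. card e = 2}"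
     "e' \<in> {e \<in> Pow H. card e = 2}" "f' \<in> {e \<in> Pow H. card e = 2}"
    using c2 perfect_matchings_edge_card[OF M] perfect_matchings_edge_subset[OF M] perfect_matchings_edge_subset[OF M'] e kk(3) by (auto simp: M'_def)
  have sw: "M \<in> switches H M'"
    unfolding switches_def using sub Meq by (intro image_eqI[of _ _ "((e, f), (e', f'))"]) auto
  have finM0: "finite M0" using finM unfolding M0_def by simp
  define R where "R = edge_rel \<pi> M'"
  \<comment> \<open>Either \<open>e\<close> is a loop, or a parallel copy \<open>e2\<close>
    survives: it is not \<open>f\<close>, whose ends avoid both \<open>x\<close> and
    \<open>y\<close>.\<close>
  have xyR: "(x, y) \<in> R\<^sup>*"
  proof (cases "x = y")
    case False
    then have "card (\<pi> ` e) = 2" unfolding hh xy by (simp add: card_insert_if)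
    then obtain e2 where e2: "e2 \<in> M" "e2 \<noteq> e" "\<pi> ` e2 = \<pi> ` e" using bad by blast
    have "e2 \<noteq> f"
    proof
      assume "e2 = f"
      then have "\<pi> k \<in> \<pi> ` e" using e2 unfolding f_def by auto
      then show False using kxy unfolding hh xy by auto
    qed
    then have "e2 \<in> M'" using e2 unfolding M'_def M0_def by simp
    then have "(x, y) \<in> R" unfolding R_def edge_rel_def using e2(3) hh xy by auto
    then show ?thesis by blast
  qed simp
  have yxR: "(y, x) \<in> R\<^sup>*" using edge_rel_rtrancl_sym xyR unfolding R_def by metis
  have xk: "(x, \<pi> k) \<in> R" unfolding R_def xy by (rule edge_relI) (simp add: M'_def ef')
  have yk: "(y, \<pi> k') \<in> R" unfolding R_def xy by (rule edge_relI) (simp add: M'_def ef')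
  have kkR: "(\<pi> k, \<pi> k') \<in> R\<^sup>*"
  proof -
    have "(\<pi> k, x) \<in> R\<^sup>*" using edge_rel_rtrancl_sym[of x "\<pi> k"] xk unfolding R_def by blast
    then show ?thesis using xyR yk by (meson rtrancl.rtrancl_into_rtrancl rtrancl_trans)
  qed
  have kkR': "(\<pi> k', \<pi> k) \<in> R\<^sup>*" using edge_rel_rtrancl_sym kkR unfolding R_def by metis
  have "edge_rel \<pi> M \<subseteq> R\<^sup>*"
  proof clarify
    fix a b assume "(a, b) \<in> edge_rel \<pi> M"
    then obtain g where g: "g \<in> M" "\<pi> ` g = {a, b}" unfolding edge_rel_def by blast
    consider "g \<in> M0" | "g = e" | "g = f" using g(1) unfolding M0_def by blast
    then show "(a, b) \<in> R\<^sup>*"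
    proof cases
      case 1
      then have "(a, b) \<in> R" using g unfolding R_def edge_rel_def M'_def by blast
      then show ?thesis by blast
    next
      case 2
      then have "{a, b} = {x, y}" using g hh xy by simp
      then show ?thesis using xyR yxR by (auto simp: doubleton_eq_iff)
    next
      case 3
      then have "{a, b} = {\<pi> k, \<pi> k'}" using g f_def by simp
      then show ?thesis using kkR kkR' by (auto simp: doubleton_eq_iff)
    qed
  qed
  then have "(edge_rel \<pi> M)\<^sup>* \<subseteq> R\<^sup>*" by (metis rtrancl_subset_rtrancl)
  then have lk': "linked \<pi> V M'" using lk unfolding linked_def R_def by blast
  have cardM: "card M = card M0 + 2" unfolding M0_def using e kk(3) fe finM
    by (metis (no_types, lifting) Diff_iff add_2_eq_Suc' card.remove finite_Diff singletonD)
  have cardM': "card M' = card M0 + 2" unfolding M'_def using notin ef_ne finM0 by simp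
  have imgs: "\<pi> ` e' = {x, \<pi> k}" "\<pi> ` f' = {y, \<pi> k'}" "\<pi> ` f = {\<pi> k, \<pi> k'}"
    unfolding ef' xy f_def by auto
  have img2: "card (\<pi> ` e') = 2" "card (\<pi> ` f') = 2" unfolding imgs using kxy by (auto simp: card_insert_if)
  have nD: "\<pi> ` e' \<notin> links \<pi> M" "\<pi> ` f' \<notin> links \<pi> M"
  proof -
    show "\<pi> ` e' \<notin> links \<pi> M"
    proof
      assume "\<pi> ` e' \<in> links \<pi> M"
      then obtain g where "g \<in> M" "\<pi> ` g = {x, \<pi> k}" unfolding imgs links_def by auto
      then show False using NbI2 far by blast
    qed
    show "\<pi> ` f' \<notin> links \<pi> M"
    proof
      assume "\<pi> ` f' \<in> links \<pi> M"
      then obtain g where "g \<in> M" "\<pi> ` g = {y, \<pi> k'}" unfolding imgs links_def by auto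
      then show False using NbI2 far by blast
    qed
  qed
  have D0M: "links \<pi> M0 \<subseteq> links \<pi> M" unfolding links_def M0_def by auto
  have DM': "links \<pi> M' = links \<pi> M0 \<union> {\<pi> ` e', \<pi> ` f'}" unfolding links_def M'_def using img2 by auto
  have eD: "\<pi> ` e \<in> links \<pi> (M - {e})" if "card (\<pi> ` e) = 2"
    using that bad unfolding links_def by (metis (mono_tags, lifting) CollectI Diff_iff image_eqI singletonD)
  have "M = insert e (M - {e})" using e by blast
  then have "links \<pi> M \<subseteq> links \<pi> (M - {e})"
    using eD unfolding links_def by (smt (verit) image_iff insert_iff mem_Collect_eq subsetI)
  moreover have "M - {e} = insert f M0" unfolding M0_def using kk(3) fe by blast
  ultimately have DMf: "links \<pi> M \<subseteq> links \<pi> (insert f M0)" by simp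
  have fD: "finite (links \<pi> M0)" "finite (links \<pi> M)" using finM finM0 finite_links by blast+
  \<comment> \<open>The number of edges is unchanged, so the adjacencies have to increase. Losing
    \<open>e\<close> costs none and losing \<open>f\<close> at most one, while two are gained. The
    two gained ones coincide only if \<open>f\<close> is a loop, and then losing \<open>f\<close>
    costs none either.\<close>
  have "card (links \<pi> M) < card (links \<pi> M')"
  proof (cases "\<pi> ` e' = \<pi> ` f'")
    case False
    have "links \<pi> M \<subseteq> insert (\<pi> ` f) (links \<pi> M0)" using DMf unfolding links_def by auto
    then have "card (links \<pi> M) \<le> card (insert (\<pi> ` f) (links \<pi> M0))"
      using fD by (intro card_mono) auto
    then have "card (links \<pi> M) \<le> card (links \<pi> M0) + 1"
      using fD by (simp add: card_insert_if split: if_splits)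
    moreover have "card (links \<pi> M') = card (links \<pi> M0) + 2"
      unfolding DM' using fD False nD D0M by (subst card_Un_disjoint) auto
    ultimately show ?thesis by simp
  next
    case True
    then have "\<pi> k = \<pi> k'" using kxy unfolding imgs by (auto simp: doubleton_eq_iff)
    then have "links \<pi> (insert f M0) \<subseteq> links \<pi> M0" unfolding links_def using imgs(3) by auto
    then have "links \<pi> M \<subseteq> links \<pi> M0" using DMf by blast
    then have "card (links \<pi> M) \<le> card (links \<pi> M0)" using fD card_mono by blast
    moreover have "card (links \<pi> M') = card (links \<pi> M0) + 1"
      unfolding DM' using fD nD D0M True by (auto simp: card_insert_if)
    ultimately show ?thesis by simp
  qed
  then have "defect \<pi> M' < defect \<pi> M" using pos cardM cardM' unfolding defect_links by linarith
  then show ?thesis using M' lk' sw by blast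
qed

text \<open>A matching of defect \<open>Suc b\<close> comes from one of defect at most
  \<open>b\<close> through one of at most \<open>card H ^ 8\<close> reverse switchings, so each unit
  of defect costs a factor \<open>1 + card H ^ 8\<close>.\<close>

lemma card_defect_le:
  fixes \<pi> :: "'h \<Rightarrow> 'v"
  assumes fin: "finite H"
    and deg: "\<And>v. card {h \<in> H. \<pi> h = v} \<le> \<Delta>" and large: "2 * ((\<Delta> + 1) * \<Delta>) < card H"
  shows "card {M \<in> perfect_matchings H. linked \<pi> V M \<and> defect \<pi> M \<le> b}
    \<le> (1 + card H ^ 8) ^ b * card {M \<in> perfect_matchings H. linked \<pi> V M \<and> defect \<pi> M = 0}"
proof (induction b)
  case (Suc b)
  define A where "A = (\<lambda>b. {M \<in> perfect_matchings H. linked \<pi> V M \<and> defect \<pi> M \<le> b})"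
  have finA: "finite (A b)" for b unfolding A_def using finite_perfect_matchings[OF fin] by simp
  have "A (Suc b) \<subseteq> A b \<union> (\<Union>M'\<in>A b. switches H M')"
  proof
    fix M assume M: "M \<in> A (Suc b)"
    show "M \<in> A b \<union> (\<Union>M'\<in>A b. switches H M')"
    proof (cases "defect \<pi> M \<le> b")
      case True then show ?thesis using M unfolding A_def by simp
    next
      case False
      then obtain M' where "M' \<in> perfect_matchings H" "linked \<pi> V M'" "defect \<pi> M' < defect \<pi> M" "M \<in> switches H M'"
        using switch_exists[OF fin _ _ _ deg large, of M V] M unfolding A_def by auto
      then show ?thesis using M unfolding A_def by auto
    qed
  qed
  then have "card (A (Suc b)) \<le> card (A b \<union> (\<Union>M'\<in>A b. switches H M'))"
    using finA finite_switches[OF fin] by (intro card_mono) auto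
  also have "\<dots> \<le> card (A b) + (\<Sum>M'\<in>A b. card (switches H M'))"
    using card_Un_le[of "A b" "\<Union>M'\<in>A b. switches H M'"] card_UN_le[OF finA, of "switches H"] by (meson add_left_mono order_trans)
  also have "\<dots> \<le> card (A b) + (\<Sum>M'\<in>A b. card H ^ 8)"
    using card_switches_le[OF fin] by (intro add_left_mono sum_mono) auto
  also have "\<dots> = (1 + card H ^ 8) * card (A b)" by simp
  also have "\<dots> \<le> (1 + card H ^ 8) * ((1 + card H ^ 8) ^ b * card {M \<in> perfect_matchings H. linked \<pi> V M \<and> defect \<pi> M = 0})"
    using Suc unfolding A_def by (rule mult_left_mono) simp
  finally show ?case unfolding A_def by (simp add: algebra_simps)
qed simp

section \<open>The first moment of the defect\<close>

lemma sum_card_swap: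
  assumes "finite A" "finite P"
  shows "(\<Sum>M\<in>A. card {q \<in> P. R q M}) = (\<Sum>q\<in>P. card {M \<in> A. R q M})"
proof -
  have "(\<Sum>M\<in>A. card {q \<in> P. R q M}) = (\<Sum>M\<in>A. \<Sum>q\<in>P. of_bool (R q M))"
    using assms by (simp add: Int_def)
  also have "\<dots> = (\<Sum>q\<in>P. \<Sum>M\<in>A. of_bool (R q M))" by (rule sum.swap)
  finally show ?thesis using assms by (simp add: Int_def)
qed

text \<open>Choose one edge \<open>rep p\<close> for each adjacency \<open>p\<close>. Every edge not
  chosen is a loop or runs parallel to a chosen one, which gives the two sets on the right.
  Quadruples are grouped as \<open>((a, c), (b, d))\<close>, with \<open>a\<close>, \<open>c\<close>
  sharing a vertex and \<open>b\<close>, \<open>d\<close> sharing a vertex, so that they range over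
  a square of the set of pairs at a common vertex.\<close>

lemma defect_le_loops_parallels:
  assumes fin: "finite H" and M: "M \<in> perfect_matchings H"
  shows "defect \<pi> M \<le> card {(a, b) \<in> {(a, b) \<in> H \<times> H. \<pi> a = \<pi> b}. a \<noteq> b \<and> {a, b} \<in> M}
    + card {((a, c), (b, d)) \<in> {(a, c) \<in> H \<times> H. \<pi> a = \<pi> c} \<times> {(b, d) \<in> H \<times> H. \<pi> b = \<pi> d}.
        {a, b} \<in> M \<and> {c, d} \<in> M \<and> {a, b} \<noteq> {c, d} \<and> a \<noteq> b \<and> c \<noteq> d}"
    (is "_ \<le> card ?P + card ?Q")
proof -
  have finM: "finite M" using finite_of_perfect_matchings[OF fin M] .
  define E where "E = {e \<in> M. card (\<pi> ` e) = 2}"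
  define rep where "rep = inv_into E ((`) \<pi>)"
  have D: "links \<pi> M = (`) \<pi> ` E" unfolding links_def E_def by auto
  have rep: "rep p \<in> E" "\<pi> ` rep p = p" if "p \<in> links \<pi> M" for p
    using that f_inv_into_f[of p "(`) \<pi>" E] unfolding D rep_def by (auto intro: inv_into_into)
  have "inj_on rep (links \<pi> M)" unfolding D rep_def by (rule inj_on_inv_into) simp
  then have c1: "card (rep ` links \<pi> M) = card (links \<pi> M)" by (rule card_image)
  have sub: "rep ` links \<pi> M \<subseteq> E" using rep by blast
  have "M = (M - E) \<union> (E - rep ` links \<pi> M) \<union> rep ` links \<pi> M" using sub unfolding E_def by blast
  then have "card M = card ((M - E) \<union> (E - rep ` links \<pi> M) \<union> rep ` links \<pi> M)" by (rule arg_cong)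
  then have "card M \<le> card (M - E) + card (E - rep ` links \<pi> M) + card (links \<pi> M)"
    using c1 card_Un_le[of "(M - E) \<union> (E - rep ` links \<pi> M)" "rep ` links \<pi> M"]
      card_Un_le[of "M - E" "E - rep ` links \<pi> M"] by linarith
  moreover have "card (M - E) \<le> card ?P"
  proof -
    have finP: "finite ?P" by (rule finite_subset[of _ "H \<times> H"]) (use fin in auto)
    have "M - E \<subseteq> (\<lambda>(a, b). {a, b}) ` ?P"
    proof
      fix e assume e: "e \<in> M - E"
      then obtain a b where ab: "e = {a, b}" "a \<noteq> b" using perfect_matchings_edge_card[OF M, of e] by (auto simp: card_2_iff)
      have "\<pi> a = \<pi> b" using e unfolding E_def ab by (auto simp: card_insert_if split: if_splits)
      then have "(a, b) \<in> ?P" using ab e perfect_matchings_edge_subset[OF M, of e] by auto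
      then show "e \<in> (\<lambda>(a, b). {a, b}) ` ?P" using ab by force
    qed
    then have "card (M - E) \<le> card ((\<lambda>(a, b). {a, b}) ` ?P)" using finP by (intro card_mono) auto
    also have "\<dots> \<le> card ?P" using finP by (rule card_image_le)
    finally show ?thesis .
  qed
  moreover have "card (E - rep ` links \<pi> M) \<le> card ?Q"
  proof -
    have finQ: "finite ?Q" by (rule finite_subset[of _ "(H \<times> H) \<times> (H \<times> H)"]) (use fin in auto)
    have "E - rep ` links \<pi> M \<subseteq> (\<lambda>((a, c), (b, d)). {a, b}) ` ?Q"
    proof
      fix e assume e: "e \<in> E - rep ` links \<pi> M"
      define f where "f = rep (\<pi> ` e)"
      have eM: "e \<in> M" "card (\<pi> ` e) = 2" using e unfolding E_def by auto
      have "\<pi> ` e \<in> links \<pi> M" using eM unfolding links_def by blast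
      then have f: "f \<in> M" "\<pi> ` f = \<pi> ` e" "f \<noteq> e" using rep[of "\<pi> ` e"] e unfolding f_def E_def by auto
      obtain a b where ab: "e = {a, b}" "a \<noteq> b" using perfect_matchings_edge_card[OF M eM(1)] by (auto simp: card_2_iff)
      obtain c' d' where cd': "f = {c', d'}" "c' \<noteq> d'" using perfect_matchings_edge_card[OF M f(1)] by (auto simp: card_2_iff)
      have "(\<pi> c' = \<pi> a \<and> \<pi> d' = \<pi> b) \<or> (\<pi> d' = \<pi> a \<and> \<pi> c' = \<pi> b)"
        using f(2) ab cd' by (auto simp: doubleton_eq_iff)
      then obtain c d where cd: "f = {c, d}" "c \<noteq> d" "\<pi> a = \<pi> c" "\<pi> b = \<pi> d"
      proof
        assume "\<pi> c' = \<pi> a \<and> \<pi> d' = \<pi> b" then show ?thesis using that[of c' d'] cd' by simp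
      next
        assume "\<pi> d' = \<pi> a \<and> \<pi> c' = \<pi> b" then show ?thesis using that[of d' c'] cd' by (simp add: insert_commute)
      qed
      have "((a, c), (b, d)) \<in> ?Q"
        using ab cd eM f perfect_matchings_edge_subset[OF M eM(1)] perfect_matchings_edge_subset[OF M f(1)] by auto
      then show "e \<in> (\<lambda>((a, c), (b, d)). {a, b}) ` ?Q"
        by (rule rev_image_eqI) (simp add: ab)
    qed
    then have "card (E - rep ` links \<pi> M) \<le> card ((\<lambda>((a, c), (b, d)). {a, b}) ` ?Q)"
      using finQ by (intro card_mono) auto
    also have "\<dots> \<le> card ?Q" using finQ by (rule card_image_le)
    finally show ?thesis .
  qed
  ultimately show ?thesis unfolding defect_links by linarith
qed

lemma card_perfect_matchings_two_edges_le:
  assumes fin: "finite H" "card H = 2 * Suc (Suc k)" and e: "e \<subseteq> H" "f \<subseteq> H" "card e = 2" "card f = 2" "e \<noteq> f"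
  shows "card {M \<in> perfect_matchings H. e \<in> M \<and> f \<in> M} \<le> odd_fact k"
proof (cases "e \<inter> f = {}")
  case True
  have "card {M \<in> perfect_matchings H. e \<in> M \<and> f \<in> M} = card {M \<in> perfect_matchings (H - e). f \<in> insert e M}"
    by (rule card_perfect_matchings_edge) (use e in auto)
  also have "\<dots> = card {M \<in> perfect_matchings (H - e). f \<in> M \<and> True}" using e by (auto intro!: arg_cong[of _ _ card])
  also have "\<dots> = card {M \<in> perfect_matchings (H - e - f). True}"
    by (rule card_perfect_matchings_edge) (use e True in auto)
  also have "\<dots> = odd_fact k"
  proof -
    have "H - e - f = H - (e \<union> f)" by blast
    moreover have "finite (e \<union> f)" "e \<union> f \<subseteq> H" using e fin finite_subset by blast+
    ultimately have "card (H - e - f) = card H - card (e \<union> f)" by (metis card_Diff_subset)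
    also have "card (e \<union> f) = 4" using True e fin by (subst card_Un_disjoint) (auto intro: finite_subset)
    finally have "card (H - e - f) = 2 * k" using fin by simp
    then show ?thesis using card_perfect_matchings[of "H - e - f" k] fin by simp
  qed
  finally show ?thesis by simp
next
  case False
  then have "{M \<in> perfect_matchings H. e \<in> M \<and> f \<in> M} = {}" using e(5) perfect_matchings_edge_unique by fastforce
  then show ?thesis by (metis card.empty zero_le)
qed

text \<open>Sum over potential loops and potential parallel pairs: a prescribed edge lies in
  \<open>odd_fact (Suc k)\<close> matchings, two prescribed edges lie in at most
  \<open>odd_fact k\<close>.\<close>

lemma sum_defect_le:
  assumes fin: "finite H" "card H = 2 * Suc (Suc k)"
  shows "(\<Sum>M\<in>perfect_matchings H. defect \<pi> M) \<le> card {(a, b) \<in> H \<times> H. \<pi> a = \<pi> b} * odd_fact (Suc k)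
    + (card {(a, b) \<in> H \<times> H. \<pi> a = \<pi> b})\<^sup>2 * odd_fact k"
proof -
  define P where "P = {(a, b) \<in> H \<times> H. \<pi> a = \<pi> b}"
  have finP: "finite P" unfolding P_def by (rule finite_subset[of _ "H \<times> H"]) (use fin in auto)
  define RP where "RP = (\<lambda>(a, b) M. a \<noteq> b \<and> {a, b} \<in> (M :: 'a set set))"
  define RQ where "RQ = (\<lambda>((a, c), (b, d)) M. {a, b} \<in> M \<and> {c, d} \<in> M \<and> {a, b} \<noteq> {c, d} \<and> a \<noteq> b \<and> (c::'a) \<noteq> d)"
  have fp: "finite (perfect_matchings H)" using finite_perfect_matchings fin by blast
  have le: "defect \<pi> M \<le> card {q \<in> P. RP q M} + card {q \<in> P \<times> P. RQ q M}" if "M \<in> perfect_matchings H" for M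
  proof -
    have 1: "{q \<in> P. RP q M} = {(a, b) \<in> {(a, b) \<in> H \<times> H. \<pi> a = \<pi> b}. a \<noteq> b \<and> {a, b} \<in> M}"
      unfolding P_def RP_def by auto
    have 2: "{q \<in> P \<times> P. RQ q M} = {((a, c), (b, d)) \<in> {(a, c) \<in> H \<times> H. \<pi> a = \<pi> c} \<times> {(b, d) \<in> H \<times> H. \<pi> b = \<pi> d}.
        {a, b} \<in> M \<and> {c, d} \<in> M \<and> {a, b} \<noteq> {c, d} \<and> a \<noteq> b \<and> c \<noteq> d}"
      unfolding P_def RQ_def by auto
    show ?thesis unfolding 1 2 by (rule defect_le_loops_parallels[OF fin(1) that])
  qed
  have "(\<Sum>M\<in>perfect_matchings H. defect \<pi> M) \<le> (\<Sum>M\<in>perfect_matchings H. card {q \<in> P. RP q M} + card {q \<in> P \<times> P. RQ q M})"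
    using le by (rule sum_mono)
  also have "\<dots> = (\<Sum>q\<in>P. card {M \<in> perfect_matchings H. RP q M}) + (\<Sum>q\<in>P \<times> P. card {M \<in> perfect_matchings H. RQ q M})"
    using sum_card_swap[OF fp finP, of RP] sum_card_swap[OF fp, of "P \<times> P" RQ] finP by (simp add: sum.distrib)
  also have "\<dots> \<le> (\<Sum>q\<in>P. odd_fact (Suc k)) + (\<Sum>q\<in>P \<times> P. odd_fact k)"
  proof (intro add_mono sum_mono)
    fix q assume "q \<in> P"
    then obtain a b where q: "q = (a, b)" "a \<in> H" "b \<in> H" unfolding P_def by auto
    show "card {M \<in> perfect_matchings H. RP q M} \<le> odd_fact (Suc k)"
    proof (cases "a = b")
      case False
      have "{M \<in> perfect_matchings H. RP q M} = {M \<in> perfect_matchings H. {a, b} \<in> M \<and> True}" using q False by (auto simp: RP_def)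
      then have "card {M \<in> perfect_matchings H. RP q M} = card {M \<in> perfect_matchings (H - {a, b}). True}"
        using card_perfect_matchings_edge[of "{a, b}" H "\<lambda>_. True"] q False by (simp add: card_insert_if)
      moreover have "card (H - {a, b}) = 2 * Suc k"
        using fin q False by (subst card_Diff_subset) (auto simp: card_insert_if)
      ultimately show ?thesis using card_perfect_matchings[of "H - {a, b}" "Suc k"] fin by simp
    qed (simp add: q RP_def)
  next
    fix q assume "q \<in> P \<times> P"
    then obtain a b c d where q: "q = ((a, c), (b, d))" "a \<in> H" "b \<in> H" "c \<in> H" "d \<in> H" unfolding P_def by auto
    show "card {M \<in> perfect_matchings H. RQ q M} \<le> odd_fact k"
    proof (cases "{a, b} \<noteq> {c, d} \<and> a \<noteq> b \<and> c \<noteq> d")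
      case True
      then have "{M \<in> perfect_matchings H. RQ q M} = {M \<in> perfect_matchings H. {a, b} \<in> M \<and> {c, d} \<in> M}" unfolding RQ_def q by auto
      then show ?thesis using card_perfect_matchings_two_edges_le[OF fin, of "{a, b}" "{c, d}"] q True
        by (simp add: card_insert_if)
    next
      case False
      then have "{M \<in> perfect_matchings H. RQ q M} = {}" unfolding RQ_def q by auto
      then show ?thesis by (metis card.empty zero_le)
    qed
  qed
  also have "\<dots> = card P * odd_fact (Suc k) + (card P)\<^sup>2 * odd_fact k"
    by (simp add: card_cartesian_product power2_eq_square)
  finally show ?thesis unfolding P_def .
qed

text \<open>Markov's inequality, multiplied out.\<close>

lemma card_defect_gt_le:
  assumes fin: "finite H" "card H = 2 * Suc (Suc k)"
  shows "b * card {M \<in> perfect_matchings H. b < defect \<pi> M} \<le> card {(a, b) \<in> H \<times> H. \<pi> a = \<pi> b} * odd_fact (Suc k)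
    + (card {(a, b) \<in> H \<times> H. \<pi> a = \<pi> b})\<^sup>2 * odd_fact k"
proof -
  have fp: "finite (perfect_matchings H)" using finite_perfect_matchings fin by blast
  have "b * card {M \<in> perfect_matchings H. b < defect \<pi> M} = (\<Sum>M\<in>{M \<in> perfect_matchings H. b < defect \<pi> M}. b)" by simp
  also have "\<dots> \<le> (\<Sum>M\<in>{M \<in> perfect_matchings H. b < defect \<pi> M}. defect \<pi> M)" by (intro sum_mono) simp
  also have "\<dots> \<le> (\<Sum>M\<in>perfect_matchings H. defect \<pi> M)" using fp by (intro sum_mono2) auto
  finally show ?thesis using sum_defect_le[OF fin, of \<pi>] by linarith
qed

subsection \<open>Components and colourings\<close>

lemma perfect_matchings_image:
  assumes "bij_betw \<phi> H H'" "M \<in> perfect_matchings H"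
  shows "(`) \<phi> ` M \<in> perfect_matchings H'"
proof (rule pmsI)
  have inj: "inj_on \<phi> H" and im: "\<phi> ` H = H'" using assms by (auto simp: bij_betw_def)
  show "e \<subseteq> H'" if "e \<in> (`) \<phi> ` M" for e using that im perfect_matchings_edge_subset[OF assms(2)] by blast
  show "card e = 2" if e: "e \<in> (`) \<phi> ` M" for e
  proof -
    obtain f where f: "f \<in> M" "e = \<phi> ` f" using e by blast
    have "inj_on \<phi> f" using inj_on_subset[OF inj perfect_matchings_edge_subset[OF assms(2) f(1)]] .
    then have "card e = card f" unfolding f(2) by (rule card_image)
    then show ?thesis using perfect_matchings_edge_card[OF assms(2)] f by simp
  qed
  show "\<exists>e\<in>(`) \<phi> ` M. x \<in> e" if x: "x \<in> H'" for x
  proof -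
    obtain y where y: "y \<in> H" "x = \<phi> y" using x im by blast
    then obtain e where "e \<in> M" "y \<in> e" using perfect_matchings_edge_ex[OF assms(2)] by blast
    then have "\<phi> ` e \<in> (`) \<phi> ` M" "x \<in> \<phi> ` e" using y by auto
    then show ?thesis by (rule bexI[rotated])
  qed
  show "e = f" if ef: "e \<in> (`) \<phi> ` M" "f \<in> (`) \<phi> ` M" "x \<in> e" "x \<in> f" for e f x
  proof -
    obtain a b where ab: "a \<in> M" "e = \<phi> ` a" "b \<in> M" "f = \<phi> ` b" using ef by blast
    obtain y z where yz: "y \<in> a" "x = \<phi> y" "z \<in> b" "x = \<phi> z" using ef ab by blast
    have "y = z" using inj_onD[OF inj, of y z] yz ab perfect_matchings_edge_subset[OF assms(2)] by blast
    then show ?thesis using perfect_matchings_edge_unique[OF assms(2)] ab yz by metis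
  qed
qed

text \<open>Moves the connected configurations of a given type, which live on an initial segment, to
  any vertex set with the same degrees inside a larger system.\<close>

lemma card_linked_relabel:
  assumes bij: "bij_betw \<sigma> V V'" and d: "\<And>v. v \<in> V \<Longrightarrow> d' (\<sigma> v) = d v" and fin: "finite V"
  shows "card {M \<in> perfect_matchings (darts V d). linked fst V M} \<le> card {M \<in> perfect_matchings (darts V' d'). linked fst V' M}"
proof -
  define \<phi> where "\<phi> = (\<lambda>(v, i :: nat). (\<sigma> v, i))"
  have inj: "inj_on \<sigma> V" and im: "\<sigma> ` V = V'" using bij by (auto simp: bij_betw_def)
  have inj\<phi>: "inj_on \<phi> (darts V d)" using inj unfolding inj_on_def \<phi>_def darts_def by auto
  have "\<phi> ` darts V d = darts V' d'"
  proof
    show "\<phi> ` darts V d \<subseteq> darts V' d'" using im d unfolding \<phi>_def darts_def by auto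
    show "darts V' d' \<subseteq> \<phi> ` darts V d"
    proof
      fix x assume "x \<in> darts V' d'"
      then obtain v' i where x: "x = (v', i)" "v' \<in> V'" "i \<in> {1..d' v'}" unfolding darts_def by auto
      then obtain v where v: "v \<in> V" "v' = \<sigma> v" using im by blast
      then have "(v, i) \<in> darts V d" "x = \<phi> (v, i)" using x d unfolding darts_def \<phi>_def by auto
      then show "x \<in> \<phi> ` darts V d" by blast
    qed
  qed
  then have bij\<phi>: "bij_betw \<phi> (darts V d) (darts V' d')" using inj\<phi> by (simp add: bij_betw_def)
  show ?thesis
  proof (rule card_inj_on_le)
    show "inj_on ((`) ((`) \<phi>)) {M \<in> perfect_matchings (darts V d). linked fst V M}"
    proof (rule inj_on_subset[of _ "Pow (Pow (darts V d))"])
      show "inj_on ((`) ((`) \<phi>)) (Pow (Pow (darts V d)))"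
        by (intro inj_on_image_Pow inj\<phi>)
    qed (use perfect_matchings_edge_subset in auto)
    show "(`) ((`) \<phi>) ` {M \<in> perfect_matchings (darts V d). linked fst V M} \<subseteq> {M \<in> perfect_matchings (darts V' d'). linked fst V' M}"
    proof clarify
      fix M assume M: "M \<in> perfect_matchings (darts V d)" "linked fst V M"
      have step: "(\<sigma> u, \<sigma> v) \<in> edge_rel fst ((`) \<phi> ` M)" if uv: "(u, v) \<in> edge_rel fst M" for u v
      proof -
        obtain h h' where h: "{h, h'} \<in> M" "fst h = u" "fst h' = v"
          by (rule edge_relE[OF uv perfect_matchings_edge_card[OF M(1)]])
        have "{\<phi> h, \<phi> h'} \<in> (`) \<phi> ` M" using h(1) by (metis image_eqI image_insert image_empty)
        then have "(fst (\<phi> h), fst (\<phi> h')) \<in> edge_rel fst ((`) \<phi> ` M)" by (rule edge_relI)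
        then show ?thesis using h by (simp add: \<phi>_def case_prod_beta)
      qed
      have star: "(\<sigma> u, \<sigma> v) \<in> (edge_rel fst ((`) \<phi> ` M))\<^sup>*" if "(u, v) \<in> (edge_rel fst M)\<^sup>*" for u v
        using that by induction (auto intro: step rtrancl_into_rtrancl)
      have "linked fst V' ((`) \<phi> ` M)"
        using M(2) star unfolding linked_def im[symmetric] by blast
      then show "(`) \<phi> ` M \<in> perfect_matchings (darts V' d') \<and> linked fst V' ((`) \<phi> ` M)"
        using perfect_matchings_image[OF bij\<phi> M(1)] by blast
    qed
    have "finite V'" using im fin by blast
    then show "finite {M \<in> perfect_matchings (darts V' d'). linked fst V' M}" using finite_perfect_matchings[OF finite_darts[OF \<open>finite V'\<close>]] by simp
  qed
qed

lemma ex_bij_betw_fibres: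
  assumes fin: "finite A" "finite B" and eq: "\<And>k. card {a \<in> A. d a = k} = card {b \<in> B. d' b = k}"
  shows "\<exists>\<sigma>. bij_betw \<sigma> A B \<and> (\<forall>a\<in>A. d' (\<sigma> a) = d a)"
proof -
  have "\<forall>k. \<exists>s. bij_betw s {a \<in> A. d a = k} {b \<in> B. d' b = k}"
    using eq fin by (intro allI finite_same_card_bij) auto
  then obtain s where s: "\<And>k. bij_betw (s k) {a \<in> A. d a = k} {b \<in> B. d' b = k}" by metis
  define \<sigma> where "\<sigma> a = s (d a) a" for a
  have \<sigma>: "\<sigma> a \<in> B" "d' (\<sigma> a) = d a" if "a \<in> A" for a
    using bij_betwE[OF s[of "d a"]] that unfolding \<sigma>_def by auto
  have "inj_on \<sigma> A"
  proof (rule inj_onI)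
    fix a b assume ab: "a \<in> A" "b \<in> A" "\<sigma> a = \<sigma> b"
    then have "d a = d b" using \<sigma>(2) by metis
    then show "a = b" using ab bij_betw_imp_inj_on[OF s[of "d a"], THEN inj_onD, of a b] unfolding \<sigma>_def by auto
  qed
  moreover have "B \<subseteq> \<sigma> ` A"
  proof
    fix b assume b: "b \<in> B"
    have "(s (d' b)) ` {a \<in> A. d a = d' b} = {c \<in> B. d' c = d' b}" using s by (auto simp: bij_betw_def)
    then obtain a where "a \<in> A" "d a = d' b" "b = s (d' b) a" using b by blast
    then have "b = \<sigma> a" unfolding \<sigma>_def by simp
    then show "b \<in> \<sigma> ` A" using \<open>a \<in> A\<close> by blast
  qed
  ultimately have "bij_betw \<sigma> A B" using \<sigma>(1) by (auto simp: bij_betw_def)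
  then show ?thesis using \<sigma>(2) by blast
qed

lemma perfect_matchings_Un:
  assumes "M \<in> perfect_matchings A" "M' \<in> perfect_matchings B" "A \<inter> B = {}"
  shows "M \<union> M' \<in> perfect_matchings (A \<union> B)"
proof (rule pmsI)
  note sub = perfect_matchings_edge_subset[OF assms(1)] perfect_matchings_edge_subset[OF assms(2)]
  show "e \<subseteq> A \<union> B" if "e \<in> M \<union> M'" for e using that sub by blast
  show "card e = 2" if "e \<in> M \<union> M'" for e
    using that perfect_matchings_edge_card[OF assms(1)] perfect_matchings_edge_card[OF assms(2)] by blast
  show "\<exists>e\<in>M \<union> M'. x \<in> e" if "x \<in> A \<union> B" for x
    using that perfect_matchings_edge_ex[OF assms(1)] perfect_matchings_edge_ex[OF assms(2)] by blast
  show "e = f" if "e \<in> M \<union> M'" "f \<in> M \<union> M'" "x \<in> e" "x \<in> f" for e f x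
  proof -
    have "\<not> (e \<in> M \<and> f \<in> M')" "\<not> (f \<in> M \<and> e \<in> M')" using that(3,4) sub assms(3) by blast+
    then show ?thesis using that perfect_matchings_edge_unique[OF assms(1)] perfect_matchings_edge_unique[OF assms(2)] by blast
  qed
qed

text \<open>\<open>S\<close> is recovered from any of its vertices as a component of the whole matching.\<close>

lemma card_components_le:
  assumes fin: "finite V" and S: "\<And>S. S \<in> \<S> \<Longrightarrow> S \<subseteq> V \<and> S \<noteq> {}"
    and x: "\<And>S. S \<in> \<S> \<Longrightarrow> x \<le> card {M \<in> perfect_matchings (darts S d). linked fst S M}"
    and y: "\<And>S. S \<in> \<S> \<Longrightarrow> y \<le> card (perfect_matchings (darts (V - S) d))"
  shows "card \<S> * (x * y) \<le> card V * card (perfect_matchings (darts V d))"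
proof -
  define A where "A = (SIGMA S:\<S>. {M \<in> perfect_matchings (darts S d). linked fst S M} \<times> perfect_matchings (darts (V - S) d))"
  have fS: "finite \<S>" using S fin by (meson finite_Pow_iff finite_subset PowI subsetI)
  have fp: "finite (perfect_matchings (darts S d))" if "S \<subseteq> V" for S
    using finite_perfect_matchings finite_darts finite_subset[OF that fin] by blast
  define v where "v S = (SOME a. a \<in> S)" for S :: "'a set"
  have vS: "v S \<in> S" if "S \<in> \<S>" for S unfolding v_def using S[OF that] some_in_eq by blast
  define \<Phi> where "\<Phi> = (\<lambda>(S, M, M'). (v S, M \<union> M' :: ('a \<times> nat) set set))"
  have "card \<S> * (x * y) = (\<Sum>S\<in>\<S>. x * y)" by simp
  also have "\<dots> \<le> (\<Sum>S\<in>\<S>. card ({M \<in> perfect_matchings (darts S d). linked fst S M} \<times> perfect_matchings (darts (V - S) d)))"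
    unfolding card_cartesian_product using x y by (intro sum_mono mult_mono) auto
  also have "\<dots> = card A" unfolding A_def using fS fp S by (subst card_SigmaI) auto
  also have "\<dots> \<le> card (V \<times> perfect_matchings (darts V d))"
  proof (rule card_inj_on_le)
    show "finite (V \<times> perfect_matchings (darts V d))" using fin fp by simp
    show "\<Phi> ` A \<subseteq> V \<times> perfect_matchings (darts V d)"
    proof
      fix z assume "z \<in> \<Phi> ` A"
      then obtain S M M' a N where z: "z = (a, N)" and "(S, M, M') \<in> A" "\<Phi> (S, M, M') = (a, N)"
        by (metis imageE prod_cases3 surj_pair)
      then have a: "S \<in> \<S>" "M \<in> perfect_matchings (darts S d)" "M' \<in> perfect_matchings (darts (V - S) d)" "a = v S" "N = M \<union> M'"
        unfolding A_def \<Phi>_def by auto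
      have "darts S d \<inter> darts (V - S) d = {}" "darts S d \<union> darts (V - S) d = darts V d"
        using S[OF a(1)] unfolding darts_def by auto
      then have "N \<in> perfect_matchings (darts V d)" using perfect_matchings_Un[OF a(2,3)] a(5) by simp
      then show "z \<in> V \<times> perfect_matchings (darts V d)" using vS[OF a(1)] S[OF a(1)] a(4) z by blast
    qed
    have comp: "S = {y. (v S, y) \<in> (edge_rel fst (M \<union> M'))\<^sup>*}"
      if "S \<in> \<S>" "M \<in> perfect_matchings (darts S d)" "linked fst S M" "M' \<in> perfect_matchings (darts (V - S) d)" for S M M'
    proof
      have "(edge_rel fst M)\<^sup>* \<subseteq> (edge_rel fst (M \<union> M'))\<^sup>*" by (intro rtrancl_mono edge_rel_mono) auto
      then show "S \<subseteq> {y. (v S, y) \<in> (edge_rel fst (M \<union> M'))\<^sup>*}"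
        using that(3) vS[OF that(1)] unfolding linked_def by blast
      show "{y. (v S, y) \<in> (edge_rel fst (M \<union> M'))\<^sup>*} \<subseteq> S"
      proof clarify
        fix y assume "(v S, y) \<in> (edge_rel fst (M \<union> M'))\<^sup>*"
        then show "y \<in> S"
        proof induction
          case base show ?case using vS[OF that(1)] .
        next
          case (step y z)
          obtain e where e: "e \<in> M \<union> M'" "fst ` e = {y, z}" using step(2) unfolding edge_rel_def by blast
          have "y \<in> fst ` e" "z \<in> fst ` e" using e(2) by auto
          moreover have "e \<subseteq> darts S d \<or> e \<subseteq> darts (V - S) d"
            using e(1) perfect_matchings_edge_subset[OF that(2)] perfect_matchings_edge_subset[OF that(4)] by blast
          ultimately show ?case using step(3) unfolding darts_def by auto
        qed
      qed
    qed
    have part: "M = {e \<in> M \<union> M'. e \<subseteq> darts S d}" "M' = (M \<union> M') - {e \<in> M \<union> M'. e \<subseteq> darts S d}"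
      if "M \<in> perfect_matchings (darts S d)" "M' \<in> perfect_matchings (darts (V - S) d)" for S M M'
    proof -
      have "\<not> e \<subseteq> darts S d" if "e \<in> M'" for e
      proof -
        have "e \<noteq> {}" using perfect_matchings_edge_card[OF \<open>M' \<in> _\<close> that] by auto
        then obtain h where "h \<in> e" by blast
        moreover then have "h \<in> darts (V - S) d" using perfect_matchings_edge_subset[OF \<open>M' \<in> _\<close> that] by blast
        ultimately show ?thesis unfolding darts_def by auto
      qed
      then show "M = {e \<in> M \<union> M'. e \<subseteq> darts S d}" "M' = (M \<union> M') - {e \<in> M \<union> M'. e \<subseteq> darts S d}"
        using perfect_matchings_edge_subset[OF that(1)] by blast+
    qed
    show "inj_on \<Phi> A"
    proof (rule inj_onI)
      fix z z' assume z: "z \<in> A" "z' \<in> A" "\<Phi> z = \<Phi> z'"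
      obtain S M M' T N N' where zz: "z = (S, M, M')" "z' = (T, N, N')" by (metis prod_cases3)
      note a = z(1,2)[unfolded zz] and eq = z(3)[unfolded zz]
      have M: "S \<in> \<S>" "M \<in> perfect_matchings (darts S d)" "linked fst S M" "M' \<in> perfect_matchings (darts (V - S) d)"
        and N: "T \<in> \<S>" "N \<in> perfect_matchings (darts T d)" "linked fst T N" "N' \<in> perfect_matchings (darts (V - T) d)"
        using a unfolding A_def by auto
      have eq': "v S = v T" "M \<union> M' = N \<union> N'" using eq unfolding \<Phi>_def by auto
      have "S = T" using comp[OF M] comp[OF N] eq' by metis
      moreover have "M = N" using part(1)[OF M(2,4)] part(1)[OF N(2,4)] eq' \<open>S = T\<close> by simp
      moreover have "M' = N'" using part(2)[OF M(2,4)] part(2)[OF N(2,4)] eq' \<open>S = T\<close> by simp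
      ultimately show "z = z'" using zz by simp
    qed
  qed
  finally show ?thesis by (simp add: card_cartesian_product)
qed

section \<open>Vertex colourings with prescribed class sizes\<close>

definition colourings :: "'v set \<Rightarrow> ('v \<Rightarrow> 'k) \<Rightarrow> 'b set \<Rightarrow> ('b \<Rightarrow> 'k) \<Rightarrow> ('b \<Rightarrow> nat) \<Rightarrow> ('v \<Rightarrow> 'b) set" where
  "colourings V d B \<kappa> m = {f \<in> V \<rightarrow>\<^sub>E B. (\<forall>v\<in>V. \<kappa> (f v) = d v) \<and> (\<forall>b\<in>B. card {v \<in> V. f v = b} = m b)}"

lemma finite_colourings: "finite V \<Longrightarrow> finite B \<Longrightarrow> finite (colourings V d B \<kappa> m)"
  unfolding colourings_def by (rule finite_subset[OF _ finite_PiE]) auto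

text \<open>A product of multinomial coefficients, one for each degree, multiplied out to stay
  within the natural numbers; \<open>\<kappa>\<close> sends a colour to the degree of the vertices
  that may bear it. The induction removes a colour \<open>b\<close> after choosing its class among
  the vertices of degree \<open>\<kappa> b\<close>.\<close>

lemma card_colourings:
  assumes "finite B" "finite V" "finite K" "\<kappa> ` B \<subseteq> K" "d ` V \<subseteq> K"
    and "\<And>k. k \<in> K \<Longrightarrow> (\<Sum>b\<in>{b \<in> B. \<kappa> b = k}. m b) = card {v \<in> V. d v = k}"
  shows "card (colourings V d B \<kappa> m) * (\<Prod>b\<in>B. fact (m b)) = (\<Prod>k\<in>K. fact (card {v \<in> V. d v = k}))"
  using assms
proof (induction B arbitrary: V rule: finite_induct)
  case empty
  then have z: "card {v \<in> V. d v = k} = 0" if "k \<in> K" for k using that by fastforce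
  have "V = {}"
  proof (rule ccontr)
    assume "V \<noteq> {}"
    then obtain v where "v \<in> V" by blast
    then show False using z[of "d v"] empty by auto
  qed
  then show ?case by (simp add: colourings_def)
next
  case (insert b B)
  define C where "C = {S. S \<subseteq> {v \<in> V. d v = \<kappa> b} \<and> card S = m b}"
  define A where "A = (SIGMA S:C. colourings (V - S) d B \<kappa> m)"
  define \<Phi> where "\<Phi> = (\<lambda>(S, f). \<lambda>v\<in>V. if v \<in> S then b else (f v :: 'a))"
  define n where "n k = card {v \<in> V. d v = k}" for k
  have \<kappa>K: "\<kappa> b \<in> K" using insert by simp
  have le: "m b \<le> n (\<kappa> b)"
  proof -
    have "m b \<le> (\<Sum>b'\<in>{b' \<in> insert b B. \<kappa> b' = \<kappa> b}. m b')"
      using insert(1) by (intro member_le_sum) auto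
    then show ?thesis using insert.prems(5)[OF \<kappa>K] unfolding n_def by simp
  qed
  have finC: "finite C" unfolding C_def by (rule finite_subset[of _ "Pow V"]) (use insert.prems(1) in auto)
  have SV: "S \<subseteq> V" "finite S" if "S \<in> C" for S
  proof -
    show "S \<subseteq> V" using that unfolding C_def by blast
    then show "finite S" using insert.prems(1) by (rule finite_subset)
  qed
  have IH: "card (colourings (V - S) d B \<kappa> m) * (\<Prod>b\<in>B. fact (m b)) = fact (n (\<kappa> b) - m b) * (\<Prod>k\<in>K - {\<kappa> b}. fact (n k))"
    if S: "S \<in> C" for S
  proof -
    have c: "card {v \<in> V - S. d v = k} = (if k = \<kappa> b then n k - m b else n k)" for k
    proof (cases "k = \<kappa> b")
      case True
      have "{v \<in> V - S. d v = k} = {v \<in> V. d v = k} - S" by blast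
      then show ?thesis using True S SV[OF S] unfolding C_def n_def by (simp add: card_Diff_subset)
    next
      case False
      then have "{v \<in> V - S. d v = k} = {v \<in> V. d v = k}" using S unfolding C_def by blast
      then show ?thesis using False unfolding n_def by simp
    qed
    have "card (colourings (V - S) d B \<kappa> m) * (\<Prod>b\<in>B. fact (m b)) = (\<Prod>k\<in>K. fact (card {v \<in> V - S. d v = k}))"
    proof (rule insert.IH)
      fix k assume k: "k \<in> K"
      show "(\<Sum>b'\<in>{b' \<in> B. \<kappa> b' = k}. m b') = card {v \<in> V - S. d v = k}"
      proof (cases "k = \<kappa> b")
        case True
        then have "{b' \<in> insert b B. \<kappa> b' = k} = insert b {b' \<in> B. \<kappa> b' = k}" by auto
        then have "(\<Sum>b'\<in>{b' \<in> insert b B. \<kappa> b' = k}. m b') = m b + (\<Sum>b'\<in>{b' \<in> B. \<kappa> b' = k}. m b')"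
          using insert(1,2) by simp
        then show ?thesis unfolding c using insert.prems(5)[OF k] True by (simp add: n_def)
      next
        case False
        then have "{b' \<in> insert b B. \<kappa> b' = k} = {b' \<in> B. \<kappa> b' = k}" by auto
        then show ?thesis unfolding c using insert.prems(5)[OF k] False by (simp add: n_def)
      qed
    qed (use insert.prems in auto)
    also have "\<dots> = fact (n (\<kappa> b) - m b) * (\<Prod>k\<in>K - {\<kappa> b}. fact (n k))"
      unfolding c using insert.prems(2) \<kappa>K by (subst prod.remove[OF _ \<kappa>K]) (auto intro!: prod.cong)
    finally show ?thesis .
  qed
  have "bij_betw \<Phi> A (colourings V d (insert b B) \<kappa> m)"
  proof (rule bij_betwI[where g = "\<lambda>f. ({v \<in> V. f v = b}, restrict f (V - {v \<in> V. f v = b}))"])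
    show "\<Phi> \<in> A \<rightarrow> colourings V d (insert b B) \<kappa> m"
    proof (rule funcsetI, clarify)
      fix S f assume "(S, f) \<in> A"
      then have S: "S \<in> C" and f: "f \<in> (V - S) \<rightarrow>\<^sub>E B" "\<And>v. v \<in> V - S \<Longrightarrow> \<kappa> (f v) = d v"
        "\<And>b. b \<in> B \<Longrightarrow> card {v \<in> V - S. f v = b} = m b"
        unfolding A_def colourings_def by auto
      define g where "g = \<Phi> (S, f)"
      have g: "g v = (if v \<in> S then b else f v)" if "v \<in> V" for v using that unfolding g_def \<Phi>_def by simp
      have 1: "g \<in> V \<rightarrow>\<^sub>E insert b B"
        unfolding g_def \<Phi>_def using f(1) by (auto simp: PiE_def Pi_def)
      have 2: "\<kappa> (g v) = d v" if "v \<in> V" for v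
        using g[OF that] f(2) that S unfolding C_def by auto
      have 3: "card {v \<in> V. g v = b'} = m b'" if b': "b' \<in> insert b B" for b'
      proof (cases "b' = b")
        case True
        have nb: "f v \<noteq> b" if "v \<in> V - S" for v using PiE_mem[OF f(1) that] insert(2) by blast
        have "{v \<in> V. g v = b} = S"
        proof (intro set_eqI iffI)
          fix v assume "v \<in> {v \<in> V. g v = b}"
          then show "v \<in> S" using g[of v] nb[of v] by (metis (mono_tags, lifting) DiffI mem_Collect_eq)
        next
          fix v assume "v \<in> S"
          then show "v \<in> {v \<in> V. g v = b}" using g[of v] SV(1)[OF S] by auto
        qed
        then show ?thesis using True S unfolding C_def by simp
      next
        case False
        then have "{v \<in> V. g v = b'} = {v \<in> V - S. f v = b'}" using g by auto
        then show ?thesis using f(3)[of b'] b' False by simp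
      qed
      show "\<Phi> (S, f) \<in> colourings V d (insert b B) \<kappa> m"
        unfolding colourings_def g_def[symmetric] using 1 2 3 by blast
    qed
    show "(\<lambda>f. ({v \<in> V. f v = b}, restrict f (V - {v \<in> V. f v = b}))) \<in> colourings V d (insert b B) \<kappa> m \<rightarrow> A"
    proof (rule funcsetI)
      fix f assume "f \<in> colourings V d (insert b B) \<kappa> m"
      then have f: "f \<in> V \<rightarrow>\<^sub>E insert b B" "\<And>v. v \<in> V \<Longrightarrow> \<kappa> (f v) = d v"
        "\<And>b'. b' \<in> insert b B \<Longrightarrow> card {v \<in> V. f v = b'} = m b'" unfolding colourings_def by auto
      define S where "S = {v \<in> V. f v = b}"
      have S: "S \<in> C" unfolding C_def S_def using f by auto
      have "restrict f (V - S) \<in> (V - S) \<rightarrow>\<^sub>E B" using f(1) unfolding S_def by (auto simp: PiE_def Pi_def)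
      moreover have "card {v \<in> V - S. restrict f (V - S) v = b'} = m b'" if "b' \<in> B" for b'
      proof -
        have "{v \<in> V - S. restrict f (V - S) v = b'} = {v \<in> V. f v = b'}" using insert(2) that unfolding S_def by auto
        then show ?thesis using f(3)[of b'] that by simp
      qed
      ultimately have "restrict f (V - S) \<in> colourings (V - S) d B \<kappa> m"
        unfolding colourings_def using f(2) by auto
      then show "({v \<in> V. f v = b}, restrict f (V - {v \<in> V. f v = b})) \<in> A"
        unfolding A_def S_def[symmetric] using S by simp
    qed
    show "({v \<in> V. \<Phi> x v = b}, restrict (\<Phi> x) (V - {v \<in> V. \<Phi> x v = b})) = x" if "x \<in> A" for x
    proof -
      obtain S f where x: "x = (S, f)" by (cases x)
      have S: "S \<in> C" and f: "f \<in> (V - S) \<rightarrow>\<^sub>E B" using that x unfolding A_def colourings_def by auto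
      have nb: "f v \<noteq> b" if "v \<in> V - S" for v using PiE_mem[OF f that] insert(2) by blast
      have g: "\<Phi> x v = (if v \<in> S then b else f v)" if "v \<in> V" for v
        using that unfolding x \<Phi>_def by simp
      have 1: "{v \<in> V. \<Phi> x v = b} = S"
      proof (intro set_eqI iffI)
        fix v assume "v \<in> {v \<in> V. \<Phi> x v = b}"
        then show "v \<in> S" using g[of v] nb[of v] by (metis (mono_tags, lifting) DiffI mem_Collect_eq)
      next
        fix v assume "v \<in> S"
        then show "v \<in> {v \<in> V. \<Phi> x v = b}" using g[of v] SV(1)[OF S] by auto
      qed
      have "restrict (\<Phi> x) (V - S) = f"
        using f unfolding x \<Phi>_def by (auto simp: PiE_def extensional_def restrict_def fun_eq_iff)
      then show ?thesis unfolding 1 using x by simp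
    qed
    show "\<Phi> ({v \<in> V. f v = b}, restrict f (V - {v \<in> V. f v = b})) = f" if "f \<in> colourings V d (insert b B) \<kappa> m" for f
      using that unfolding \<Phi>_def colourings_def by (auto simp: PiE_def extensional_def restrict_def fun_eq_iff)
  qed
  then have "card (colourings V d (insert b B) \<kappa> m) = card A" by (simp add: bij_betw_same_card)
  also have "\<dots> = (\<Sum>S\<in>C. card (colourings (V - S) d B \<kappa> m))"
    unfolding A_def using finC insert(1) insert.prems(1)
    by (subst card_SigmaI) (auto intro!: finite_colourings)
  finally have "card (colourings V d (insert b B) \<kappa> m) * (\<Prod>b\<in>insert b B. fact (m b))
      = (\<Sum>S\<in>C. card (colourings (V - S) d B \<kappa> m) * (\<Prod>b\<in>B. fact (m b))) * fact (m b)"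
    unfolding sum_distrib_right[symmetric] using insert(1,2) by simp
  also have "\<dots> = (\<Sum>S\<in>C. fact (n (\<kappa> b) - m b) * (\<Prod>k\<in>K - {\<kappa> b}. fact (n k))) * fact (m b)"
    using IH by simp
  also have "\<dots> = card C * (fact (n (\<kappa> b) - m b) * (\<Prod>k\<in>K - {\<kappa> b}. fact (n k))) * fact (m b)" by simp
  also have "card C = n (\<kappa> b) choose m b" unfolding C_def n_def using insert.prems(1) by (intro n_subsets) simp
  also have "(n (\<kappa> b) choose m b) * (fact (n (\<kappa> b) - m b) * (\<Prod>k\<in>K - {\<kappa> b}. fact (n k))) * fact (m b)
      = (fact (m b) * fact (n (\<kappa> b) - m b) * (n (\<kappa> b) choose m b)) * (\<Prod>k\<in>K - {\<kappa> b}. fact (n k))"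
    by (simp add: mult_ac)
  also have "\<dots> = fact (n (\<kappa> b)) * (\<Prod>k\<in>K - {\<kappa> b}. fact (n k))"
    using binomial_fact_lemma[OF le] by simp
  also have "\<dots> = (\<Prod>k\<in>K. fact (n k))" using insert.prems(2) \<kappa>K by (simp add: prod.remove)
  finally show ?case unfolding n_def .
qed

subsection \<open>Configurations\<close>

lemma half_edges_darts: "half_edges m = darts (vertices m) (tdegree m)"
  by (simp add: half_edges_def darts_def)

lemma configurations_perfect_matchings: "configurations m = perfect_matchings (darts (vertices m) (tdegree m))"
  by (simp add: configurations_def perfect_matchings_def half_edges_darts)

lemma finite_vertices [simp]: "finite (vertices m)"
  by (simp add: vertices_def)

lemma tsupp_subset:
  assumes "finite (tsupp m)"
  shows "\<exists>K. tsupp m \<subseteq> {1..K}"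
proof -
  have "tsupp m \<subseteq> {1..Max (tsupp m)}"
    using Max_ge[OF assms] by (auto simp: tsupp_def)
  then show ?thesis by blast
qed

text \<open>Vertices are numbered in order of degree, so those of degree \<open>k\<close> form the
  interval between consecutive partial sums of \<open>m\<close>. Finite support ensures that the
  minimum defining the degree exists.\<close>

lemma tdegree_eq_iff:
  assumes fin: "finite (tsupp m)" and v: "v \<in> vertices m"
  shows "tdegree m v = k \<longleftrightarrow> k \<noteq> 0 \<and> sum m {1..k - 1} < v \<and> v \<le> sum m {1..k}"
proof -
  obtain K where K: "tsupp m \<subseteq> {1..K}" using tsupp_subset[OF fin] by blast
  have "tsize m \<le> sum m {1..K}" unfolding tsize_def by (rule sum_mono2) (use K in auto)
  then have ex: "v \<le> sum m {1..K}" using v by (simp add: vertices_def)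
  have v1: "1 \<le> v" using v by (simp add: vertices_def)
  have mono: "sum m {1..i} \<le> sum m {1..j}" if "i \<le> j" for i j by (rule sum_mono2) (use that in auto)
  show ?thesis
  proof
    assume k: "tdegree m v = k"
    have le: "v \<le> sum m {1..k}" unfolding k[symmetric] tdegree_def by (rule LeastI[of _ K]) (rule ex)
    then have "k \<noteq> 0" using v1 by (cases k) auto
    moreover have "\<not> v \<le> sum m {1..k - 1}"
      by (rule not_less_Least) (use k \<open>k \<noteq> 0\<close> in \<open>simp add: tdegree_def\<close>)
    ultimately show "k \<noteq> 0 \<and> sum m {1..k - 1} < v \<and> v \<le> sum m {1..k}" using le by simp
  next
    assume k: "k \<noteq> 0 \<and> sum m {1..k - 1} < v \<and> v \<le> sum m {1..k}"
    show "tdegree m v = k" unfolding tdegree_def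
    proof (rule Least_equality)
      fix y assume "v \<le> sum m {1..y}"
      then have "\<not> y \<le> k - 1" using mono[of y "k - 1"] k by linarith
      then show "k \<le> y" by simp
    qed (use k in simp)
  qed
qed

lemma card_tdegree:
  assumes fin: "finite (tsupp m)"
  shows "card {v \<in> vertices m. tdegree m v = k} = (if k = 0 then 0 else m k)"
proof (cases "k = 0")
  case True
  then have "{v \<in> vertices m. tdegree m v = k} = {}" using tdegree_eq_iff[OF fin] by auto
  then show ?thesis using True by simp
next
  case False
  have "sum m {1..k} \<le> tsize m"
  proof -
    have "sum m {1..k} = sum m ({1..k} \<inter> tsupp m)" by (rule sum.mono_neutral_right) (auto simp: tsupp_def)
    also have "\<dots> \<le> tsize m" unfolding tsize_def using fin by (intro sum_mono2) auto
    finally show ?thesis .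
  qed
  then have "{v \<in> vertices m. tdegree m v = k} = {sum m {1..k - 1}<..sum m {1..k}}"
  proof (intro set_eqI)
    fix v
    show "v \<in> {v \<in> vertices m. tdegree m v = k} \<longleftrightarrow> v \<in> {sum m {1..k - 1}<..sum m {1..k}}"
    proof (cases "v \<in> vertices m")
      case True then show ?thesis using tdegree_eq_iff[OF fin True, of k] False by simp
    next
      case False then show ?thesis using \<open>sum m {1..k} \<le> tsize m\<close> by (auto simp: vertices_def)
    qed
  qed
  moreover have "sum m {1..k} = sum m {1..k - 1} + m k" using False by (cases k) auto
  ultimately show ?thesis using False by simp
qed

lemma tdegree_ge_1: "finite (tsupp m) \<Longrightarrow> v \<in> vertices m \<Longrightarrow> 1 \<le> tdegree m v"
  using tdegree_eq_iff[of m v "tdegree m v"] by simp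

lemma sum_tdegree:
  assumes fin: "finite (tsupp m)"
  shows "(\<Sum>v\<in>vertices m. F (tdegree m v)) = (\<Sum>i\<in>tsupp m. m i * F i :: nat)"
proof -
  have sub: "tdegree m ` vertices m \<subseteq> tsupp m"
  proof
    fix k assume "k \<in> tdegree m ` vertices m"
    then obtain v where v: "v \<in> {v \<in> vertices m. tdegree m v = k}" by blast
    then have "card {v \<in> vertices m. tdegree m v = k} \<noteq> 0"
      using card_0_eq[of "{v \<in> vertices m. tdegree m v = k}"] by auto
    then show "k \<in> tsupp m" using card_tdegree[OF fin, of k] by (auto simp: tsupp_def split: if_splits)
  qed
  have "(\<Sum>v\<in>vertices m. F (tdegree m v)) = (\<Sum>i\<in>tsupp m. \<Sum>v\<in>{v \<in> vertices m. tdegree m v = i}. F (tdegree m v))"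
    by (rule sum.group[symmetric]) (use fin sub in auto)
  also have "\<dots> = (\<Sum>i\<in>tsupp m. m i * F i)"
  proof (rule sum.cong[OF refl])
    fix i assume i: "i \<in> tsupp m"
    then have "card {v \<in> vertices m. tdegree m v = i} = m i" using card_tdegree[OF fin, of i] by (auto simp: tsupp_def)
    then show "(\<Sum>v\<in>{v \<in> vertices m. tdegree m v = i}. F (tdegree m v)) = m i * F i" by simp
  qed
  finally show ?thesis .
qed

lemma card_darts_type: "finite (tsupp m) \<Longrightarrow> card (darts (vertices m) (tdegree m)) = tell m"
  using sum_tdegree[of m "\<lambda>i. i"] by (simp add: card_darts tell_def mult.commute)

lemma sum_tsupp_atMost:
  assumes "tsupp m \<subseteq> {1..K}"
  shows "tsize m = sum m {1..K}" "tell m = (\<Sum>i=1..K. i * m i)"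
  unfolding tsize_def tell_def using assms by (auto intro!: sum.mono_neutral_left simp: tsupp_def)

lemma connected_multigraph_linked:
  assumes "finite M"
  shows "connected_multigraph V (multigraph M) \<longleftrightarrow> linked fst V M"
proof -
  have "{(x, y). {x, y} \<in># multigraph M} = edge_rel fst M"
    unfolding multigraph_def edge_rel_def using assms by (auto simp: image_iff)
  then show ?thesis unfolding connected_multigraph_def linked_def by simp
qed

lemma connected_configurations_perfect_matchings:
  "connected_configurations m = {M \<in> perfect_matchings (darts (vertices m) (tdegree m)). linked fst (vertices m) M}"
proof -
  have "finite M" if "M \<in> perfect_matchings (darts (vertices m) (tdegree m))" for M
    using finite_of_perfect_matchings[OF finite_darts that] by simp
  then show ?thesis unfolding connected_configurations_def configurations_perfect_matchings
    using connected_multigraph_linked by blast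
qed

lemma simple_multigraph_defect:
  assumes fin: "finite M" and "defect fst M = 0"
  shows "simple_multigraph (multigraph M)"
proof -
  have le: "card M \<le> card (links fst M)" using assms(2) by (simp add: defect_links)
  have sub: "links fst M \<subseteq> (`) fst ` M" unfolding links_def by blast
  have c: "card (links fst M) \<le> card ((`) fst ` M)" "card ((`) fst ` M) \<le> card M"
    using fin sub by (auto intro: card_mono card_image_le)
  have inj: "inj_on ((`) fst) M" by (rule eq_card_imp_inj_on) (use fin le c in auto)
  have eq: "links fst M = (`) fst ` M" by (rule card_subset_eq) (use fin sub le c in auto)
  have two: "card (fst ` e) = 2" if "e \<in> M" for e using eq that unfolding links_def by blast
  have "{j} \<notin># multigraph M" for j
  proof
    assume "{j} \<in># multigraph M"
    then obtain e where "e \<in> M" "fst ` e = {j}" unfolding multigraph_def using fin by auto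
    then show False using two[of e] by simp
  qed
  moreover have "count (multigraph M) p \<le> 1" for p
  proof -
    have "multigraph M = mset_set ((`) fst ` M)"
      unfolding multigraph_def using image_mset_mset_set[OF inj] by simp
    then show ?thesis by (simp add: count_mset_set')
  qed
  ultimately show ?thesis unfolding simple_multigraph_def by blast
qed

lemma card_simple_connected_ge:
  "card {M \<in> perfect_matchings (darts (vertices m) (tdegree m)). linked fst (vertices m) M \<and> defect fst M = 0}
     \<le> card (simple_connected_configurations m)"
proof (rule card_mono)
  have fp: "finite (perfect_matchings (darts (vertices m) (tdegree m)))" using finite_perfect_matchings[OF finite_darts[OF finite_vertices]] by simp
  show "finite (simple_connected_configurations m)"
    unfolding simple_connected_configurations_def connected_configurations_perfect_matchings using fp by simp
  show "{M \<in> perfect_matchings (darts (vertices m) (tdegree m)). linked fst (vertices m) M \<and> defect fst M = 0}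
    \<subseteq> simple_connected_configurations m"
    unfolding simple_connected_configurations_def connected_configurations_perfect_matchings simple_configurations_def
      configurations_perfect_matchings
    using simple_multigraph_defect finite_of_perfect_matchings[OF finite_darts[OF finite_vertices]] by blast
qed

text \<open>In a system of type \<open>t\<close>, every choice of \<open>m k\<close> among the
  \<open>t k\<close> vertices of each degree \<open>k \<le> k0\<close> gives a candidate for a
  component of type \<open>m\<close>. Their number is the product of the binomial coefficients of
  \<open>t k\<close> over \<open>m k\<close>, and \<open>card_components_le\<close> bounds how many
  candidates with their matchings fit into the larger system.\<close>

lemma card_connected_le:
  fixes m r :: "nat \<Rightarrow> nat"
  defines "t \<equiv> \<lambda>k. m k + r k"
  assumes fin: "finite (tsupp m)" and r: "\<And>k. k \<notin> {1..k0} \<Longrightarrow> r k = 0"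
    and ne: "tsize m \<noteq> 0" and ell: "tell m = 2 * a" "tell r = 2 * c"
  shows "card (connected_configurations m) * odd_fact c * (\<Prod>k=1..k0. fact (t k))
    \<le> (tsize m + tsize r) * odd_fact (a + c) * (\<Prod>k=1..k0. fact (m k) * fact (r k))"
proof -
  obtain K0 where K0: "tsupp m \<subseteq> {1..K0}" using tsupp_subset[OF fin] by blast
  define K where "K = max k0 K0"
  have "tsupp r \<subseteq> {1..k0}" using r unfolding tsupp_def by (metis (mono_tags, lifting) mem_Collect_eq subsetI)
  then have KK: "tsupp m \<subseteq> {1..K}" "tsupp r \<subseteq> {1..K}" using K0 unfolding K_def by force+
  then have Kt: "tsupp t \<subseteq> {1..K}" unfolding t_def tsupp_def by fastforce
  then have fint: "finite (tsupp t)" using finite_subset by blast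
  have tsz: "tsize t = tsize m + tsize r" and tel: "tell t = tell m + tell r"
    unfolding sum_tsupp_atMost[OF KK(1)] sum_tsupp_atMost[OF KK(2)] sum_tsupp_atMost[OF Kt]
    by (simp_all add: t_def sum.distrib algebra_simps)
  define V d where "V = vertices t" and "d = tdegree t"
  define V1 where "V1 = {v \<in> V. d v \<le> k0}"
  define B where "B = {1..k0} \<times> (UNIV :: bool set)"
  define q where "q = (\<lambda>(k, s). if s then m k else r k)"
  define F where "F = colourings V1 d B fst q"
  have finV: "finite V" "finite V1" unfolding V_def V1_def by auto
  have dV: "card {v \<in> V. d v = k} = (if k = 0 then 0 else t k)" for k
    unfolding V_def d_def by (rule card_tdegree[OF fint])
  have d1: "1 \<le> d v" if "v \<in> V" for v using that tdegree_ge_1[OF fint] unfolding V_def d_def by blast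
  have dV1: "{v \<in> V1. d v = k} = {v \<in> V. d v = k}" if "k \<le> k0" for k using that unfolding V1_def by auto
  have cF: "card F * (\<Prod>b\<in>B. fact (q b)) = (\<Prod>k=1..k0. fact (card {v \<in> V1. d v = k}))"
    unfolding F_def
  proof (rule card_colourings)
    show "fst ` B \<subseteq> {1..k0}" "d ` V1 \<subseteq> {1..k0}" using d1 unfolding B_def V1_def by auto
    fix k assume k: "k \<in> {1..k0}"
    then have "{b \<in> B. fst b = k} = {(k, True), (k, False)}" unfolding B_def by auto
    then show "(\<Sum>b\<in>{b \<in> B. fst b = k}. q b) = card {v \<in> V1. d v = k}"
      using k dV1[of k] dV[of k] by (simp add: q_def t_def)
  qed (use finV in \<open>auto simp: B_def\<close>)
  have pB: "(\<Prod>b\<in>B. fact (q b) :: nat) = (\<Prod>k=1..k0. fact (m k) * fact (r k))"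
  proof -
    have "(\<Prod>b\<in>B. fact (q b) :: nat) = (\<Prod>k=1..k0. \<Prod>s\<in>UNIV. fact (q (k, s)))"
      unfolding B_def by (subst prod.cartesian_product) (simp add: case_prod_unfold)
    then show ?thesis by (simp add: UNIV_bool q_def mult.commute)
  qed
  have pK: "(\<Prod>k=1..k0. fact (card {v \<in> V1. d v = k}) :: nat) = (\<Prod>k=1..k0. fact (t k))"
    using dV1 dV by (intro prod.cong) auto
  \<comment> \<open>As \<open>r\<close> vanishes above \<open>k0\<close>, every vertex of larger
    degree belongs to the component.\<close>
  define S where "S f = {v \<in> V. d v \<le> k0 \<longrightarrow> snd (f v)}" for f :: "nat \<Rightarrow> nat \<times> bool"
  have SV: "S f \<subseteq> V" for f unfolding S_def by blast
  have fF: "f v = (d v, snd (f v))" if "f \<in> F" "v \<in> V1" for f v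
  proof -
    have "fst (f v) = d v" using that unfolding F_def colourings_def by simp
    then show ?thesis by (metis prod.collapse)
  qed
  have injS: "inj_on S F"
  proof (rule inj_onI)
    fix f g assume fg: "f \<in> F" "g \<in> F" "S f = S g"
    have ext: "f \<in> V1 \<rightarrow>\<^sub>E B" "g \<in> V1 \<rightarrow>\<^sub>E B" using fg unfolding F_def colourings_def by auto
    show "f = g"
    proof (rule PiE_ext[OF ext])
      fix v assume v: "v \<in> V1"
      then have "snd (f v) \<longleftrightarrow> v \<in> S f" "snd (g v) \<longleftrightarrow> v \<in> S g" unfolding S_def V1_def by auto
      then have "snd (f v) = snd (g v)" using fg(3) by simp
      then show "f v = g v" using fF[OF fg(1) v] fF[OF fg(2) v] by (intro prod_eqI) simp_all
    qed
  qed
  have Sk: "card {v \<in> vertices m. tdegree m v = k} = card {v \<in> S f. d v = k}" if f: "f \<in> F" for f k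
  proof (cases "1 \<le> k \<and> k \<le> k0")
    case True
    then have "{v \<in> S f. d v = k} = {v \<in> V1. f v = (k, True)}"
      using fF[OF f] unfolding S_def V1_def by fastforce
    moreover have "card {v \<in> V1. f v = (k, True)} = m k"
      using f True unfolding F_def colourings_def B_def q_def by fastforce
    ultimately show ?thesis using card_tdegree[OF fin, of k] True by simp
  next
    case False
    then have "{v \<in> S f. d v = k} = {v \<in> V. d v = k}"
      using d1 unfolding S_def by fastforce
    then show ?thesis using card_tdegree[OF fin, of k] dV[of k] False r[of k] by (auto simp: t_def)
  qed
  have "card (S ` F) * (card (connected_configurations m) * odd_fact c) \<le> card V * card (perfect_matchings (darts V d))"
  proof (rule card_components_le[OF finV(1)])
    fix T assume "T \<in> S ` F"
    then obtain f where f: "f \<in> F" "T = S f" by blast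
    have finS: "finite (S f)" using SV finV finite_subset by blast
    obtain \<sigma> where \<sigma>: "bij_betw \<sigma> (vertices m) (S f)" "\<And>v. v \<in> vertices m \<Longrightarrow> d (\<sigma> v) = tdegree m v"
      using ex_bij_betw_fibres[OF finite_vertices finS Sk[OF f(1)]] by blast
    have "vertices m \<noteq> {}" using ne unfolding vertices_def by simp
    then have "S f \<noteq> {}" using \<sigma>(1) by (auto simp: bij_betw_def)
    then show "T \<subseteq> V \<and> T \<noteq> {}" using SV f(2) by simp
    show "card (connected_configurations m) \<le> card {M \<in> perfect_matchings (darts T d). linked fst T M}"
      unfolding connected_configurations_perfect_matchings f(2) by (rule card_linked_relabel[OF \<sigma>(1)]) (use \<sigma>(2) in auto)
    have "(\<Sum>v\<in>S f. d v) = (\<Sum>v\<in>vertices m. d (\<sigma> v))" using sum.reindex_bij_betw[OF \<sigma>(1), of d] by simp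
    also have "\<dots> = (\<Sum>v\<in>vertices m. tdegree m v)" using \<sigma>(2) by simp
    also have "\<dots> = tell m" using card_darts_type[OF fin] card_darts[OF finite_vertices, of m] by metis
    finally have "(\<Sum>v\<in>S f. d v) = tell m" .
    moreover have "(\<Sum>v\<in>V. d v) = tell t"
      unfolding V_def d_def using card_darts_type[OF fint] card_darts[OF finite_vertices, of t] by metis
    ultimately have "card (darts (V - S f) d) = 2 * c"
      using SV[of f] finV tel ell by (simp add: card_darts sum_diff_nat finS)
    then show "odd_fact c \<le> card (perfect_matchings (darts (V - T) d))"
      using card_perfect_matchings[of "darts (V - S f) d" c] f(2) finV by (simp add: finite_darts)
  qed
  moreover have "card (darts V d) = 2 * (a + c)" unfolding V_def d_def using card_darts_type[OF fint] tel ell by simp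
  then have "card (perfect_matchings (darts V d)) = odd_fact (a + c)" by (intro card_perfect_matchings finite_darts finV)
  moreover have "card V = tsize m + tsize r" unfolding V_def vertices_def using tsz by simp
  moreover have "card (S ` F) = card F" using injS by (rule card_image)
  ultimately have "card F * (card (connected_configurations m) * odd_fact c) \<le> (tsize m + tsize r) * odd_fact (a + c)"
    by simp
  then have "card F * (card (connected_configurations m) * odd_fact c) * (\<Prod>b\<in>B. fact (q b))
    \<le> (tsize m + tsize r) * odd_fact (a + c) * (\<Prod>b\<in>B. fact (q b))" by (rule mult_right_mono) simp
  also have "card F * (card (connected_configurations m) * odd_fact c) * (\<Prod>b\<in>B. fact (q b))
    = card (connected_configurations m) * odd_fact c * (card F * (\<Prod>b\<in>B. fact (q b)))" by (simp add: mult_ac)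
  finally show ?thesis by (simp only: pB cF[unfolded pB pK])
qed

section \<open>The lower bound for a given label profile\<close>

definition label_types :: "nat \<Rightarrow> (nat \<times> nat set) set" where
  "label_types k0 = (SIGMA k:{1..k0}. Pow {1..k} - {{}})"

lemma finite_label_types: "finite (label_types k0)"
  by (simp add: label_types_def)

text \<open>The two or more labelled half-edges at each core vertex are the degree condition of the
  growth argument.\<close>

lemma card_linked_core_ge:
  assumes L: "labelling V d L" and c: "card (core_he V L) = 2 * Suc k"
  shows "2 ^ k * fact k \<le> card {C \<in> perfect_matchings (core_he V L). linked fst (core_vs V L) C}"
proof -
  have fin: "finite (core_he V L)" using c by (intro card_ge_0_finite) simp
  have fib: "card {h \<in> core_he V L. fst h = v} = card (L v)" if "v \<in> core_vs V L" for v
  proof -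
    have "{h \<in> core_he V L. fst h = v} = Pair v ` L v" using that by (auto simp: core_he_def)
    then show ?thesis by (simp add: card_image inj_on_def)
  qed
  have "core_he V L \<noteq> {}" using c by auto
  then obtain h where h: "h \<in> core_he V L" by blast
  show ?thesis
  proof (rule card_linked_matchings_ge[OF fin c, of fst _ "fst h"])
    show "fst ` core_he V L \<subseteq> core_vs V L" "fst h \<in> core_vs V L" using h by (auto simp: core_he_def)
    show "\<exists>x\<in>core_he V L. fst x = fst h" using h by blast
    show "2 \<le> card {h \<in> core_he V L. fst h = v}" if "v \<in> core_vs V L" for v
      using fib[OF that] that by (simp add: core_vs_def)
  qed
qed

lemma card_core_pairs_le:
  assumes L: "labelling V d L"
  shows "card {(a, b) \<in> core_he V L \<times> core_he V L. fst a = fst b} \<le> (\<Sum>v\<in>V. (d v)\<^sup>2)"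
proof -
  have finV: "finite V" using L by (simp add: labelling_def)
  define Q where "Q = (SIGMA v:V. {1..d v} \<times> {1..d v})"
  have "{(a, b) \<in> core_he V L \<times> core_he V L. fst a = fst b} \<subseteq> (\<lambda>(v, i, j). ((v, i), (v, j))) ` Q"
  proof clarify
    fix v i w j assume a: "(v, i) \<in> core_he V L" "(w, j) \<in> core_he V L" "fst (v, i) = fst (w, j)"
    then have "(v, i) \<in> darts V d" "(v, j) \<in> darts V d" "w = v" using core_subset_darts[OF L] by auto
    then have "(v, i, j) \<in> Q" unfolding Q_def darts_def by auto
    then show "((v, i), (w, j)) \<in> (\<lambda>(v, i, j). ((v, i), (v, j))) ` Q"
      using \<open>w = v\<close> by (intro rev_image_eqI[of "(v, i, j)"]) auto
  qed
  then have "card {(a, b) \<in> core_he V L \<times> core_he V L. fst a = fst b} \<le> card ((\<lambda>(v, i, j). ((v, i), (v, j))) ` Q)"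
    using finV by (intro card_mono) (auto simp: Q_def)
  also have "\<dots> \<le> card Q" using finV by (intro card_image_le) (auto simp: Q_def)
  also have "\<dots> = (\<Sum>v\<in>V. (d v)\<^sup>2)" using finV by (simp add: Q_def power2_eq_square)
  finally show ?thesis .
qed

lemma sum_colouring:
  fixes G :: "'b \<Rightarrow> nat"
  assumes "f \<in> colourings V d B \<kappa> q" "finite V" "finite B"
  shows "(\<Sum>v\<in>V. G (f v)) = (\<Sum>b\<in>B. q b * G b)"
proof -
  have f: "f ` V \<subseteq> B" "\<And>b. b \<in> B \<Longrightarrow> card {v \<in> V. f v = b} = q b"
    using assms(1) unfolding colourings_def by auto
  have "(\<Sum>v\<in>V. G (f v)) = (\<Sum>b\<in>B. \<Sum>v\<in>{v \<in> V. f v = b}. G (f v))"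
    by (rule sum.group[symmetric]) (use assms f in auto)
  also have "\<dots> = (\<Sum>b\<in>B. q b * G b)"
  proof (rule sum.cong[OF refl])
    fix b assume "b \<in> B"
    then show "(\<Sum>v\<in>{v \<in> V. f v = b}. G (f v)) = q b * G b" using f(2) by simp
  qed
  finally show ?thesis .
qed

text \<open>The profile \<open>q\<close> says how many vertices of each degree up to
  \<open>k0\<close> bear each label set; vertices of larger degree are labelled completely and
  contribute neither tips nor slots. The type \<open>b0\<close>, a core type with a slot, supplies
  the slot outside the trees from which the forest grows. The core bound \<open>X\<close> stays
  abstract so that it can count core matchings with or without control of the defect.\<close>

lemma card_linked_ge_profile:
  fixes m :: "nat \<Rightarrow> nat" and k0 :: nat
  defines "V \<equiv> vertices m" and "d \<equiv> tdegree m" and "B \<equiv> label_types k0"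
  assumes fin: "finite (tsupp m)" and k0: "1 \<le> k0"
    and q: "\<And>j. j \<in> {1..k0} \<Longrightarrow> (\<Sum>b\<in>{b \<in> B. fst b = j}. q b) = m j"
    and T: "(\<Sum>b\<in>B. q b * of_bool (card (snd b) = 1)) = Suc t"
    and W: "(\<Sum>b\<in>B. q b * (fst b - card (snd b))) = Suc t"
    and ell: "tell m = 2 * Suc t + 2 * Suc k"
    and b0: "b0 \<in> B" "2 \<le> card (snd b0)" "card (snd b0) < fst b0" "q b0 \<noteq> 0"
    and X: "\<And>L. labelling V d L \<Longrightarrow> card (core_he V L) = 2 * Suc k \<Longrightarrow>
      X \<le> card {C \<in> perfect_matchings (core_he V L). linked fst (core_vs V L) C \<and> defect fst C \<le> b}"
  shows "(\<Prod>j=1..k0. fact (m j)) * (fact t * X)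
    \<le> card {M \<in> perfect_matchings (darts V d). linked fst V M \<and> defect fst M \<le> b} * (\<Prod>b\<in>B. fact (q b))"
proof -
  define V1 where "V1 = {v \<in> V. d v \<le> k0}"
  define F where "F = colourings V1 d B fst q"
  have finV: "finite V" "finite V1" unfolding V_def V1_def by auto
  have finB: "finite B" unfolding B_def by (rule finite_label_types)
  have d1: "1 \<le> d v" if "v \<in> V" for v using that tdegree_ge_1[OF fin] unfolding V_def d_def by blast
  have dV1: "card {v \<in> V1. d v = j} = m j" if "j \<in> {1..k0}" for j
  proof -
    have "{v \<in> V1. d v = j} = {v \<in> V. d v = j}" using that unfolding V1_def by auto
    then show ?thesis using card_tdegree[OF fin, of j] that unfolding V_def d_def by simp
  qed
  have "card F * (\<Prod>b\<in>B. fact (q b)) = (\<Prod>j=1..k0. fact (card {v \<in> V1. d v = j}))"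
    unfolding F_def
  proof (rule card_colourings[OF finB finV(2)])
    show "fst ` B \<subseteq> {1..k0}" unfolding B_def label_types_def by auto
    show "d ` V1 \<subseteq> {1..k0}" using d1 unfolding V1_def by auto
  qed (use q dV1 in auto)
  then have cF: "card F * (\<Prod>b\<in>B. fact (q b)) = (\<Prod>j=1..k0. fact (m j))" using dV1 by simp
  define lab where "lab f = (\<lambda>v\<in>V. if d v \<le> k0 then snd (f v) else {1..d v})" for f :: "nat \<Rightarrow> nat \<times> nat set"
  have fB: "f v \<in> B" "fst (f v) = d v" if "f \<in> F" "v \<in> V1" for f v
    using that unfolding F_def colourings_def by auto
  have labL: "labelling V d (lab f)" if f: "f \<in> F" for f
    unfolding labelling_def
  proof (intro conjI ballI)
    fix v assume v: "v \<in> V"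
    show "lab f v \<subseteq> {1..d v}" "lab f v \<noteq> {}"
    proof (atomize (full), cases "d v \<le> k0")
      case True
      then have "v \<in> V1" using v unfolding V1_def by simp
      then have "f v \<in> B" "fst (f v) = d v" using fB f by auto
      then have "snd (f v) \<subseteq> {1..d v}" "snd (f v) \<noteq> {}" unfolding B_def label_types_def by auto
      then show "lab f v \<subseteq> {1..d v} \<and> lab f v \<noteq> {}" using True v unfolding lab_def by simp
    next
      case False
      then show "lab f v \<subseteq> {1..d v} \<and> lab f v \<noteq> {}" using v d1[OF v] unfolding lab_def by auto
    qed
  qed (use finV in simp)
  have inj: "inj_on lab F"
  proof (rule inj_onI)
    fix f g assume fg: "f \<in> F" "g \<in> F" "lab f = lab g"
    have ext: "f \<in> V1 \<rightarrow>\<^sub>E B" "g \<in> V1 \<rightarrow>\<^sub>E B" using fg unfolding F_def colourings_def by auto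
    show "f = g"
    proof (rule PiE_ext[OF ext])
      fix v assume v: "v \<in> V1"
      then have "snd (f v) = lab f v" "snd (g v) = lab g v" unfolding lab_def V1_def by auto
      then show "f v = g v" using fB[OF fg(1) v] fB[OF fg(2) v] fg(3) by (metis prod_eqI)
    qed
  qed
  have ge: "fact t * X \<le>
      card {M \<in> perfect_matchings (darts V d). linked fst V M \<and> defect fst M \<le> b \<and> (\<exists>r. fits V d (lab f) M r)}"
    if f: "f \<in> F" for f
  proof -
    have fcol: "f \<in> colourings V1 d B fst q" using f unfolding F_def .
    have labv: "lab f v = snd (f v)" if "v \<in> V1" for v using that unfolding lab_def V1_def by simp
    have labv2: "lab f v = {1..d v}" if "v \<in> V" "v \<notin> V1" for v using that unfolding lab_def V1_def by simp
    have "tree_vs V (lab f) = {v \<in> V1. card (snd (f v)) = 1}"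
    proof (intro set_eqI iffI)
      fix v assume v: "v \<in> tree_vs V (lab f)"
      then have vV: "v \<in> V" "card (lab f v) = 1" unfolding tree_vs_def by auto
      have "v \<in> V1"
      proof (rule ccontr)
        assume "v \<notin> V1"
        \<comment> \<open>A completely labelled vertex has a single label only if its degree is 1,
          which is at most \<open>k0\<close>.\<close>
        then have "d v = 1" "\<not> d v \<le> k0" using labv2[OF vV(1)] vV unfolding V1_def by auto
        then show False using k0 by simp
      qed
      then show "v \<in> {v \<in> V1. card (snd (f v)) = 1}" using vV labv by simp
    next
      fix v assume "v \<in> {v \<in> V1. card (snd (f v)) = 1}"
      then show "v \<in> tree_vs V (lab f)" using labv unfolding tree_vs_def V1_def by auto
    qed
    then have "card (tree_vs V (lab f)) = (\<Sum>v\<in>V1. of_bool (card (snd (f v)) = 1))"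
      using finV by (simp add: Int_def)
    also have "\<dots> = Suc t" using sum_colouring[OF fcol finV(2) finB, of "\<lambda>b. of_bool (card (snd b) = 1)"] T by simp
    finally have cT: "card (tree_vs V (lab f)) = Suc t" .
    have finlab: "finite (lab f v)" "lab f v \<subseteq> {1..d v}" if "v \<in> V" for v
      using labL[OF f] that finite_subset[of "lab f v" "{1..d v}"] unfolding labelling_def by auto
    have "card (slots V d (lab f)) = (\<Sum>v\<in>V. card ({1..d v} - lab f v))"
      unfolding slots_def using finV by simp
    also have "\<dots> = (\<Sum>v\<in>V. d v - card (lab f v))"
      using finlab by (intro sum.cong) (auto simp: card_Diff_subset)
    also have sl: "\<dots> = (\<Sum>v\<in>V1. d v - card (lab f v))"
      by (rule sum.mono_neutral_right) (use finV labv2 in \<open>auto simp: V1_def\<close>)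
    also have "\<dots> = (\<Sum>v\<in>V1. fst (f v) - card (snd (f v)))"
      using labv fB[OF f] by (intro sum.cong) auto
    also have "\<dots> = Suc t" using sum_colouring[OF fcol finV(2) finB, of "\<lambda>b. fst b - card (snd b)"] W by simp
    finally have cW: "card (slots V d (lab f)) = Suc t" .
    have "darts V d = core_he V (lab f) \<union> tip (lab f) ` tree_vs V (lab f) \<union> slots V d (lab f)"
      using darts_cases[OF labL[OF f]] core_subset_darts[OF labL[OF f]] tip_in_darts[OF labL[OF f]]
        slots_subset_darts[of V d "lab f"] by blast
    moreover have fins: "finite (core_he V (lab f))" "finite (tip (lab f) ` tree_vs V (lab f))" "finite (slots V d (lab f))"
      using finite_subset[OF core_subset_darts[OF labL[OF f]] finite_darts[OF finV(1)]]
        finite_subset[OF slots_subset_darts[of V d "lab f"] finite_darts[OF finV(1)]] finV by (auto simp: tree_vs_def)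
    moreover have "core_he V (lab f) \<inter> tip (lab f) ` tree_vs V (lab f) = {}"
      by (auto dest: tip_notin_core)
    moreover have "(core_he V (lab f) \<union> tip (lab f) ` tree_vs V (lab f)) \<inter> slots V d (lab f) = {}"
      using tip_notin_slots[of _ V "lab f" d] core_disj_slots[of _ V "lab f" d] by blast
    ultimately have "card (darts V d) = card (core_he V (lab f)) + card (tip (lab f) ` tree_vs V (lab f)) + Suc t"
      using cW by (simp add: card_Un_disjoint)
    moreover have "card (tip (lab f) ` tree_vs V (lab f)) = Suc t"
      using cT by (subst card_image) (auto intro: inj_onI dest: tip_inj)
    moreover have "card (darts V d) = tell m" unfolding V_def d_def by (rule card_darts_type[OF fin])
    ultimately have cC: "card (core_he V (lab f)) = 2 * Suc k" using ell by simp
    have "\<exists>w\<in>slots V d (lab f). fst w \<notin> tree_vs V (lab f)"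
    proof -
      have "card {v \<in> V1. f v = b0} = q b0" using fcol b0(1) unfolding colourings_def by auto
      then have "{v \<in> V1. f v = b0} \<noteq> {}" using b0(4) by (metis card.empty)
      then obtain v where v: "v \<in> V1" "f v = b0" by blast
      have vV: "v \<in> V" using v unfolding V1_def by simp
      have "card (lab f v) < card {1..d v}" using v labv fB[OF f v(1)] b0(3) by simp
      then have "\<not> {1..d v} \<subseteq> lab f v" using card_mono[OF finlab(1)[OF vV]] by (meson not_le)
      then obtain i where "i \<in> {1..d v} - lab f v" by blast
      then have "(v, i) \<in> slots V d (lab f)" using vV unfolding slots_def by simp
      moreover have "v \<notin> tree_vs V (lab f)" using v labv b0(2) unfolding tree_vs_def by simp
      ultimately show ?thesis by force
    qed
    from card_glue_ge[OF labL[OF f] cT cW this, of b] X[OF labL[OF f] cC]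
    show ?thesis by (meson le_trans mult_le_mono2)
  qed
  have "card (lab ` F) * (fact t * X) \<le> card {M \<in> perfect_matchings (darts V d). linked fst V M \<and> defect fst M \<le> b}"
  proof (rule card_linked_ge_labellings[OF finV(1)])
    show "finite (lab ` F)" unfolding F_def by (intro finite_imageI finite_colourings finV finB)
    show "L \<in> extensional V \<and> labelling V d L" if "L \<in> lab ` F" for L
      using that labL unfolding lab_def by auto
  qed (use ge in auto)
  then have "card F * (fact t * X) * (\<Prod>b\<in>B. fact (q b))
    \<le> card {M \<in> perfect_matchings (darts V d). linked fst V M \<and> defect fst M \<le> b} * (\<Prod>b\<in>B. fact (q b))"
    using card_image[OF inj] by simp
  also have "card F * (fact t * X) * (\<Prod>b\<in>B. fact (q b)) = (\<Prod>j=1..k0. fact (m j)) * (fact t * X)"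
    unfolding cF[symmetric] by (simp add: mult_ac)
  finally show ?thesis .
qed

subsection \<open>The solution of the fixed point equation\<close>

lemma has_sum_diff_real:
  fixes f g :: "'a \<Rightarrow> real"
  assumes "(f has_sum a) A" "(g has_sum b) A"
  shows "((\<lambda>x. f x - g x) has_sum (a - b)) A"
  using has_sum_add[OF assms(1), of "\<lambda>x. - g x" "- b"] assms(2) by (simp add: has_sum_uminus)

text \<open>Up to the weight of degree k, the k-th term of the fixed point equation, with a factor
  \<open>b\<close> split off and \<open>1 - b\<close> cancelled from numerator and denominator. This
  form is continuous up to \<open>b = 1\<close>, where the original quotient is undefined.\<close>

definition beta_kernel :: "nat \<Rightarrow> real \<Rightarrow> real" where
  "beta_kernel k b = (if k = 1 then -1 else (\<Sum>i=1..k-2. b ^ i) / (\<Sum>i<k. b ^ i))"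

lemma beta_kernel_denom:
  assumes "2 \<le> k"
  shows "(\<Sum>i<k. b ^ i) = (\<Sum>i=1..k-2. b ^ i) + (1 + (b::real) ^ (k - 1))"
proof -
  have "{..<k} = insert 0 (insert (k - 1) {1..k-2})" using assms by auto
  moreover have "k - 1 \<notin> {1..k-2}" "0 \<notin> insert (k - 1) {1..k-2}" using assms by auto
  ultimately show ?thesis by (simp add: algebra_simps)
qed

lemma beta_kernel_pos:
  assumes "1 \<le> k" "0 \<le> b"
  shows "0 \<le> (\<Sum>i=1..k-2. b ^ i)" "1 \<le> (\<Sum>i<k. (b::real) ^ i)"
proof -
  show "0 \<le> (\<Sum>i=1..k-2. b ^ i)" using assms by (intro sum_nonneg) auto
  have "(\<Sum>i\<in>{0::nat}. b ^ i) \<le> (\<Sum>i<k. b ^ i)" using assms by (intro sum_mono2) auto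
  then show "1 \<le> (\<Sum>i<k. b ^ i)" by simp
qed

lemma beta_kernel_bound:
  assumes "1 \<le> k" "0 \<le> b"
  shows "\<bar>beta_kernel k b\<bar> \<le> 1"
proof (cases "k = 1")
  case False
  then have "(\<Sum>i=1..k-2. b ^ i) \<le> (\<Sum>i<k. b ^ i)" using beta_kernel_denom[of k b] assms by simp
  then show ?thesis using beta_kernel_pos[OF assms] False by (simp add: beta_kernel_def)
qed (simp add: beta_kernel_def)

lemma beta_kernel_eq:
  assumes "1 \<le> k" "0 < b" "b < 1"
  shows "1 - (1 - b\<^sup>2) / (1 - b ^ k) = b * beta_kernel k b"
proof -
  have bk: "b ^ k < 1" using assms power_less_one_iff[of b k] by simp
  show ?thesis
  proof (cases "k = 1")
    case True
    then show ?thesis using assms by (simp add: beta_kernel_def field_simps power2_eq_square)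
  next
    case False
    then obtain j where j: "k = j + 2" using assms by (metis One_nat_def Suc_1 add.commute le_Suc_ex le_antisym not_less_eq_eq)
    have 1: "(\<Sum>i<k. b ^ i) = (1 - b ^ k) / (1 - b)" using assms by (simp add: sum_gp_strict)
    have "(\<Sum>i=1..k-2. b ^ i) = (\<Sum>i<k. b ^ i) - (1 + b ^ (k - 1))" using beta_kernel_denom[of k b] j by simp
    also have "\<dots> = (b - b ^ (k - 1)) / (1 - b)" unfolding 1 using assms j by (simp add: field_simps)
    finally have "beta_kernel k b = (b - b ^ (k - 1)) / (1 - b ^ k)"
      unfolding beta_kernel_def 1 using False assms bk by simp
    then have "b * beta_kernel k b = (b * b - b * b ^ (k - 1)) / (1 - b ^ k)" by (simp add: right_diff_distrib)
    also have "b * b ^ (k - 1) = b ^ k" using assms by (metis power_minus_mult mult.commute less_le_trans zero_less_one)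
    finally show ?thesis using bk by (simp add: field_simps power2_eq_square)
  qed
qed

text \<open>With \<open>m = k - 1\<close> the kernel is S / (S + 1 + b^m), so it increases iff S /
  (1 + b^m) does. Pairing \<open>i\<close> with \<open>m - i\<close> reduces this to (b^i + b^(m-i))
  / (1 + b^m), where after cross-multiplication the difference is a sum of products of positive
  factors.\<close>

lemma beta_kernel_strict_mono:
  assumes k: "3 \<le> k" and ab: "0 \<le> a" "a < b" "b \<le> 1"
  shows "beta_kernel k a < beta_kernel k b"
proof -
  define m where "m = k - 1"
  define S where "S c = (\<Sum>i=1..m-1. c ^ i)" for c :: real
  have rev: "2 * S c = (\<Sum>i=1..m-1. c ^ i + c ^ (m - i))" for c
  proof -
    have "S c = (\<Sum>i=1..m-1. c ^ (m - i))"
      unfolding S_def by (subst sum.atLeastAtMost_rev) (use k in \<open>auto simp: m_def intro!: sum.cong\<close>)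
    then show ?thesis by (simp add: sum.distrib S_def)
  qed
  have summand: "(a ^ i + a ^ (m - i)) * (1 + b ^ m) < (b ^ i + b ^ (m - i)) * (1 + a ^ m)" if "i \<in> {1..m-1}" for i
  proof -
    have i: "i \<noteq> 0" "m - i \<noteq> 0" "m = i + (m - i)" using that by auto
    have p: "a ^ j < b ^ j" "a ^ j * b ^ j < 1" if "j \<noteq> 0" for j
    proof -
      show "a ^ j < b ^ j" using ab that by (intro power_strict_mono) auto
      have "a * b < 1" using ab by (smt (verit) mult_left_le)
      then show "a ^ j * b ^ j < 1" using ab that by (simp flip: power_mult_distrib add: power_less_one_iff)
    qed
    have "0 < (b ^ (m - i) - a ^ (m - i)) * (1 - a ^ i * b ^ i) + (b ^ i - a ^ i) * (1 - a ^ (m - i) * b ^ (m - i))"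
      using p[OF i(1)] p[OF i(2)] by (intro add_pos_pos mult_pos_pos) auto
    also have "\<dots> = (b ^ i + b ^ (m - i)) * (1 + a ^ i * a ^ (m - i)) - (a ^ i + a ^ (m - i)) * (1 + b ^ i * b ^ (m - i))"
      by (simp add: algebra_simps)
    finally show ?thesis using i(3) by (metis diff_gt_0_iff_gt power_add)
  qed
  have "2 * S a * (1 + b ^ m) < 2 * S b * (1 + a ^ m)"
    unfolding rev sum_distrib_right by (rule sum_strict_mono) (use k summand in \<open>auto simp: m_def\<close>)
  then have *: "S a * (1 + b ^ m) < S b * (1 + a ^ m)" by simp
  have D: "(\<Sum>i<k. c ^ i) = S c + (1 + c ^ m)" for c :: real
    using beta_kernel_denom[of k c] k unfolding S_def m_def by (simp add: numeral_eq_Suc)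
  have Sk: "(\<Sum>i=1..k-2. c ^ i) = S c" for c :: real unfolding S_def m_def by (simp add: numeral_eq_Suc)
  have pos: "0 < S c + (1 + c ^ m)" if "0 \<le> c" for c
    using beta_kernel_pos(2)[of k c] that k unfolding D by simp
  have "S a * (S b + (1 + b ^ m)) < S b * (S a + (1 + a ^ m))" using * by (simp add: algebra_simps)
  then show ?thesis unfolding beta_kernel_def Sk D using k pos[of a] pos[of b] ab
    by (simp add: divide_less_cancel frac_less_eq field_simps)
qed

section \<open>Existence and uniqueness of the solution\<close>

locale degree_distribution =
  fixes p :: "nat \<Rightarrow> real"
  assumes p_nonneg: "\<And>i. 1 \<le> i \<Longrightarrow> 0 \<le> p i"
    and p_sum: "(p has_sum 1) {1..}"
    and p_mean: "(\<lambda>i. real i * p i) summable_on {1..}"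
    and p1_pos: "p 1 > 0"
    and mean_gt_2: "(\<Sum>\<^sub>\<infinity>i\<in>{1..}. real i * p i) > 2"
begin

definition "\<mu> = (\<Sum>\<^sub>\<infinity>i\<in>{1..}. real i * p i)"

lemma mu_has_sum: "((\<lambda>i. real i * p i) has_sum \<mu>) {1..}"
  unfolding \<mu>_def using p_mean by (rule has_sum_infsum)

text \<open>Otherwise the mean would be at most 2. Such a degree makes \<open>beta_fun\<close>
  strictly increasing, and later provides the label types that balance tips against slots.\<close>

lemma ex_p_pos: "\<exists>k\<ge>3. 0 < p k"
proof (rule ccontr)
  assume neg: "\<not> ?thesis"
  have "real i * p i \<le> 2 * p i" if "i \<in> {1..}" for i
  proof (cases "3 \<le> i")
    case True
    then have "p i = 0" using neg p_nonneg[of i] by force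
    then show ?thesis by simp
  next
    case False
    then show ?thesis using p_nonneg[of i] that by (intro mult_right_mono) auto
  qed
  then have "\<mu> \<le> 2 * 1" by (rule has_sum_mono[OF mu_has_sum has_sum_cmult_right[OF p_sum]])
  then show False using mean_gt_2 unfolding \<mu>_def by simp
qed

definition "beta_fun b = (\<Sum>\<^sub>\<infinity>k\<in>{1..}. real k * p k * beta_kernel k b)"

lemma beta_fun_has_sum:
  assumes "0 \<le> b"
  shows "((\<lambda>k. real k * p k * beta_kernel k b) has_sum beta_fun b) {1..}"
  unfolding beta_fun_def
proof (rule has_sum_infsum, rule abs_summable_summable, rule summable_on_comparison_test[OF p_mean])
  fix k :: nat assume k: "k \<in> {1..}"
  then have "\<bar>beta_kernel k b\<bar> \<le> 1" using beta_kernel_bound assms by simp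
  then show "norm (real k * p k * beta_kernel k b) \<le> real k * p k"
    using p_nonneg[of k] k by (simp add: abs_mult mult_left_le)
qed simp

text \<open>The kernels are bounded by 1, so the series is dominated by the one for the mean and
  converges uniformly on the closed interval.\<close>

lemma beta_fun_continuous: "continuous_on {0..1} beta_fun"
proof (rule uniform_limit_theorem)
  show "uniform_limit {0..1} (\<lambda>X b. \<Sum>k\<in>X. real k * p k * beta_kernel k b) beta_fun (finite_subsets_at_top {1..})"
    unfolding beta_fun_def
  proof (rule Weierstrass_m_test_general[OF _ p_mean])
    fix k :: nat and b :: real assume k: "k \<in> {1..}" and b: "b \<in> {0..1}"
    then have "\<bar>beta_kernel k b\<bar> \<le> 1" using beta_kernel_bound by simp
    then show "norm (real k * p k * beta_kernel k b) \<le> real k * p k"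
      using p_nonneg[of k] k by (simp add: abs_mult mult_left_le)
  qed
  have "continuous_on {0..1} (beta_kernel k)" if "1 \<le> k" for k
  proof (cases "k = 1")
    case False
    have "(\<Sum>i<k. b ^ i) \<noteq> 0" if "b \<in> {0..1}" for b :: real
      using beta_kernel_pos(2)[of k b] that \<open>1 \<le> k\<close> by auto
    then have "continuous_on {0..1} (\<lambda>b. (\<Sum>i=1..k-2. b ^ i) / (\<Sum>i<k. (b::real) ^ i))"
      by (intro continuous_intros) auto
    then show ?thesis using False unfolding beta_kernel_def by simp
  qed (simp add: beta_kernel_def)
  then show "\<forall>\<^sub>F X in finite_subsets_at_top {1..}. continuous_on {0..1} (\<lambda>b. \<Sum>k\<in>X. real k * p k * beta_kernel k b)"
    by (intro eventually_finite_subsets_at_top_weakI continuous_intros) auto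
qed simp

lemma beta_fun_strict_mono:
  assumes "0 \<le> a" "a < b" "b \<le> 1"
  shows "beta_fun a < beta_fun b"
proof -
  obtain k0 where k0: "3 \<le> k0" "0 < p k0" using ex_p_pos by blast
  show ?thesis
  proof (rule has_sum_strict_mono[OF beta_fun_has_sum beta_fun_has_sum])
    fix k :: nat assume k: "k \<in> {1..}"
    have "beta_kernel k a \<le> beta_kernel k b"
    proof (cases "3 \<le> k")
      case True then show ?thesis using beta_kernel_strict_mono[of k a b] assms by simp
    next
      case False
      then have "k = 1 \<or> k = 2" using k by auto
      then show ?thesis by (auto simp: beta_kernel_def)
    qed
    then show "real k * p k * beta_kernel k a \<le> real k * p k * beta_kernel k b"
      using p_nonneg[of k] k by (intro mult_left_mono) auto
  next
    show "k0 \<in> {1..}" using k0 by simp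
    show "real k0 * p k0 * beta_kernel k0 a < real k0 * p k0 * beta_kernel k0 b"
      using beta_kernel_strict_mono[OF k0(1) assms] k0 by (intro mult_strict_left_mono) auto
  qed (use assms in auto)
qed

text \<open>At 0 all kernels vanish except the first, which leaves \<open>- p 1\<close>.\<close>

lemma beta_fun_0: "beta_fun 0 < 0"
proof -
  have z: "(\<Sum>i=Suc 0..n. (0::real) ^ i) = 0" for n by (rule sum.neutral) auto
  have "((\<lambda>k. real k * p k * beta_kernel k 0) has_sum (\<Sum>k\<in>{1}. real k * p k * beta_kernel k 0)) {1::nat}"
    by (rule has_sum_finite) simp
  then have "((\<lambda>k. real k * p k * beta_kernel k 0) has_sum (\<Sum>k\<in>{1}. real k * p k * beta_kernel k 0)) {1..}"
    by (rule has_sum_cong_neutral[THEN iffD1, rotated -1]) (use z in \<open>auto simp: beta_kernel_def\<close>)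
  then have "beta_fun 0 = - p 1"
    using beta_fun_has_sum[of 0] has_sum_unique by (fastforce simp: beta_kernel_def)
  then show ?thesis using p1_pos by simp
qed

text \<open>At 1 the kernel equals (k - 2) / k, so the sum is \<mu> - 2; this is where a mean above
  2 makes the equation solvable.\<close>

lemma beta_fun_1: "0 < beta_fun 1"
proof -
  have "((\<lambda>k. real k * p k - 2 * p k) has_sum (\<mu> - 2 * 1)) {1..}"
    by (intro has_sum_diff_real mu_has_sum has_sum_cmult_right p_sum)
  moreover have "real k * p k - 2 * p k = real k * p k * beta_kernel k 1" if "k \<in> {1..}" for k
    using that by (auto simp: beta_kernel_def field_simps of_nat_diff)
  ultimately have "((\<lambda>k. real k * p k * beta_kernel k 1) has_sum (\<mu> - 2 * 1)) {1..}"
    by (rule has_sum_cong[THEN iffD1, rotated])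
  then have "beta_fun 1 = \<mu> - 2" using beta_fun_has_sum[of 1] has_sum_unique by fastforce
  then show ?thesis using mean_gt_2 unfolding \<mu>_def by simp
qed

lemma size_biased_summable:
  assumes "0 < b" "b < 1"
  shows "(\<lambda>k. real k * p k / (1 - b ^ k)) summable_on {1..}"
proof (rule summable_on_comparison_test[OF summable_on_cmult_right[OF p_mean, of "1 / (1 - b)"]])
  fix k :: nat assume k: "k \<in> {1..}"
  have "b ^ k \<le> b" using assms k power_decreasing[of 1 k b] by simp
  then have "1 / (1 - b ^ k) \<le> 1 / (1 - b)" using assms by (intro divide_left_mono mult_pos_pos) auto
  then have "1 / (1 - b ^ k) * (real k * p k) \<le> 1 / (1 - b) * (real k * p k)"
    using p_nonneg[of k] k by (intro mult_right_mono) auto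
  then show "real k * p k / (1 - b ^ k) \<le> 1 / (1 - b) * (real k * p k)" by simp
  show "0 \<le> real k * p k / (1 - b ^ k)" using p_nonneg[of k] k \<open>b ^ k \<le> b\<close> assms by simp
qed

text \<open>By \<open>beta_kernel_eq\<close>, applied termwise, the difference of the two sides is
  \<open>b * beta_fun b\<close>.\<close>

lemma beta_equation_iff:
  assumes "0 < b" "b < 1"
  shows "(\<Sum>\<^sub>\<infinity>k\<in>{1..}. real k * p k) = (1 - b\<^sup>2) * (\<Sum>\<^sub>\<infinity>k\<in>{1..}. real k * p k / (1 - b ^ k))
    \<longleftrightarrow> beta_fun b = 0"
proof -
  define H where "H = (\<Sum>\<^sub>\<infinity>k\<in>{1..}. real k * p k / (1 - b ^ k))"
  have "((\<lambda>k. real k * p k - (1 - b\<^sup>2) * (real k * p k / (1 - b ^ k))) has_sum (\<mu> - (1 - b\<^sup>2) * H)) {1..}"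
    unfolding H_def by (intro has_sum_diff_real mu_has_sum has_sum_cmult_right has_sum_infsum size_biased_summable assms)
  moreover have "real k * p k - (1 - b\<^sup>2) * (real k * p k / (1 - b ^ k)) = b * (real k * p k * beta_kernel k b)"
    if "k \<in> {1..}" for k
  proof -
    have "real k * p k - (1 - b\<^sup>2) * (real k * p k / (1 - b ^ k)) = real k * p k * (1 - (1 - b\<^sup>2) / (1 - b ^ k))"
      by (simp add: algebra_simps)
    then show ?thesis using beta_kernel_eq[of k b] that assms by simp
  qed
  ultimately have "((\<lambda>k. b * (real k * p k * beta_kernel k b)) has_sum (\<mu> - (1 - b\<^sup>2) * H)) {1..}"
    by (rule has_sum_cong[THEN iffD1, rotated])
  moreover have "((\<lambda>k. b * (real k * p k * beta_kernel k b)) has_sum (b * beta_fun b)) {1..}"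
    using assms by (intro has_sum_cmult_right beta_fun_has_sum) auto
  ultimately have "\<mu> - (1 - b\<^sup>2) * H = b * beta_fun b" by (rule has_sum_unique)
  then show ?thesis unfolding H_def \<mu>_def using assms by auto
qed

lemma beta_of_props:
  "0 < beta_of p" "beta_of p < 1"
  "((\<lambda>k. real k * p k / (1 - beta_of p ^ k)) has_sum (\<mu> / (1 - (beta_of p)\<^sup>2))) {1..}"
proof -
  have "\<exists>b\<ge>0. b \<le> 1 \<and> beta_fun b = 0"
    using IVT'[of beta_fun 0 0 1] beta_fun_0 beta_fun_1 beta_fun_continuous by auto
  then obtain b where b: "0 \<le> b" "b \<le> 1" "beta_fun b = 0" by blast
  then have b01: "0 < b" "b < 1" using beta_fun_0 beta_fun_1 by (auto simp: less_le)
  define P where "P b \<longleftrightarrow> 0 < b \<and> b < 1 \<and>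
     (\<Sum>\<^sub>\<infinity>k\<in>{1..}. real k * p k) = (1 - b\<^sup>2) * (\<Sum>\<^sub>\<infinity>k\<in>{1..}. real k * p k / (1 - b ^ k))" for b
  have Pb: "P b" unfolding P_def using b b01 beta_equation_iff by simp
  have "c = b" if "P c" for c
  proof -
    have "0 < c" "c < 1" "beta_fun c = 0" using that beta_equation_iff unfolding P_def by auto
    then show ?thesis using beta_fun_strict_mono[of b c] beta_fun_strict_mono[of c b] b b01
      by (cases "b < c"; cases "c < b") auto
  qed
  then have "beta_of p = b" unfolding beta_of_def P_def[symmetric] using Pb by blast
  then show 1: "0 < beta_of p" "beta_of p < 1" using b01 by auto
  have "\<mu> = (1 - b\<^sup>2) * (\<Sum>\<^sub>\<infinity>k\<in>{1..}. real k * p k / (1 - b ^ k))" using Pb unfolding P_def \<mu>_def by simp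
  moreover have "1 - b\<^sup>2 \<noteq> 0" using b01 by (simp add: power2_eq_1_iff)
  ultimately have "(\<Sum>\<^sub>\<infinity>k\<in>{1..}. real k * p k / (1 - b ^ k)) = \<mu> / (1 - b\<^sup>2)" by (simp add: field_simps)
  then show "((\<lambda>k. real k * p k / (1 - beta_of p ^ k)) has_sum (\<mu> / (1 - (beta_of p)\<^sup>2))) {1..}"
    using has_sum_infsum[OF size_biased_summable[OF b01]] \<open>beta_of p = b\<close> by simp
qed

end

subsection \<open>Exponential rates\<close>

text \<open>Passes from the unordered sums of the statement to truncations at degree
  \<open>K\<close>.\<close>

lemma has_sum_partial_sums:
  fixes f :: "nat \<Rightarrow> real"
  assumes "(f has_sum S) {1..}"
  shows "(\<lambda>K. \<Sum>k=1..K. f k) \<longlonglongrightarrow> S"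
proof -
  have "filterlim (\<lambda>K. {1..K}) (finite_subsets_at_top {1::nat..}) sequentially"
    unfolding filterlim_finite_subsets_at_top
  proof (intro allI impI)
    fix X :: "nat set" assume X: "finite X \<and> X \<subseteq> {1..}"
    have "X \<subseteq> {1..K}" if "K \<ge> Max (insert 0 X)" for K
    proof
      fix x assume "x \<in> X"
      then have "x \<le> K" using that X Max_ge[of "insert 0 X" x] by simp
      then show "x \<in> {1..K}" using X \<open>x \<in> X\<close> by auto
    qed
    then show "\<forall>\<^sub>F K in sequentially. finite {1..K} \<and> X \<subseteq> {1..K} \<and> {1..K} \<subseteq> {1..}"
      unfolding eventually_sequentially by (intro exI[of _ "Max (insert 0 X)"]) auto
  qed
  then show ?thesis using assms unfolding has_sum_def by (rule filterlim_compose[rotated])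
qed

text \<open>The entropy function, equal to 0 at 0; its continuity there covers degrees with
  \<open>p k = 0\<close>.\<close>

definition xlnx :: "real \<Rightarrow> real" where
  "xlnx x = x * ln x"

lemma xlnx_0 [simp]: "xlnx 0 = 0"
  by (simp add: xlnx_def)

lemma xlnx_mult: "0 \<le> x \<Longrightarrow> 0 < c \<Longrightarrow> xlnx (x * c) = c * xlnx x + x * c * ln c"
  by (cases "x = 0") (auto simp: xlnx_def ln_mult algebra_simps)

lemma continuous_on_xlnx: "continuous_on {0..} xlnx"
proof -
  have "continuous (at x within {0..}) xlnx" if "x \<in> {0..}" for x
  proof (cases "x = 0")
    case True
    have "((\<lambda>x. x * ln x) \<longlongrightarrow> 0) (at_right (0::real))" by real_asymp
    then have "(xlnx \<longlongrightarrow> xlnx 0) (at 0 within {0<..})" unfolding xlnx_def by simp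
    then have "(xlnx \<longlongrightarrow> xlnx 0) (at 0 within {0..})"
      by (simp add: at_within_Ici_at_right)
    then show ?thesis unfolding continuous_within True .
  next
    case False
    then have "x > 0" using that by simp
    then have "isCont xlnx x" unfolding xlnx_def by (intro continuous_intros) auto
    then show ?thesis using continuous_at_imp_continuous_at_within by blast
  qed
  then show ?thesis unfolding continuous_on_eq_continuous_within by blast
qed

lemma tendsto_xlnx:
  assumes "(f \<longlongrightarrow> x) F" "0 \<le> x" "\<forall>\<^sub>F n in F. 0 \<le> f n"
  shows "((\<lambda>n. xlnx (f n)) \<longlongrightarrow> xlnx x) F"
  using continuous_on_tendsto_compose[OF continuous_on_xlnx assms(1)] assms by simp

text \<open>\<open>rate f e L\<close> says \<open>f n = n powr e n * exp (L * n + o(n))\<close>.\<close>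

definition rate :: "(nat \<Rightarrow> real) \<Rightarrow> (nat \<Rightarrow> real) \<Rightarrow> real \<Rightarrow> bool" where
  "rate f e L \<longleftrightarrow> (\<forall>\<^sub>F n in sequentially. 0 < f n) \<and>
     (\<lambda>n. (ln (f n) - e n * ln (real n)) / real n) \<longlonglongrightarrow> L"

lemma rate_mult:
  assumes "rate f e L" "rate g e' L'"
  shows "rate (\<lambda>n. f n * g n) (\<lambda>n. e n + e' n) (L + L')"
proof -
  have pos: "\<forall>\<^sub>F n in sequentially. 0 < f n \<and> 0 < g n" using assms unfolding rate_def by (auto intro: eventually_conj)
  have "(\<lambda>n. (ln (f n) - e n * ln (real n)) / real n + (ln (g n) - e' n * ln (real n)) / real n) \<longlonglongrightarrow> L + L'"
    using assms unfolding rate_def by (intro tendsto_add) auto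
  moreover have "\<forall>\<^sub>F n in sequentially. (ln (f n) - e n * ln (real n)) / real n + (ln (g n) - e' n * ln (real n)) / real n
     = (ln (f n * g n) - (e n + e' n) * ln (real n)) / real n"
    using pos by eventually_elim (simp add: ln_mult diff_divide_distrib add_divide_distrib algebra_simps)
  ultimately have "(\<lambda>n. (ln (f n * g n) - (e n + e' n) * ln (real n)) / real n) \<longlonglongrightarrow> L + L'"
    by (rule Lim_transform_eventually)
  then show ?thesis unfolding rate_def using eventually_mono[OF pos] by (auto elim!: eventually_mono)
qed

lemma rate_inverse:
  assumes "rate f e L"
  shows "rate (\<lambda>n. inverse (f n)) (\<lambda>n. - e n) (- L)"
proof -
  have pos: "\<forall>\<^sub>F n in sequentially. 0 < f n" using assms unfolding rate_def by auto
  have "(\<lambda>n. - ((ln (f n) - e n * ln (real n)) / real n)) \<longlonglongrightarrow> - L"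
    using assms unfolding rate_def by (intro tendsto_minus) auto
  moreover have "\<forall>\<^sub>F n in sequentially. - ((ln (f n) - e n * ln (real n)) / real n)
     = (ln (inverse (f n)) - (- e n) * ln (real n)) / real n"
    using pos by eventually_elim (simp add: ln_inverse diff_divide_distrib add_divide_distrib)
  ultimately have "(\<lambda>n. (ln (inverse (f n)) - (- e n) * ln (real n)) / real n) \<longlonglongrightarrow> - L"
    by (rule Lim_transform_eventually)
  then show ?thesis unfolding rate_def using pos by (auto elim!: eventually_mono)
qed

lemma rate_divide:
  assumes "rate f e L" "rate g e' L'"
  shows "rate (\<lambda>n. f n / g n) (\<lambda>n. e n - e' n) (L - L')"
  using rate_mult[OF assms(1) rate_inverse[OF assms(2)]] by (simp add: divide_inverse)

lemma rate_subexp: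
  assumes "\<forall>\<^sub>F n in sequentially. 0 < f n" "(\<lambda>n. ln (f n) / real n) \<longlonglongrightarrow> 0"
  shows "rate f (\<lambda>_. 0) 0"
  using assms unfolding rate_def by simp

lemma rate_prod:
  assumes "finite A" "\<And>i. i \<in> A \<Longrightarrow> rate (f i) (e i) (L i)"
  shows "rate (\<lambda>n. \<Prod>i\<in>A. f i n) (\<lambda>n. \<Sum>i\<in>A. e i n) (\<Sum>i\<in>A. L i)"
  using assms
proof (induction A rule: finite_induct)
  case empty
  then show ?case by (simp add: rate_def)
next
  case (insert i A)
  then show ?case using rate_mult[of "f i" "e i" "L i"] by simp
qed

lemma ln_over_real: "(\<lambda>n. ln (real n) / real n) \<longlonglongrightarrow> 0"
  by real_asymp

text \<open>A bounded power of n is subexponential.\<close>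

lemma rate_exponent:
  assumes "rate f e L" "\<forall>\<^sub>F n in sequentially. \<bar>e n - e' n\<bar> \<le> C"
  shows "rate f e' L"
proof -
  have "(\<lambda>n. (e n - e' n) * (ln (real n) / real n)) \<longlonglongrightarrow> 0"
  proof (rule Lim_null_comparison)
    show "\<forall>\<^sub>F n in sequentially. norm ((e n - e' n) * (ln (real n) / real n)) \<le> C * norm (ln (real n) / real n)"
      using assms(2) by eventually_elim (simp only: abs_mult real_norm_def mult_right_mono abs_ge_zero)
    show "(\<lambda>n. C * norm (ln (real n) / real n)) \<longlonglongrightarrow> 0"
      using tendsto_mult_right_zero[OF tendsto_norm_zero[OF ln_over_real]] .
  qed
  then have "(\<lambda>n. (ln (f n) - e n * ln (real n)) / real n + (e n - e' n) * (ln (real n) / real n)) \<longlonglongrightarrow> L + 0"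
    using assms(1) unfolding rate_def by (intro tendsto_add) auto
  then have "(\<lambda>n. (ln (f n) - e' n * ln (real n)) / real n) \<longlonglongrightarrow> L"
    by (simp add: diff_divide_distrib algebra_simps)
  then show ?thesis using assms(1) unfolding rate_def by simp
qed

section \<open>Stirling bounds and factorial rates\<close>

lemma ln_fact_ge: "xlnx (real m) - real m \<le> ln (fact m)"
proof (induction m)
  case (Suc m)
  have "xlnx (real (Suc m)) - real (Suc m) - (xlnx (real m) - real m) \<le> ln (real (Suc m))"
  proof (cases "m = 0")
    case False
    then have "ln (real (Suc m)) - ln (real m) = ln (real (Suc m) / real m)" by (subst ln_divide_pos) auto
    also have "real (Suc m) / real m = 1 + 1 / real m" using False by (simp add: field_simps)
    also have "ln (1 + 1 / real m) \<le> 1 / real m" by (rule ln_add_one_self_le_self) simp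
    finally have "real m * (ln (real (Suc m)) - ln (real m)) \<le> 1" using False by (simp add: field_simps)
    then show ?thesis by (simp add: xlnx_def algebra_simps)
  qed (simp add: xlnx_def)
  moreover have "ln (fact (Suc m) :: real) = ln (real (Suc m)) + ln (fact m)" by (simp add: ln_mult)
  ultimately show ?case using Suc by linarith
qed simp

text \<open>The shifted argument \<open>Suc m\<close> absorbs the error term of Stirling's formula
  and gives equality at 0. The induction uses ln x \<le> x - 1 at x = (m+1)/(m+2).\<close>

lemma ln_fact_le: "ln (fact m) \<le> xlnx (real (Suc m)) - real m"
proof (induction m)
  case (Suc m)
  have "ln (real (Suc m) / real (Suc (Suc m))) \<le> real (Suc m) / real (Suc (Suc m)) - 1" by (rule ln_le_minus_one) simp
  also have "\<dots> = - 1 / real (Suc (Suc m))" by (simp add: field_simps)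
  also have "ln (real (Suc m) / real (Suc (Suc m))) = ln (real (Suc m)) - ln (real (Suc (Suc m)))" by (rule ln_divide_pos) simp_all
  finally have "1 / real (Suc (Suc m)) \<le> ln (real (Suc (Suc m))) - ln (real (Suc m))" by simp
  then have "1 \<le> (ln (real (Suc (Suc m))) - ln (real (Suc m))) * real (Suc (Suc m))"
    by (simp add: pos_divide_le_eq)
  then have "ln (real (Suc m)) \<le> xlnx (real (Suc (Suc m))) - real (Suc m) - (xlnx (real (Suc m)) - real m)"
    by (simp add: xlnx_def algebra_simps)
  moreover have "ln (fact (Suc m) :: real) = ln (real (Suc m)) + ln (fact m)" by (simp add: ln_mult)
  ultimately show ?case using Suc by linarith
qed (simp add: xlnx_def)

text \<open>Stirling's formula with \<open>a n\<close> written as n times the ratio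
  \<open>a n / n\<close>, which splits off n to the power \<open>a n\<close>. The case
  \<open>x = 0\<close> is included through the continuity of \<open>xlnx\<close> at 0.\<close>

lemma rate_fact:
  assumes lim: "(\<lambda>n. real (a n) / real n) \<longlonglongrightarrow> x"
  shows "rate (\<lambda>n. fact (a n)) (\<lambda>n. real (a n)) (xlnx x - x)"
proof -
  have x: "0 \<le> x" by (rule tendsto_lowerbound[OF lim]) auto
  have lim': "(\<lambda>n. real (Suc (a n)) / real n) \<longlonglongrightarrow> x"
  proof -
    have "(\<lambda>n. real (a n) / real n + 1 / real n) \<longlonglongrightarrow> x + 0" by (intro tendsto_add lim lim_1_over_n)
    then show ?thesis by (simp add: add_divide_distrib add.commute)
  qed
  define lo where "lo n = xlnx (real (a n) / real n) - real (a n) / real n" for n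
  \<comment> \<open>The last term compensates the shift: \<open>Suc (a n)\<close> subtracts one more
    \<open>ln n\<close> than the exponent \<open>a n\<close> does.\<close>
  define up where "up n = xlnx (real (Suc (a n)) / real n) - real (a n) / real n + ln (real n) / real n" for n
  have "(\<lambda>n. (ln (fact (a n)) - real (a n) * ln (real n)) / real n) \<longlonglongrightarrow> xlnx x - x"
  proof (rule tendsto_sandwich)
    show "lo \<longlonglongrightarrow> xlnx x - x" unfolding lo_def by (intro tendsto_diff tendsto_xlnx lim x) auto
    have "up \<longlonglongrightarrow> xlnx x - x + 0" unfolding up_def
      by (intro tendsto_diff tendsto_add tendsto_xlnx lim lim' x ln_over_real) auto
    then show "up \<longlonglongrightarrow> xlnx x - x" by simp
    have eq: "xlnx (real k / real n) = (xlnx (real k) - real k * ln (real n)) / real n" if "n > 0" for k n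
      using that by (cases "k = 0") (auto simp: xlnx_def ln_div field_simps)
    show "\<forall>\<^sub>F n in sequentially. lo n \<le> (ln (fact (a n)) - real (a n) * ln (real n)) / real n"
      using eventually_gt_at_top[of 0]
    proof eventually_elim
      case (elim n)
      have "lo n = (xlnx (real (a n)) - real (a n) - real (a n) * ln (real n)) / real n"
        unfolding lo_def eq[OF elim] by (simp add: diff_divide_distrib)
      then show ?case using ln_fact_ge[of "a n"] by (simp add: divide_right_mono)
    qed
    show "\<forall>\<^sub>F n in sequentially. (ln (fact (a n)) - real (a n) * ln (real n)) / real n \<le> up n"
      using eventually_gt_at_top[of 0]
    proof eventually_elim
      case (elim n)
      have "up n = (xlnx (real (Suc (a n))) - real (a n) - real (a n) * ln (real n)) / real n"
        unfolding up_def eq[OF elim] by (simp add: diff_divide_distrib add_divide_distrib distrib_right)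
      then show ?case using ln_fact_le[of "a n"] by (simp add: divide_right_mono)
    qed
  qed
  then show ?thesis unfolding rate_def by simp
qed

lemma rate_power2:
  assumes lim: "(\<lambda>n. real (k n) / real n) \<longlonglongrightarrow> y"
  shows "rate (\<lambda>n. 2 ^ k n) (\<lambda>_. 0) (y * ln 2)"
proof -
  have "(\<lambda>n. real (k n) / real n * ln 2) \<longlonglongrightarrow> y * ln 2" by (intro tendsto_mult lim tendsto_const)
  then show ?thesis unfolding rate_def by (simp add: ln_realpow)
qed

lemma rate_power2_fact:
  assumes lim: "(\<lambda>n. real (k n) / real n) \<longlonglongrightarrow> y"
  shows "rate (\<lambda>n. 2 ^ k n * fact (k n)) (\<lambda>n. real (k n)) (xlnx (2 * y) / 2 - y)"
proof -
  have y: "0 \<le> y" by (rule tendsto_lowerbound[OF lim]) auto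
  have "y * ln 2 + (xlnx y - y) = xlnx (2 * y) / 2 - y"
    using xlnx_mult[OF y, of 2] by (simp add: mult.commute)
  note eq = this
  show ?thesis unfolding eq[symmetric] using rate_mult[OF rate_power2[OF lim] rate_fact[OF lim]] by simp
qed

text \<open>From (2k-1)!! = (2k)! / (2^k k!), the powers 2k and k of n subtract to k.\<close>

lemma rate_odd_fact:
  assumes lim: "(\<lambda>n. real (k n) / real n) \<longlonglongrightarrow> y"
  shows "rate (\<lambda>n. real (odd_fact (k n))) (\<lambda>n. real (k n)) (xlnx (2 * y) / 2 - y)"
proof -
  have lim2: "(\<lambda>n. real (2 * k n) / real n) \<longlonglongrightarrow> 2 * y"
    using tendsto_mult_left[OF lim, of 2] by simp
  have eq: "real (odd_fact j) = fact (2 * j) / (2 ^ j * fact j)" for j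
  proof -
    have "real (odd_fact j * (2 ^ j * fact j)) = real (fact (2 * j))" by (subst odd_fact_fact) simp
    then have "real (odd_fact j) * (2 ^ j * fact j) = fact (2 * j)" by simp
    then show ?thesis by (simp add: eq_divide_eq)
  qed
  have "(\<lambda>n. real (2 * k n) - real (k n)) = (\<lambda>n. real (k n))" by auto
  then show ?thesis unfolding eq using rate_divide[OF rate_fact[OF lim2] rate_power2_fact[OF lim]] by simp
qed

section \<open>From rates to exponential bounds\<close>

lemma rate_upper:
  assumes g: "rate g e L" and B: "rate B e' M" and e: "\<forall>\<^sub>F n in sequentially. \<bar>e n - e' n\<bar> \<le> C" and eps: "L - M < K"
    and le: "\<forall>\<^sub>F n in sequentially. a n \<le> g n"
  shows "\<forall>\<^sub>F n in sequentially. a n \<le> exp (K * real n) * B n"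
proof -
  have r: "rate (\<lambda>n. g n / B n) (\<lambda>_. 0) (L - M)"
    using rate_divide[OF rate_exponent[OF g e] B] by simp
  then have "\<forall>\<^sub>F n in sequentially. ln (g n / B n) / real n < K"
    using order_tendstoD(2)[OF _ eps, of "\<lambda>n. ln (g n / B n) / real n"] unfolding rate_def by simp
  moreover have "\<forall>\<^sub>F n in sequentially. 0 < g n / B n" using r unfolding rate_def by simp
  moreover have "\<forall>\<^sub>F n in sequentially. 0 < B n" using B unfolding rate_def by simp
  ultimately show ?thesis using le eventually_gt_at_top[of 0]
  proof eventually_elim
    case (elim n)
    then have "ln (g n / B n) < K * real n" by (simp add: divide_less_eq)
    then have "g n / B n < exp (K * real n)" using elim by (metis exp_less_mono exp_ln)
    then show ?case using elim by (simp add: divide_less_eq)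
  qed
qed

lemma rate_lower:
  assumes g: "rate g e L" and B: "rate B e' M" and e: "\<forall>\<^sub>F n in sequentially. \<bar>e n - e' n\<bar> \<le> C" and eps: "K < L - M"
    and le: "\<forall>\<^sub>F n in sequentially. g n \<le> a n"
  shows "\<forall>\<^sub>F n in sequentially. exp (K * real n) * B n \<le> a n"
proof -
  have r: "rate (\<lambda>n. g n / B n) (\<lambda>_. 0) (L - M)"
    using rate_divide[OF rate_exponent[OF g e] B] by simp
  then have "\<forall>\<^sub>F n in sequentially. K < ln (g n / B n) / real n"
    using order_tendstoD(1)[OF _ eps, of "\<lambda>n. ln (g n / B n) / real n"] unfolding rate_def by simp
  moreover have "\<forall>\<^sub>F n in sequentially. 0 < g n / B n" using r unfolding rate_def by simp
  moreover have "\<forall>\<^sub>F n in sequentially. 0 < B n" using B unfolding rate_def by simp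
  ultimately show ?thesis using le eventually_gt_at_top[of 0]
  proof eventually_elim
    case (elim n)
    then have "K * real n < ln (g n / B n)" by (simp add: less_divide_eq)
    then have "exp (K * real n) < g n / B n" using elim by (metis exp_less_mono exp_ln)
    then show ?case using elim by (simp add: less_divide_eq)
  qed
qed

lemma exp_asympI:
  assumes B: "\<forall>\<^sub>F n in sequentially. 0 < B n"
    and up: "\<And>c. - K < c \<Longrightarrow> \<forall>\<^sub>F n in sequentially. a n \<le> exp (c * real n) * B n"
    and lo: "\<And>c. c < - K \<Longrightarrow> \<forall>\<^sub>F n in sequentially. exp (c * real n) * B n \<le> a n"
  shows "exp_asymp K a B"
proof -
  have "\<forall>\<^sub>F n in sequentially. exp ((- K - 1) * real n) * B n \<le> a n" by (rule lo) simp
  \<comment> \<open>The lower bound just obtained makes \<open>a n\<close> positive for large n, so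
    that its logarithm is meaningful.\<close>
  then have a: "\<forall>\<^sub>F n in sequentially. 0 < a n"
    using B by eventually_elim (meson exp_gt_zero less_le_trans mult_pos_pos)
  define \<epsilon> where "\<epsilon> n = ln (a n / B n) / real n + K" for n
  have bnd: "\<forall>\<^sub>F n in sequentially. c < ln (a n / B n) / real n" if "c < - K" for c
  proof -
    obtain c' where c': "c < c'" "c' < - K" using dense[OF \<open>c < - K\<close>] by blast
    show ?thesis using lo[OF c'(2)] a B eventually_gt_at_top[of 0]
    proof eventually_elim
      case (elim n)
      then have "exp (c' * real n) \<le> a n / B n" by (simp add: le_divide_eq)
      then have "c' * real n \<le> ln (a n / B n)" using elim by (simp add: ln_ge_iff)
      then have "c' \<le> ln (a n / B n) / real n" using elim by (simp add: le_divide_eq)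
      then show ?case using c' by simp
    qed
  qed
  have bnd': "\<forall>\<^sub>F n in sequentially. ln (a n / B n) / real n < c" if "- K < c" for c
  proof -
    obtain c' where c': "- K < c'" "c' < c" using dense[OF \<open>- K < c\<close>] by blast
    show ?thesis using up[OF c'(1)] a B eventually_gt_at_top[of 0]
    proof eventually_elim
      case (elim n)
      then have "a n / B n \<le> exp (c' * real n)" by (simp add: divide_le_eq)
      then have "ln (a n / B n) \<le> c' * real n" using elim by (metis divide_pos_pos ln_exp ln_le_cancel_iff exp_gt_zero)
      then have "ln (a n / B n) / real n \<le> c'" using elim by (simp add: divide_le_eq)
      then show ?case using c' by simp
    qed
  qed
  have "(\<lambda>n. ln (a n / B n) / real n) \<longlonglongrightarrow> - K" using bnd bnd' by (rule order_tendstoI)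
  then have "\<epsilon> \<longlonglongrightarrow> - K + K" unfolding \<epsilon>_def by (intro tendsto_add tendsto_const)
  moreover have "\<forall>\<^sub>F n in sequentially. a n = exp (- K * real n + \<epsilon> n * real n) * B n"
    using a B eventually_gt_at_top[of 0]
  proof eventually_elim
    case (elim n)
    then have "- K * real n + \<epsilon> n * real n = ln (a n / B n)" unfolding \<epsilon>_def by (simp add: field_simps)
    then show ?case using elim by simp
  qed
  ultimately show ?thesis unfolding exp_asymp_def by (intro exI[of _ \<epsilon>]) simp
qed

subsection \<open>The upper bound\<close>

lemma tendsto_nat_floor:
  assumes "0 \<le> x"
  shows "(\<lambda>n. real (nat \<lfloor>real n * x\<rfloor>) / real n) \<longlonglongrightarrow> x"
proof (rule tendsto_sandwich)
  have "(\<lambda>n. x - 1 / real n) \<longlonglongrightarrow> x - 0" by (intro tendsto_diff tendsto_const lim_1_over_n)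
  then show "(\<lambda>n. x - 1 / real n) \<longlonglongrightarrow> x" by simp
  show "\<forall>\<^sub>F n in sequentially. x - 1 / real n \<le> real (nat \<lfloor>real n * x\<rfloor>) / real n"
    using eventually_gt_at_top[of 0]
  proof eventually_elim
    case (elim n)
    have "real n * x - 1 \<le> real (nat \<lfloor>real n * x\<rfloor>)" by linarith
    then have "(real n * x - 1) / real n \<le> real (nat \<lfloor>real n * x\<rfloor>) / real n" by (rule divide_right_mono) simp
    then show ?case using elim by (simp add: diff_divide_distrib)
  qed
  show "\<forall>\<^sub>F n in sequentially. real (nat \<lfloor>real n * x\<rfloor>) / real n \<le> x"
    using eventually_gt_at_top[of 0]
  proof eventually_elim
    case (elim n)
    have "0 \<le> real n * x" using assms by simp
    then have "real (nat \<lfloor>real n * x\<rfloor>) \<le> real n * x" by linarith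
    then show ?case using elim by (simp add: divide_le_eq mult.commute)
  qed
qed simp

lemma rate_linear:
  assumes lim: "(\<lambda>n. f n / real n) \<longlonglongrightarrow> s" and s: "0 < s"
  shows "rate f (\<lambda>_. 0) 0"
proof (rule rate_subexp)
  have pos: "\<forall>\<^sub>F n in sequentially. 0 < f n / real n" using order_tendstoD(1)[OF lim s] .
  then show "\<forall>\<^sub>F n in sequentially. 0 < f n"
    using eventually_gt_at_top[of 0] by eventually_elim (simp add: zero_less_divide_iff)
  have "(\<lambda>n. ln (f n / real n)) \<longlonglongrightarrow> ln s" using lim s by (intro tendsto_ln) auto
  then have "(\<lambda>n. ln (f n / real n) * (1 / real n) + ln (real n) / real n) \<longlonglongrightarrow> ln s * 0 + 0"
    by (intro tendsto_add tendsto_mult ln_over_real lim_1_over_n)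
  moreover have "\<forall>\<^sub>F n in sequentially. ln (f n / real n) * (1 / real n) + ln (real n) / real n = ln (f n) / real n"
    using pos eventually_gt_at_top[of 0]
  proof eventually_elim
    case (elim n)
    then have "0 < f n" by (simp add: zero_less_divide_iff)
    then have "ln (f n / real n) = ln (f n) - ln (real n)" using elim by (intro ln_divide_pos) auto
    then show ?case by (simp add: diff_divide_distrib)
  qed
  ultimately have "(\<lambda>n. ln (f n) / real n) \<longlonglongrightarrow> ln s * 0 + 0" by (rule Lim_transform_eventually)
  then show "(\<lambda>n. ln (f n) / real n) \<longlonglongrightarrow> 0" by simp
qed

locale degree_limit =
  fixes N :: "nat \<Rightarrow> nat \<Rightarrow> nat" and p :: "nat \<Rightarrow> real"
  assumes type_seq: "\<And>n. type_sequence (N n)"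
    and size: "\<And>n. tsize (N n) = n"
    and a_lim: "\<And>i. 1 \<le> i \<Longrightarrow> (\<lambda>n. real (N n i) / real n) \<longlonglongrightarrow> p i"
    and a_sum: "(p has_sum 1) {1..}"
    and b_summable: "(\<lambda>i. real i * p i) summable_on {1..}"
    and b_lim: "(\<lambda>n. real (tell (N n)) / real n) \<longlonglongrightarrow> (\<Sum>\<^sub>\<infinity>i\<in>{1..}. real i * p i)"
    and p1: "p 1 > 0"
    and mean: "(\<Sum>\<^sub>\<infinity>i\<in>{1..}. real i * p i) > 2"
begin

lemma p_ge_0: "1 \<le> i \<Longrightarrow> 0 \<le> p i"
  by (rule tendsto_lowerbound[OF a_lim]) auto

sublocale degree_distribution p
  by unfold_locales (use p_ge_0 a_sum b_summable p1 mean in auto)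

definition "\<beta> = beta_of p"

lemma beta01: "0 < \<beta>" "\<beta> < 1"
  unfolding \<beta>_def by (rule beta_of_props)+

lemma size_biased_has_sum: "((\<lambda>k. real k * p k / (1 - \<beta> ^ k)) has_sum (\<mu> / (1 - \<beta>\<^sup>2))) {1..}"
  unfolding \<beta>_def by (rule beta_of_props)

lemma beta_power: "1 \<le> k \<Longrightarrow> 0 < \<beta> ^ k" "1 \<le> k \<Longrightarrow> \<beta> ^ k < 1" "1 \<le> k \<Longrightarrow> \<beta> ^ k \<le> \<beta>"
  using beta01 power_decreasing[of 1 k \<beta>] power_less_one_iff[of \<beta> k] by auto

lemma beta_sq: "\<beta>\<^sup>2 < 1"
  using beta01 power_less_one_iff[of \<beta> 2] by auto

lemma mu_gt_2: "2 < \<mu>"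
  using mean unfolding \<mu>_def .

definition "half_ell n = tell (N n) div 2"

lemma tell_half: "tell (N n) = 2 * half_ell n"
  using type_seq[of n] unfolding half_ell_def type_sequence_def by simp

lemma finite_supp: "finite (tsupp (N n))"
  using type_seq[of n] unfolding type_sequence_def by simp

lemma tell_lim: "(\<lambda>n. real (tell (N n)) / real n) \<longlonglongrightarrow> \<mu>"
  using b_lim unfolding \<mu>_def .

lemma half_ell_lim: "(\<lambda>n. real (half_ell n) / real n) \<longlonglongrightarrow> \<mu> / 2"
  using tendsto_divide[OF tell_lim tendsto_const, of 2] unfolding tell_half by simp

lemma card_configurations: "card (configurations (N n)) = odd_fact (half_ell n)"
  unfolding configurations_perfect_matchings
  by (intro card_perfect_matchings finite_darts finite_vertices) (simp add: card_darts_type finite_supp tell_half)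

definition "log_surv k = p k * ln (1 - \<beta> ^ k)"

lemma log_surv_summable: "log_surv summable_on {1..}"
proof (rule abs_summable_summable, rule summable_on_comparison_test)
  show "(\<lambda>k. (- ln (1 - \<beta>)) * p k) summable_on {1..}"
    by (intro summable_on_cmult_right has_sum_imp_summable[OF a_sum])
  fix k :: nat assume k: "k \<in> {1..}"
  have "ln (1 - \<beta>) \<le> ln (1 - \<beta> ^ k)" "ln (1 - \<beta> ^ k) \<le> 0"
    using beta_power[of k] beta01 k by (auto simp: ln_le_cancel_iff)
  then have "p k * \<bar>ln (1 - \<beta> ^ k)\<bar> \<le> p k * (- ln (1 - \<beta>))"
    using p_ge_0[of k] k by (intro mult_left_mono) auto
  then show "norm (log_surv k) \<le> (- ln (1 - \<beta>)) * p k"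
    using p_ge_0[of k] k by (simp add: log_surv_def abs_mult mult.commute)
qed simp

definition "surv_sum = (\<Sum>\<^sub>\<infinity>k\<in>{1..}. log_surv k)"

lemma K_of_eq: "K_of p = \<mu> / 2 * ln (1 - \<beta>\<^sup>2) - surv_sum"
  unfolding K_of_def surv_sum_def log_surv_def \<beta>_def[symmetric] \<mu>_def by simp

lemma log_surv_lim: "(\<lambda>K. \<Sum>k=1..K. log_surv k) \<longlonglongrightarrow> surv_sum"
  unfolding surv_sum_def by (intro has_sum_partial_sums has_sum_infsum log_surv_summable)

text \<open>Density of the added vertices of degree k: \<open>p k + \<rho> k\<close> equals p k / (1
  - \<beta>^k), so the original vertices are a share 1 - \<beta>^k of their degree class when
  \<open>p k\<close> is positive.\<close>

definition "\<rho> k = p k * \<beta> ^ k / (1 - \<beta> ^ k)"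

definition "\<Lambda> K = (\<Sum>k=1..K. real k * \<rho> k)"

lemma rho_ge_0: "1 \<le> k \<Longrightarrow> 0 \<le> \<rho> k"
  using beta_power[of k] p_ge_0[of k] unfolding \<rho>_def by simp

text \<open>The fixed point equation enters here: all half-edges together have density \<mu> / (1 -
  \<beta>^2), and the added ones are the share \<beta>^2 of them.\<close>

lemma Lambda_lim: "\<Lambda> \<longlonglongrightarrow> \<mu> * \<beta>\<^sup>2 / (1 - \<beta>\<^sup>2)"
proof -
  have "((\<lambda>k. real k * p k / (1 - \<beta> ^ k) - real k * p k) has_sum (\<mu> / (1 - \<beta>\<^sup>2) - \<mu>)) {1..}"
    by (intro has_sum_diff_real size_biased_has_sum mu_has_sum)
  then have "(\<lambda>K. \<Sum>k=1..K. real k * p k / (1 - \<beta> ^ k) - real k * p k) \<longlonglongrightarrow> \<mu> / (1 - \<beta>\<^sup>2) - \<mu>"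
    by (rule has_sum_partial_sums)
  moreover have "real k * p k / (1 - \<beta> ^ k) - real k * p k = real k * \<rho> k" if "k \<in> {1..K}" for k K
    using beta_power[of k] that unfolding \<rho>_def by (simp add: field_simps)
  then have "(\<lambda>K. \<Sum>k=1..K. real k * p k / (1 - \<beta> ^ k) - real k * p k) = \<Lambda>"
    unfolding \<Lambda>_def by (intro ext sum.cong) auto
  moreover have "\<mu> / (1 - \<beta>\<^sup>2) - \<mu> = \<mu> * \<beta>\<^sup>2 / (1 - \<beta>\<^sup>2)" using beta_sq by (simp add: field_simps)
  ultimately show ?thesis by simp
qed

lemma Lambda_ge_0: "0 \<le> \<Lambda> K"
  unfolding \<Lambda>_def using rho_ge_0 by (intro sum_nonneg) auto

text \<open>Rate of the bound in \<open>card_connected_le\<close> relative to the number of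
  configurations, by Stirling's formula: the first bracket stems from the double factorials, the sum
  from the binomial coefficients of the degree classes.\<close>

definition "upper_rate K = (xlnx (\<mu> + \<Lambda> K) - xlnx (\<Lambda> K) - xlnx \<mu>) / 2
  + (\<Sum>k=1..K. xlnx (p k) + xlnx (\<rho> k) - xlnx (p k + \<rho> k))"

text \<open>Each degree contributes \<open>log_surv k\<close> and a multiple of ln \<beta>. The
  latter add up to \<open>ln \<beta> * \<Lambda> K\<close> and cancel in the limit against the ln
  \<beta> term of the double factorials.\<close>

lemma upper_rate_lim: "upper_rate \<longlonglongrightarrow> - K_of p"
proof -
  have summand: "xlnx (p k) + xlnx (\<rho> k) - xlnx (p k + \<rho> k) = ln \<beta> * (real k * \<rho> k) + log_surv k" if k: "1 \<le> k" for k
  proof -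
    note b = beta_power[OF k]
    have 1: "xlnx (\<rho> k) = \<beta> ^ k / (1 - \<beta> ^ k) * xlnx (p k) + \<rho> k * (real k * ln \<beta> - ln (1 - \<beta> ^ k))"
    proof -
      have "ln (\<beta> ^ k / (1 - \<beta> ^ k)) = real k * ln \<beta> - ln (1 - \<beta> ^ k)"
        using b beta01 by (simp add: ln_div ln_realpow)
      then show ?thesis using xlnx_mult[OF p_ge_0[OF k], of "\<beta> ^ k / (1 - \<beta> ^ k)"] b by (simp add: \<rho>_def)
    qed
    have s: "p k + \<rho> k = p k * (1 / (1 - \<beta> ^ k))" using b by (simp add: \<rho>_def field_simps)
    have 2: "xlnx (p k + \<rho> k) = 1 / (1 - \<beta> ^ k) * xlnx (p k) - (p k + \<rho> k) * ln (1 - \<beta> ^ k)"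
      using xlnx_mult[OF p_ge_0[OF k], of "1 / (1 - \<beta> ^ k)"] b unfolding s[symmetric] by (simp add: ln_div)
    have 3: "1 / (1 - \<beta> ^ k) = 1 + \<beta> ^ k / (1 - \<beta> ^ k)" using b by (simp add: field_simps)
    show ?thesis unfolding 1 2 3 log_surv_def by (simp add: algebra_simps)
  qed
  define \<Lambda>' where "\<Lambda>' = \<mu> * \<beta>\<^sup>2 / (1 - \<beta>\<^sup>2)"
  have \<Lambda>'0: "0 \<le> \<Lambda>'" using beta_sq mu_gt_2 unfolding \<Lambda>'_def by simp
  have eq: "upper_rate = (\<lambda>K. (xlnx (\<mu> + \<Lambda> K) - xlnx (\<Lambda> K) - xlnx \<mu>) / 2 + (ln \<beta> * \<Lambda> K + (\<Sum>k=1..K. log_surv k)))"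
  proof
    fix K
    have "(\<Sum>k=1..K. xlnx (p k) + xlnx (\<rho> k) - xlnx (p k + \<rho> k)) = (\<Sum>k=1..K. ln \<beta> * (real k * \<rho> k) + log_surv k)"
      using summand by (intro sum.cong) auto
    then show "upper_rate K = (xlnx (\<mu> + \<Lambda> K) - xlnx (\<Lambda> K) - xlnx \<mu>) / 2 + (ln \<beta> * \<Lambda> K + (\<Sum>k=1..K. log_surv k))"
      unfolding upper_rate_def by (simp add: sum.distrib sum_distrib_left \<Lambda>_def)
  qed
  have "upper_rate \<longlonglongrightarrow> (xlnx (\<mu> + \<Lambda>') - xlnx \<Lambda>' - xlnx \<mu>) / 2 + (ln \<beta> * \<Lambda>' + surv_sum)"
    unfolding eq using Lambda_ge_0 mu_gt_2 \<Lambda>'0 log_surv_lim Lambda_lim[folded \<Lambda>'_def]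
    by (intro tendsto_intros tendsto_xlnx) (auto intro: add_nonneg_nonneg)
  also have "(xlnx (\<mu> + \<Lambda>') - xlnx \<Lambda>' - xlnx \<mu>) / 2 + (ln \<beta> * \<Lambda>' + surv_sum) = - K_of p"
  proof -
    have c: "0 < 1 - \<beta>\<^sup>2" "0 < \<beta>\<^sup>2" using beta_sq beta01 by auto
    have s: "\<mu> + \<Lambda>' = \<mu> * (1 / (1 - \<beta>\<^sup>2))" using c unfolding \<Lambda>'_def by (simp add: field_simps)
    have 1: "xlnx (\<mu> + \<Lambda>') = 1 / (1 - \<beta>\<^sup>2) * xlnx \<mu> - (\<mu> + \<Lambda>') * ln (1 - \<beta>\<^sup>2)"
      using xlnx_mult[of \<mu> "1 / (1 - \<beta>\<^sup>2)"] mu_gt_2 c unfolding s[symmetric] by (simp add: ln_div)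
    have "ln (\<beta>\<^sup>2 / (1 - \<beta>\<^sup>2)) = 2 * ln \<beta> - ln (1 - \<beta>\<^sup>2)" using c beta01 by (simp add: ln_div ln_realpow)
    then have 2: "xlnx \<Lambda>' = \<beta>\<^sup>2 / (1 - \<beta>\<^sup>2) * xlnx \<mu> + \<Lambda>' * (2 * ln \<beta> - ln (1 - \<beta>\<^sup>2))"
      using xlnx_mult[of \<mu> "\<beta>\<^sup>2 / (1 - \<beta>\<^sup>2)"] mu_gt_2 c by (simp add: \<Lambda>'_def)
    have 3: "1 / (1 - \<beta>\<^sup>2) = 1 + \<beta>\<^sup>2 / (1 - \<beta>\<^sup>2)" using c by (simp add: field_simps)
    show ?thesis unfolding 1 2 3 K_of_eq by (simp add: field_simps)
  qed
  finally show ?thesis .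
qed

lemma rate_configurations:
  "rate (\<lambda>n. real (card (configurations (N n)))) (\<lambda>n. real (half_ell n)) (xlnx \<mu> / 2 - \<mu> / 2)"
  unfolding card_configurations using rate_odd_fact[OF half_ell_lim] by simp

lemma connected_upper:
  assumes c: "- K_of p < c"
  shows "\<forall>\<^sub>F n in sequentially. real (card (connected_configurations (N n)))
    \<le> exp (c * real n) * real (card (configurations (N n)))"
proof -
  obtain k0 where k0: "upper_rate k0 < c"
    using order_tendstoD(2)[OF upper_rate_lim c] unfolding eventually_sequentially by blast
  \<comment> \<open>Half of the wanted number, doubled in \<open>r\<close>, so that the added
    degrees have an even sum for every n.\<close>
  define h where "h n k = nat \<lfloor>real n * (\<rho> k / 2)\<rfloor>" for n k
  define r where "r n k = (if k \<in> {1..k0} then 2 * h n k else 0)" for n k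
  define cc where "cc n = (\<Sum>k=1..k0. k * h n k)" for n
  have supp: "tsupp (r n) \<subseteq> {1..k0}" for n unfolding r_def tsupp_def by auto
  have tell_r: "tell (r n) = 2 * cc n" for n
    unfolding sum_tsupp_atMost(2)[OF supp] cc_def sum_distrib_left by (intro sum.cong) (auto simp: r_def)
  have h_lim: "(\<lambda>n. real (h n k) / real n) \<longlonglongrightarrow> \<rho> k / 2" if "k \<in> {1..k0}" for k
    unfolding h_def using rho_ge_0[of k] that by (intro tendsto_nat_floor) auto
  have r_lim: "(\<lambda>n. real (r n k) / real n) \<longlonglongrightarrow> \<rho> k" if "k \<in> {1..k0}" for k
    using tendsto_mult_left[OF h_lim[OF that], of 2] that unfolding r_def by simp
  have cc_lim: "(\<lambda>n. real (cc n) / real n) \<longlonglongrightarrow> \<Lambda> k0 / 2"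
  proof -
    have "(\<lambda>n. \<Sum>k=1..k0. real k * (real (h n k) / real n)) \<longlonglongrightarrow> (\<Sum>k=1..k0. real k * (\<rho> k / 2))"
      by (intro tendsto_sum tendsto_mult_left h_lim)
    then show ?thesis unfolding cc_def \<Lambda>_def by (simp add: sum_divide_distrib)
  qed
  have tsize_lim: "(\<lambda>n. real (n + tsize (r n)) / real n) \<longlonglongrightarrow> 1 + (\<Sum>k=1..k0. \<rho> k)"
  proof -
    have "(\<lambda>n. 1 + (\<Sum>k=1..k0. real (r n k) / real n)) \<longlonglongrightarrow> 1 + (\<Sum>k=1..k0. \<rho> k)"
      by (intro tendsto_add tendsto_const tendsto_sum r_lim)
    moreover have "\<forall>\<^sub>F n in sequentially. 1 + (\<Sum>k=1..k0. real (r n k) / real n) = real (n + tsize (r n)) / real n"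
      using eventually_gt_at_top[of 0]
      by eventually_elim (simp add: sum_tsupp_atMost(1)[OF supp] sum_divide_distrib add_divide_distrib)
    ultimately show ?thesis by (rule Lim_transform_eventually)
  qed
  have ac_lim: "(\<lambda>n. real (half_ell n + cc n) / real n) \<longlonglongrightarrow> (\<mu> + \<Lambda> k0) / 2"
    using tendsto_add[OF half_ell_lim cc_lim] by (simp add: add_divide_distrib)
  have Nr_lim: "(\<lambda>n. real (N n k + r n k) / real n) \<longlonglongrightarrow> p k + \<rho> k" if "k \<in> {1..k0}" for k
    using tendsto_add[OF a_lim r_lim[OF that]] that by (simp add: add_divide_distrib)
  define f1 where "f1 n = real (n + tsize (r n)) * real (odd_fact (half_ell n + cc n)) *
    (\<Prod>k=1..k0. fact (N n k) * fact (r n k))" for n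
  define f2 where "f2 n = real (odd_fact (cc n)) * (\<Prod>k=1..k0. fact (N n k + r n k))" for n
  define L1 where "L1 = 0 + (xlnx (2 * ((\<mu> + \<Lambda> k0) / 2)) / 2 - (\<mu> + \<Lambda> k0) / 2)
     + (\<Sum>k=1..k0. (xlnx (p k) - p k) + (xlnx (\<rho> k) - \<rho> k))"
  define L2 where "L2 = (xlnx (2 * (\<Lambda> k0 / 2)) / 2 - \<Lambda> k0 / 2) + (\<Sum>k=1..k0. xlnx (p k + \<rho> k) - (p k + \<rho> k))"
  have rf1: "rate f1 (\<lambda>n. 0 + real (half_ell n + cc n) + (\<Sum>k=1..k0. real (N n k) + real (r n k))) L1"
    unfolding f1_def L1_def
  proof (intro rate_mult rate_prod rate_odd_fact rate_fact)
    show "rate (\<lambda>n. real (n + tsize (r n))) (\<lambda>n. 0) 0"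
      by (rule rate_linear[OF tsize_lim]) (use rho_ge_0 in \<open>auto intro!: add_pos_nonneg sum_nonneg\<close>)
  qed (use ac_lim a_lim r_lim in auto)
  have rf2: "rate f2 (\<lambda>n. real (cc n) + (\<Sum>k=1..k0. real (N n k + r n k))) L2"
    unfolding f2_def L2_def by (intro rate_mult rate_prod rate_odd_fact rate_fact cc_lim Nr_lim) auto
  have "L1 - L2 - (xlnx \<mu> / 2 - \<mu> / 2) = upper_rate k0"
  proof -
    have "2 * ((\<mu> + \<Lambda> k0) / 2) = \<mu> + \<Lambda> k0" "2 * (\<Lambda> k0 / 2) = \<Lambda> k0" by simp_all
    then show ?thesis unfolding L1_def L2_def upper_rate_def
      by (simp only: sum.distrib sum_subtractf) (simp add: diff_divide_distrib add_divide_distrib)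
  qed
  then have lt: "L1 - L2 - (xlnx \<mu> / 2 - \<mu> / 2) < c" using k0 by simp
  show ?thesis
  proof (rule rate_upper[OF rate_divide[OF rf1 rf2] rate_configurations _ lt])
    show "\<forall>\<^sub>F n in sequentially. \<bar>0 + real (half_ell n + cc n) + (\<Sum>k=1..k0. real (N n k) + real (r n k))
       - (real (cc n) + (\<Sum>k=1..k0. real (N n k + r n k))) - real (half_ell n)\<bar> \<le> 0"
      by simp
    show "\<forall>\<^sub>F n in sequentially. real (card (connected_configurations (N n))) \<le> f1 n / f2 n"
      using eventually_gt_at_top[of 0]
    proof eventually_elim
      case (elim n)
      have "card (connected_configurations (N n)) * odd_fact (cc n) * (\<Prod>k=1..k0. fact (N n k + r n k))
        \<le> (tsize (N n) + tsize (r n)) * odd_fact (half_ell n + cc n) * (\<Prod>k=1..k0. fact (N n k) * fact (r n k))"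
        by (rule card_connected_le[OF finite_supp _ _ tell_half tell_r]) (use elim size in \<open>auto simp: r_def\<close>)
      then have "real (card (connected_configurations (N n)) * odd_fact (cc n) * (\<Prod>k=1..k0. fact (N n k + r n k)))
        \<le> real ((tsize (N n) + tsize (r n)) * odd_fact (half_ell n + cc n) * (\<Prod>k=1..k0. fact (N n k) * fact (r n k)))"
        by (rule of_nat_mono)
      then have "real (card (connected_configurations (N n))) * f2 n \<le> f1 n"
        unfolding f1_def f2_def size by (simp add: mult.assoc)
      moreover have "0 < odd_fact m" for m by (induction m) auto
      then have "0 < f2 n" unfolding f2_def by (intro mult_pos_pos prod_pos) auto
      ultimately show ?case by (simp add: le_divide_eq)
    qed
  qed
qed

end

subsection \<open>The lower bound\<close>

lemma sum_Pow_card: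
  fixes F :: "nat \<Rightarrow> real"
  shows "(\<Sum>s\<in>Pow {1..k}. F (card s)) = (\<Sum>j\<le>k. real (k choose j) * F j)"
proof -
  have "card s \<le> k" if "s \<subseteq> {1..k}" for s using card_mono[OF _ that] by simp
  then have "(\<Sum>s\<in>Pow {1..k}. F (card s)) = (\<Sum>j\<le>k. \<Sum>s\<in>{s \<in> Pow {1..k}. card s = j}. F (card s))"
    by (intro sum.group[symmetric]) auto
  also have "\<dots> = (\<Sum>j\<le>k. real (k choose j) * F j)"
  proof (rule sum.cong[OF refl])
    fix j
    have "card {s \<in> Pow {1..k}. card s = j} = k choose j" using n_subsets[of "{1..k}" j] by simp
    then show "(\<Sum>s\<in>{s \<in> Pow {1..k}. card s = j}. F (card s)) = real (k choose j) * F j" by simp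
  qed
  finally show ?thesis .
qed

lemma sum_Pow_weights:
  fixes u v :: real
  shows "(\<Sum>s\<in>Pow {1..k}. u ^ card s * v ^ (k - card s)) = (u + v) ^ k"
    and "(\<Sum>s\<in>Pow {1..k}. real (card s) * (u ^ card s * v ^ (k - card s))) = real k * u * (u + v) ^ (k - 1)"
    and "1 \<le> k \<Longrightarrow> (\<Sum>s\<in>Pow {1..k}. of_bool (card s = 1) * (u ^ card s * v ^ (k - card s))) = real k * u * v ^ (k - 1)"
proof -
  show "(\<Sum>s\<in>Pow {1..k}. u ^ card s * v ^ (k - card s)) = (u + v) ^ k"
    using sum_Pow_card[of "\<lambda>j. u ^ j * v ^ (k - j)" k] by (simp add: binomial_ring mult.assoc)
  have "(\<Sum>s\<in>Pow {1..k}. real (card s) * (u ^ card s * v ^ (k - card s)))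
    = (\<Sum>j\<le>k. real (k choose j) * (real j * (u ^ j * v ^ (k - j))))"
    by (rule sum_Pow_card[of "\<lambda>j. real j * (u ^ j * v ^ (k - j))"])
  also have "\<dots> = u * (\<Sum>j\<le>k. (real j * real (k choose j)) * u ^ (j - 1) * v ^ (k - j))"
    unfolding sum_distrib_left
  proof (rule sum.cong[OF refl])
    fix j show "real (k choose j) * (real j * (u ^ j * v ^ (k - j))) = u * ((real j * real (k choose j)) * u ^ (j - 1) * v ^ (k - j))"
      by (cases j) simp_all
  qed
  finally show "(\<Sum>s\<in>Pow {1..k}. real (card s) * (u ^ card s * v ^ (k - card s))) = real k * u * (u + v) ^ (k - 1)"
    using binomial_deriv1[of k u v] by simp
  assume k: "1 \<le> k"
  have "(\<Sum>s\<in>Pow {1..k}. of_bool (card s = 1) * (u ^ card s * v ^ (k - card s)))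
    = (\<Sum>j\<le>k. real (k choose j) * (of_bool (j = 1) * (u ^ j * v ^ (k - j))))"
    by (rule sum_Pow_card[of "\<lambda>j. of_bool (j = 1) * (u ^ j * v ^ (k - j))"])
  also have "\<dots> = (\<Sum>j\<in>{1}. real (k choose j) * (of_bool (j = 1) * (u ^ j * v ^ (k - j))))"
    by (rule sum.mono_neutral_right) (use k in auto)
  finally show "(\<Sum>s\<in>Pow {1..k}. of_bool (card s = 1) * (u ^ card s * v ^ (k - card s))) = real k * u * v ^ (k - 1)"
    by simp
qed

abbreviation "tip_weight b \<equiv> of_bool (card (snd b) = 1)"
abbreviation "slot_weight b \<equiv> fst b - card (snd b)"

section \<open>Label frequencies and their entropy\<close>

context degree_limit
begin

definition lab_freq :: "nat \<times> nat set \<Rightarrow> real" where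
  "lab_freq b = p (fst b) * ((1 - \<beta>) ^ card (snd b) * \<beta> ^ (fst b - card (snd b))) / (1 - \<beta> ^ fst b)"

text \<open>Density of all labelled half-edges at vertices of degree k, tips included:
  \<open>p k\<close> times the mean of a binomial variable conditioned to be positive.\<close>

definition "core_deg k = real k * p k * (1 - \<beta>) / (1 - \<beta> ^ k)"

definition "tip_freq k = real k * p k * (1 - \<beta>) * \<beta> ^ (k - 1) / (1 - \<beta> ^ k)"

lemma lab_freq_ge_0: "1 \<le> fst b \<Longrightarrow> 0 \<le> lab_freq b"
  using p_ge_0[of "fst b"] beta_power[of "fst b"] beta01 unfolding lab_freq_def by simp

lemma lab_freq_pos: "1 \<le> fst b \<Longrightarrow> 0 < p (fst b) \<Longrightarrow> 0 < lab_freq b"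
  using beta_power[of "fst b"] beta01 unfolding lab_freq_def by simp

lemma sum_lab_freq:
  assumes k: "1 \<le> k"
  shows "(\<Sum>s\<in>Pow {1..k} - {{}}. lab_freq (k, s)) = p k"
    and "(\<Sum>s\<in>Pow {1..k} - {{}}. lab_freq (k, s) * real (card s)) = core_deg k"
    and "(\<Sum>s\<in>Pow {1..k} - {{}}. lab_freq (k, s) * of_bool (card s = 1)) = tip_freq k"
    and "(\<Sum>s\<in>Pow {1..k} - {{}}. lab_freq (k, s) * real (k - card s)) = real k * p k - core_deg k"
proof -
  note b = beta_power[OF k]
  define c where "c = p k / (1 - \<beta> ^ k)"
  define w where "w s = (1 - \<beta>) ^ card s * \<beta> ^ (k - card s)" for s :: "nat set"
  have lf: "lab_freq (k, s) = c * w s" for s unfolding lab_freq_def c_def w_def by simp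
  have rem: "(\<Sum>s\<in>Pow {1..k} - {{}}. G s) = (\<Sum>s\<in>Pow {1..k}. G s) - G {}" for G :: "nat set \<Rightarrow> real"
    by (subst sum_diff1) auto
  have w0: "w {} = \<beta> ^ k" unfolding w_def by simp
  show 1: "(\<Sum>s\<in>Pow {1..k} - {{}}. lab_freq (k, s)) = p k"
    unfolding rem lf sum_distrib_left[symmetric] w0 using sum_Pow_weights(1)[of "1 - \<beta>" \<beta> k] b
    unfolding w_def[symmetric] c_def by (simp add: field_simps)
  show 2: "(\<Sum>s\<in>Pow {1..k} - {{}}. lab_freq (k, s) * real (card s)) = core_deg k"
  proof -
    have "(\<Sum>s\<in>Pow {1..k} - {{}}. lab_freq (k, s) * real (card s)) = (\<Sum>s\<in>Pow {1..k}. c * (real (card s) * w s))"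
      unfolding rem lf by (simp add: mult_ac)
    also have "\<dots> = c * (real k * (1 - \<beta>))"
      unfolding sum_distrib_left[symmetric] using sum_Pow_weights(2)[where u = "1 - \<beta>" and v = \<beta> and k = k]
      unfolding w_def[symmetric] by simp
    finally show ?thesis unfolding core_deg_def c_def by simp
  qed
  show "(\<Sum>s\<in>Pow {1..k} - {{}}. lab_freq (k, s) * of_bool (card s = 1)) = tip_freq k"
  proof -
    have "(\<Sum>s\<in>Pow {1..k} - {{}}. lab_freq (k, s) * of_bool (card s = 1)) = (\<Sum>s\<in>Pow {1..k}. c * (of_bool (card s = 1) * w s))"
      unfolding rem lf by (simp add: mult_ac)
    also have "\<dots> = c * (real k * (1 - \<beta>) * \<beta> ^ (k - 1))"
      unfolding sum_distrib_left[symmetric] using sum_Pow_weights(3)[OF k, of "1 - \<beta>" \<beta>]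
      unfolding w_def[symmetric] by simp
    finally show ?thesis unfolding tip_freq_def c_def by simp
  qed
  have "(\<Sum>s\<in>Pow {1..k} - {{}}. lab_freq (k, s) * real (k - card s))
    = (\<Sum>s\<in>Pow {1..k} - {{}}. real k * lab_freq (k, s) - lab_freq (k, s) * real (card s))"
  proof (rule sum.cong[OF refl])
    fix s assume "s \<in> Pow {1..k} - {{}}"
    then have "card s \<le> k" using card_mono[of "{1..k}" s] by auto
    then show "lab_freq (k, s) * real (k - card s) = real k * lab_freq (k, s) - lab_freq (k, s) * real (card s)"
      by (simp add: of_nat_diff algebra_simps)
  qed
  then show "(\<Sum>s\<in>Pow {1..k} - {{}}. lab_freq (k, s) * real (k - card s)) = real k * p k - core_deg k"
    unfolding sum_subtractf sum_distrib_left[symmetric] 1 2 .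
qed

text \<open>For positive \<open>p k\<close> the logarithm of \<open>lab_freq (k, s)\<close> is
  affine in the size of \<open>s\<close>, so the entropy reduces to the total and the first moments
  computed above.\<close>

lemma sum_xlnx_lab_freq:
  assumes k: "1 \<le> k"
  shows "(\<Sum>s\<in>Pow {1..k} - {{}}. xlnx (lab_freq (k, s)))
    = xlnx (p k) - log_surv k + core_deg k * ln (1 - \<beta>) + (real k * p k - core_deg k) * ln \<beta>"
proof -
  note b = beta_power[OF k]
  have lx: "xlnx (lab_freq (k, s)) = lab_freq (k, s) * (ln (p k) - ln (1 - \<beta> ^ k))
      + lab_freq (k, s) * real (card s) * ln (1 - \<beta>) + lab_freq (k, s) * real (k - card s) * ln \<beta>" for s
  proof (cases "p k = 0")
    case False
    then have "ln (lab_freq (k, s)) = ln (p k) - ln (1 - \<beta> ^ k) + real (card s) * ln (1 - \<beta>) + real (k - card s) * ln \<beta>"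
      using b beta01 unfolding lab_freq_def by (simp add: ln_div ln_mult ln_realpow)
    then have "xlnx (lab_freq (k, s)) = lab_freq (k, s) *
        (ln (p k) - ln (1 - \<beta> ^ k) + real (card s) * ln (1 - \<beta>) + real (k - card s) * ln \<beta>)"
      unfolding xlnx_def by simp
    then show ?thesis by (simp only: distrib_left mult.assoc)
  qed (simp add: lab_freq_def)
  have "(\<Sum>s\<in>Pow {1..k} - {{}}. xlnx (lab_freq (k, s)))
    = p k * (ln (p k) - ln (1 - \<beta> ^ k)) + core_deg k * ln (1 - \<beta>) + (real k * p k - core_deg k) * ln \<beta>"
    by (simp only: lx sum.distrib sum_distrib_right[symmetric] sum_lab_freq[OF k])
  then show ?thesis unfolding log_surv_def xlnx_def by (simp add: algebra_simps)
qed

lemma sum_label_types: "(\<Sum>b\<in>label_types k0. G b) = (\<Sum>k=1..k0. \<Sum>s\<in>Pow {1..k} - {{}}. G (k, s))"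
  for G :: "nat \<times> nat set \<Rightarrow> real"
  unfolding label_types_def by (subst sum.Sigma) (auto simp: case_prod_unfold)

definition "tips k0 = (\<Sum>b\<in>label_types k0. lab_freq b * tip_weight b)"
text \<open>Surplus of tips over slots among the degrees up to \<open>k0\<close>; it tends to 0 but
  need not vanish for a given \<open>k0\<close>.\<close>

definition "excess k0 = tips k0 - (\<Sum>b\<in>label_types k0. lab_freq b * real (slot_weight b))"

lemma tips_eq: "tips k0 = (\<Sum>k=1..k0. tip_freq k)"
  unfolding tips_def sum_label_types using sum_lab_freq(3) by (intro sum.cong) auto

lemma excess_eq: "excess k0 = tips k0 - (\<Sum>k=1..k0. real k * p k - core_deg k)"
  unfolding excess_def sum_label_types using sum_lab_freq(4) by simp

lemma core_deg_lim: "(\<lambda>k0. \<Sum>k=1..k0. core_deg k) \<longlonglongrightarrow> \<mu> / (1 + \<beta>)"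
proof -
  have "((\<lambda>k. (1 - \<beta>) * (real k * p k / (1 - \<beta> ^ k))) has_sum ((1 - \<beta>) * (\<mu> / (1 - \<beta>\<^sup>2)))) {1..}"
    by (intro has_sum_cmult_right size_biased_has_sum)
  then have "(\<lambda>k0. \<Sum>k=1..k0. (1 - \<beta>) * (real k * p k / (1 - \<beta> ^ k))) \<longlonglongrightarrow> (1 - \<beta>) * (\<mu> / (1 - \<beta>\<^sup>2))"
    by (rule has_sum_partial_sums)
  moreover have "(1 - \<beta>) * (\<mu> / (1 - \<beta>\<^sup>2)) = \<mu> / (1 + \<beta>)"
  proof -
    have "1 - \<beta>\<^sup>2 = (1 - \<beta>) * (1 + \<beta>)" by (simp add: power2_eq_square algebra_simps)
    then show ?thesis using beta01 by simp
  qed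
  moreover have "(\<lambda>k0. \<Sum>k=1..k0. (1 - \<beta>) * (real k * p k / (1 - \<beta> ^ k))) = (\<lambda>k0. \<Sum>k=1..k0. core_deg k)"
    unfolding core_deg_def by (simp add: mult_ac)
  ultimately show ?thesis by simp
qed

lemma mean_lim: "(\<lambda>k0. \<Sum>k=1..k0. real k * p k) \<longlonglongrightarrow> \<mu>"
  by (intro has_sum_partial_sums mu_has_sum)

text \<open>Up to the factor (1 - \<beta>) / \<beta>, tips are counted like the added half-edges of
  the upper bound, whose limit is known from the fixed point equation.\<close>

lemma tips_lim: "tips \<longlonglongrightarrow> \<mu> * \<beta> / (1 + \<beta>)"
proof -
  have "tips = (\<lambda>k0. (1 - \<beta>) / \<beta> * \<Lambda> k0)"
  proof
    fix k0
    have "tip_freq k = (1 - \<beta>) / \<beta> * (real k * \<rho> k)" if "k \<in> {1..k0}" for k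
    proof -
      have "\<beta> ^ k = \<beta> * \<beta> ^ (k - 1)" using that by (cases k) auto
      then show ?thesis using beta01 unfolding tip_freq_def \<rho>_def by simp
    qed
    then show "tips k0 = (1 - \<beta>) / \<beta> * \<Lambda> k0"
      unfolding tips_eq \<Lambda>_def sum_distrib_left by (intro sum.cong) auto
  qed
  moreover have "(\<lambda>k0. (1 - \<beta>) / \<beta> * \<Lambda> k0) \<longlonglongrightarrow> (1 - \<beta>) / \<beta> * (\<mu> * \<beta>\<^sup>2 / (1 - \<beta>\<^sup>2))"
    by (intro tendsto_mult tendsto_const Lambda_lim)
  moreover have "(1 - \<beta>) / \<beta> * (\<mu> * \<beta>\<^sup>2 / (1 - \<beta>\<^sup>2)) = \<mu> * \<beta> / (1 + \<beta>)"
  proof -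
    have "1 - \<beta>\<^sup>2 = (1 - \<beta>) * (1 + \<beta>)" by (simp add: power2_eq_square algebra_simps)
    then show ?thesis using beta01 by (simp add: power2_eq_square)
  qed
  ultimately show ?thesis by simp
qed

text \<open>Labelled half-edges have density \<mu> / (1 + \<beta>), which leaves \<mu> \<beta> / (1
  + \<beta>) for the slots, the same as for the tips.\<close>

lemma excess_lim: "excess \<longlonglongrightarrow> 0"
proof -
  have "(\<lambda>k0. tips k0 - ((\<Sum>k=1..k0. real k * p k) - (\<Sum>k=1..k0. core_deg k))) \<longlonglongrightarrow> \<mu> * \<beta> / (1 + \<beta>) - (\<mu> - \<mu> / (1 + \<beta>))"
    by (intro tendsto_diff tips_lim mean_lim core_deg_lim)
  moreover have "\<mu> * \<beta> / (1 + \<beta>) - (\<mu> - \<mu> / (1 + \<beta>)) = 0" using beta01 by (simp add: field_simps)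
  ultimately show ?thesis unfolding excess_eq[abs_def] sum_subtractf by simp
qed

text \<open>A vertex of degree 1 is always a tree vertex. The positive lower bound keeps the number
  of tips linear in n.\<close>

lemma tips_ge_p1:
  assumes "1 \<le> k0"
  shows "p 1 \<le> tips k0"
proof -
  have "tip_freq 1 \<le> (\<Sum>k=1..k0. tip_freq k)"
  proof (rule member_le_sum)
    fix k assume "k \<in> {1..k0} - {1}"
    then show "0 \<le> tip_freq k" using beta_power[of k] p_ge_0[of k] beta01 unfolding tip_freq_def by simp
  qed (use assms in auto)
  then show ?thesis unfolding tips_eq using beta01 by (simp add: tip_freq_def)
qed

text \<open>Rate of the number of label assignments, times the factorial of the number of tips,
  times the number of connected core matchings, relative to all configurations; the core has density
  \<open>\<mu> - 2 * tips k0\<close> of half-edges.\<close>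

definition "base_rate k0 = (\<Sum>k=1..k0. xlnx (p k)) - (\<Sum>b\<in>label_types k0. xlnx (lab_freq b))
  + xlnx (tips k0) + xlnx (\<mu> - 2 * tips k0) / 2 - xlnx \<mu> / 2"

lemma core_share_pos: "0 < \<mu> - 2 * (\<mu> * \<beta> / (1 + \<beta>))"
proof -
  have "\<mu> - 2 * (\<mu> * \<beta> / (1 + \<beta>)) = \<mu> * (1 - \<beta>) / (1 + \<beta>)" using beta01 by (simp add: field_simps)
  then show ?thesis using beta01 mu_gt_2 by simp
qed

lemma base_rate_lim: "base_rate \<longlonglongrightarrow> - K_of p"
proof -
  have eq: "base_rate k0 = (\<Sum>k=1..k0. log_surv k) - (\<Sum>k=1..k0. core_deg k) * ln (1 - \<beta>)
      - ((\<Sum>k=1..k0. real k * p k) - (\<Sum>k=1..k0. core_deg k)) * ln \<beta>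
      + xlnx (tips k0) + xlnx (\<mu> - 2 * tips k0) / 2 - xlnx \<mu> / 2" for k0
  proof -
    have "(\<Sum>b\<in>label_types k0. xlnx (lab_freq b)) = (\<Sum>k=1..k0. xlnx (p k) - log_surv k + core_deg k * ln (1 - \<beta>)
        + (real k * p k - core_deg k) * ln \<beta>)"
      unfolding sum_label_types using sum_xlnx_lab_freq by (intro sum.cong) auto
    then show ?thesis unfolding base_rate_def
      by (simp add: sum.distrib sum_subtractf sum_distrib_right left_diff_distrib)
  qed
  define t where "t = \<mu> * \<beta> / (1 + \<beta>)"
  have t0: "0 \<le> t" using mu_gt_2 beta01 unfolding t_def by simp
  have u0: "0 < \<mu> - 2 * t" using core_share_pos unfolding t_def .
  have lim_t: "tips \<longlonglongrightarrow> t" unfolding t_def by (rule tips_lim)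
  have lim_u: "(\<lambda>k0. \<mu> - 2 * tips k0) \<longlonglongrightarrow> \<mu> - 2 * t" by (intro tendsto_intros lim_t)
  have ev: "\<forall>\<^sub>F k0 in sequentially. 0 \<le> \<mu> - 2 * tips k0"
    using order_tendstoD(1)[OF lim_u u0] by (rule eventually_mono) simp
  have ev2: "\<forall>\<^sub>F k0 in sequentially. 0 \<le> tips k0"
    using eventually_ge_at_top[of 1] by (rule eventually_mono) (use tips_ge_p1 p1 in force)
  have "base_rate \<longlonglongrightarrow> surv_sum - \<mu> / (1 + \<beta>) * ln (1 - \<beta>) - (\<mu> - \<mu> / (1 + \<beta>)) * ln \<beta>
      + xlnx t + xlnx (\<mu> - 2 * t) / 2 - xlnx \<mu> / 2"
    unfolding eq[abs_def] using u0
    by (intro tendsto_intros tendsto_xlnx log_surv_lim core_deg_lim mean_lim lim_t lim_u t0 ev ev2) auto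
  also have "surv_sum - \<mu> / (1 + \<beta>) * ln (1 - \<beta>) - (\<mu> - \<mu> / (1 + \<beta>)) * ln \<beta>
      + xlnx t + xlnx (\<mu> - 2 * t) / 2 - xlnx \<mu> / 2 = - K_of p"
  proof -
    have a: "xlnx t = \<beta> / (1 + \<beta>) * xlnx \<mu> + \<mu> * (\<beta> / (1 + \<beta>)) * (ln \<beta> - ln (1 + \<beta>))"
      using xlnx_mult[of \<mu> "\<beta> / (1 + \<beta>)"] mu_gt_2 beta01 unfolding t_def by (simp add: ln_div)
    have "\<mu> - 2 * t = \<mu> * ((1 - \<beta>) / (1 + \<beta>))" using beta01 unfolding t_def by (simp add: field_simps)
    then have b: "xlnx (\<mu> - 2 * t) = (1 - \<beta>) / (1 + \<beta>) * xlnx \<mu> + \<mu> * ((1 - \<beta>) / (1 + \<beta>)) * (ln (1 - \<beta>) - ln (1 + \<beta>))"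
      using xlnx_mult[of \<mu> "(1 - \<beta>) / (1 + \<beta>)"] mu_gt_2 beta01 by (simp add: ln_div)
    have "1 - \<beta>\<^sup>2 = (1 - \<beta>) * (1 + \<beta>)" by (simp add: power2_eq_square algebra_simps)
    then have c: "ln (1 - \<beta>\<^sup>2) = ln (1 - \<beta>) + ln (1 + \<beta>)" using beta01 by (simp add: ln_mult)
    \<comment> \<open>In terms of 1 / (1 + \<beta>) all coefficients are affine, and the identity
      becomes one between polynomials.\<close>
    define i where "i = 1 / (1 + \<beta>)"
    have i: "\<beta> / (1 + \<beta>) = 1 - i" "(1 - \<beta>) / (1 + \<beta>) = 2 * i - 1" "\<mu> / (1 + \<beta>) = \<mu> * i"
      using beta01 unfolding i_def by (simp_all add: field_simps)
    show ?thesis unfolding a b c K_of_eq i by (simp add: field_simps)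
  qed
  finally show ?thesis .
qed

end

section \<open>Rounding the frequencies to an exact profile\<close>

lemma label_typesD:
  assumes "b \<in> label_types k0"
  shows "1 \<le> fst b" "fst b \<le> k0" "snd b \<subseteq> {1..fst b}" "card (snd b) \<le> fst b"
proof -
  show 1: "1 \<le> fst b" "fst b \<le> k0" "snd b \<subseteq> {1..fst b}"
    using assms unfolding label_types_def by auto
  show "card (snd b) \<le> fst b" using card_mono[OF _ 1(3)] by simp
qed

text \<open>The types with a slot. The remaining, full types will absorb the rounding errors: each
  degree has exactly one of them, and it has no slot.\<close>

definition proper_types :: "nat \<Rightarrow> (nat \<times> nat set) set" where
  "proper_types k0 = {b \<in> label_types k0. snd b \<noteq> {1..fst b}}"

lemma full_in_label_types: "k \<in> {1..k0} \<Longrightarrow> (k, {1..k}) \<in> label_types k0"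
  by (auto simp: label_types_def)

lemma finite_proper_types: "finite (proper_types k0)"
  unfolding proper_types_def using finite_label_types by simp

lemma sum_label_types_full:
  fixes G :: "nat \<times> nat set \<Rightarrow> 'a::comm_monoid_add"
  shows "(\<Sum>b\<in>label_types k0. G b) = (\<Sum>b\<in>proper_types k0. G b) + (\<Sum>k=1..k0. G (k, {1..k}))"
proof -
  have 1: "label_types k0 = proper_types k0 \<union> (\<lambda>k. (k, {1..k})) ` {1..k0}"
    unfolding proper_types_def label_types_def by auto
  have "(\<Sum>b\<in>label_types k0. G b) = (\<Sum>b\<in>proper_types k0. G b) + (\<Sum>b\<in>(\<lambda>k. (k, {1..k})) ` {1..k0}. G b)"
    unfolding 1
  proof (rule sum.union_disjoint)
    show "proper_types k0 \<inter> (\<lambda>k. (k, {1..k})) ` {1..k0} = {}" by (auto simp: proper_types_def)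
  qed (simp_all add: finite_proper_types)
  also have "(\<Sum>b\<in>(\<lambda>k. (k, {1..k})) ` {1..k0}. G b) = (\<Sum>k=1..k0. G (k, {1..k}))"
    by (subst sum.reindex) (auto simp: inj_on_def)
  finally show ?thesis .
qed

lemma sum_fibre_full:
  fixes G :: "nat \<times> nat set \<Rightarrow> 'a::comm_monoid_add"
  assumes "j \<in> {1..k0}"
  shows "(\<Sum>b\<in>{b \<in> label_types k0. fst b = j}. G b) = (\<Sum>b\<in>{b \<in> proper_types k0. fst b = j}. G b) + G (j, {1..j})"
proof -
  have "{b \<in> label_types k0. fst b = j} = insert (j, {1..j}) {b \<in> proper_types k0. fst b = j}"
  proof (intro set_eqI iffI)
    fix b assume "b \<in> {b \<in> label_types k0. fst b = j}"
    then show "b \<in> insert (j, {1..j}) {b \<in> proper_types k0. fst b = j}"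
      unfolding proper_types_def by (cases b) simp
  next
    fix b assume "b \<in> insert (j, {1..j}) {b \<in> proper_types k0. fst b = j}"
    then show "b \<in> {b \<in> label_types k0. fst b = j}"
      using full_in_label_types[OF assms] unfolding proper_types_def by auto
  qed
  moreover have "(j, {1..j}) \<notin> {b \<in> proper_types k0. fst b = j}" unfolding proper_types_def by auto
  ultimately show ?thesis using finite_proper_types[of k0] by (simp add: add.commute)
qed

lemma fibre_label_types: "j \<in> {1..k0} \<Longrightarrow> {b \<in> label_types k0. fst b = j} = Pair j ` (Pow {1..j} - {{}})"
  by (auto simp: label_types_def)

lemma eventually_pos_of_lim:
  fixes f :: "nat \<Rightarrow> real"
  assumes "(\<lambda>n. f n / real n) \<longlonglongrightarrow> x" "0 < x"
  shows "\<forall>\<^sub>F n in sequentially. 0 < f n"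
  using order_tendstoD(1)[OF assms] eventually_gt_at_top[of 0]
  by eventually_elim (simp add: zero_less_divide_iff)

lemma tendsto_nat_diff:
  fixes a b :: "nat \<Rightarrow> nat"
  assumes "(\<lambda>n. real (a n) / real n) \<longlonglongrightarrow> x" "(\<lambda>n. real (b n) / real n) \<longlonglongrightarrow> y"
    and "\<forall>\<^sub>F n in sequentially. b n \<le> a n"
  shows "(\<lambda>n. real (a n - b n) / real n) \<longlonglongrightarrow> x - y"
proof -
  have "(\<lambda>n. real (a n) / real n - real (b n) / real n) \<longlonglongrightarrow> x - y" by (intro tendsto_diff assms)
  moreover have "\<forall>\<^sub>F n in sequentially. real (a n) / real n - real (b n) / real n = real (a n - b n) / real n"
    using assms(3) by eventually_elim (simp add: of_nat_diff diff_divide_distrib)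
  ultimately show ?thesis by (rule Lim_transform_eventually)
qed

lemma eventually_le_of_lim:
  fixes a b :: "nat \<Rightarrow> nat"
  assumes "(\<lambda>n. real (a n) / real n) \<longlonglongrightarrow> x" "(\<lambda>n. real (b n) / real n) \<longlonglongrightarrow> y" "y < x"
  shows "\<forall>\<^sub>F n in sequentially. b n < a n"
proof -
  have "(\<lambda>n. (real (a n) - real (b n)) / real n) \<longlonglongrightarrow> x - y"
    unfolding diff_divide_distrib by (intro tendsto_diff assms)
  from eventually_pos_of_lim[OF this] assms(3) show ?thesis by (auto elim!: eventually_mono)
qed

text \<open>
  Labels are chosen with frequencies \<open>lab_freq\<close> at the vertices of degree at most \<open>k0\<close>, while all
  half-edges at the other vertices are labelled. This leaves an imbalance of about \<open>n * excess k0\<close>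
  between tips and slots. It is removed exactly by trading the label type \<open>bf\<close>, with no slot,
  against \<open>bs\<close>, with one slot; neither of them has a tip.
\<close>

context degree_limit
begin

lemma linked_lower:
  assumes c: "c < - K_of p"
    and X: "\<And>c0. 0 < c0 \<Longrightarrow> \<forall>\<^sub>F n in sequentially. \<forall>k L. c0 * real n \<le> real k \<longrightarrow>
      labelling (vertices (N n)) (tdegree (N n)) L \<longrightarrow> card (core_he (vertices (N n)) L) = 2 * Suc k \<longrightarrow>
      2 ^ (k - 1) * fact k \<le> card {C \<in> perfect_matchings (core_he (vertices (N n)) L).
        linked fst (core_vs (vertices (N n)) L) C \<and> defect fst C \<le> D n}"
  shows "\<forall>\<^sub>F n in sequentially. exp (c * real n) * real (card (configurations (N n)))
    \<le> real (card {M \<in> perfect_matchings (darts (vertices (N n)) (tdegree (N n))). linked fst (vertices (N n)) M \<and> defect fst M \<le> D n})"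
proof -
  obtain ks where ks: "3 \<le> ks" "0 < p ks" using ex_p_pos by blast
  \<comment> \<open>Degree at least 3 leaves \<open>bs\<close> with two or more labels, so it is a
    core type with a slot, as the acyclic attachment requires.\<close>
  define bs bf where "bs = (ks, {1..ks - 1})" and "bf = (ks, {1..ks})"
  have bsf: "bs \<noteq> bf" "fst bs = ks" "fst bf = ks" "card (snd bs) = ks - 1" "snd bf = {1..fst bf}" "snd bs \<noteq> {1..fst bs}"
  proof -
    have "ks \<in> {1..ks}" "ks \<notin> {1..ks - 1}" using ks by auto
    then have "{1..ks - 1} \<noteq> {1..ks}" by blast
    then show "bs \<noteq> bf" "fst bs = ks" "fst bf = ks" "card (snd bs) = ks - 1" "snd bf = {1..fst bf}" "snd bs \<noteq> {1..fst bs}"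
      unfolding bs_def bf_def by simp_all
  qed
  have pos: "0 < lab_freq bs" "0 < lab_freq bf" 
    using lab_freq_pos[of bs] lab_freq_pos[of bf] ks bsf(2,3) by simp_all
  \<comment> \<open>The trade changes only the two entropy terms of \<open>bs\<close> and
    \<open>bf\<close>, by amounts that vanish with \<open>excess k0\<close>.\<close>
  define low where "low k0 = base_rate k0 + (xlnx (lab_freq bs) - xlnx (lab_freq bs + excess k0))
    + (xlnx (lab_freq bf) - xlnx (lab_freq bf - excess k0))" for k0
  have l1: "(\<lambda>k0. lab_freq bs + excess k0) \<longlonglongrightarrow> lab_freq bs + 0" by (intro tendsto_intros excess_lim)
  have l2: "(\<lambda>k0. lab_freq bf - excess k0) \<longlonglongrightarrow> lab_freq bf - 0" by (intro tendsto_intros excess_lim)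
  have e1: "\<forall>\<^sub>F k0 in sequentially. 0 < lab_freq bs + excess k0" by (rule order_tendstoD(1)[OF l1]) (use pos in simp)
  have e2: "\<forall>\<^sub>F k0 in sequentially. 0 < lab_freq bf - excess k0" by (rule order_tendstoD(1)[OF l2]) (use pos in simp)
  have "low \<longlonglongrightarrow> - K_of p + (xlnx (lab_freq bs) - xlnx (lab_freq bs + 0)) + (xlnx (lab_freq bf) - xlnx (lab_freq bf - 0))"
  proof -
    have 1: "(\<lambda>k0. xlnx (lab_freq bs + excess k0)) \<longlonglongrightarrow> xlnx (lab_freq bs + 0)"
      by (rule tendsto_xlnx[OF l1]) (use pos e1 in \<open>auto elim: eventually_mono\<close>)
    have "\<forall>\<^sub>F k0 in sequentially. 0 \<le> lab_freq bf - excess k0" using e2 by (rule eventually_mono) simp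
    then have 2: "(\<lambda>k0. xlnx (lab_freq bf - excess k0)) \<longlonglongrightarrow> xlnx (lab_freq bf - 0)"
      by (intro tendsto_xlnx[OF l2]) (use pos in auto)
    show ?thesis unfolding low_def[abs_def]
      by (rule tendsto_add[OF tendsto_add[OF base_rate_lim tendsto_diff[OF tendsto_const 1]] tendsto_diff[OF tendsto_const 2]])
  qed
  then have "\<forall>\<^sub>F k0 in sequentially. c < low k0" using order_tendstoD(1) c by fastforce
  moreover have "\<forall>\<^sub>F k0 in sequentially. 0 < \<mu> - 2 * tips k0"
  proof -
    have "(\<lambda>k0. \<mu> - 2 * tips k0) \<longlonglongrightarrow> \<mu> - 2 * (\<mu> * \<beta> / (1 + \<beta>))" by (intro tendsto_intros tips_lim)
    then show ?thesis using order_tendstoD(1) core_share_pos by blast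
  qed
  ultimately have "\<forall>\<^sub>F k0 in sequentially. c < low k0 \<and> 0 < \<mu> - 2 * tips k0 \<and> 0 < lab_freq bs + excess k0
    \<and> 0 < lab_freq bf - excess k0 \<and> ks \<le> k0"
    using e1 e2 eventually_ge_at_top[of ks] by eventually_elim auto
  then obtain k0 where k0: "c < low k0" "0 < \<mu> - 2 * tips k0" "0 < lab_freq bs + excess k0"
    "0 < lab_freq bf - excess k0" "ks \<le> k0"
    unfolding eventually_sequentially by blast
  define B P where "B = label_types k0" and "P = proper_types k0"
  have finB: "finite B" and finP: "finite P" unfolding B_def P_def by (rule finite_label_types finite_proper_types)+
  have PB: "P \<subseteq> B" unfolding P_def B_def proper_types_def by auto
  have bsB: "bs \<in> B" and bfB: "bf \<in> B"
    unfolding B_def label_types_def bs_def bf_def using ks k0(5) by auto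
  then have bsP: "bs \<in> P" unfolding P_def B_def proper_types_def using bsf(6) by blast
  have B1: "1 \<le> fst b" "fst b \<in> {1..k0}" if "b \<in> B" for b using label_typesD[of b k0] that unfolding B_def by auto
  have tw0: "tip_weight bs = (0 :: nat)"
    using bsf(4) ks by simp
  have sw0: "slot_weight (k, {1..k}) = 0" "slot_weight bs = 1" for k
    using bsf(2,4) ks by simp_all
  define ex where "ex = excess k0"
  define y where "y b = (if b = bs then lab_freq bs + ex else if b = bf then lab_freq bf - ex else lab_freq b)" for b
  have sum_y: "(\<Sum>b\<in>B. H (y b)) = (\<Sum>b\<in>B. H (lab_freq b)) + (H (lab_freq bs + ex) - H (lab_freq bs))
     + (H (lab_freq bf - ex) - H (lab_freq bf))" for H :: "real \<Rightarrow> real"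
  proof -
    have "(\<Sum>b\<in>B. H (y b) - H (lab_freq b)) = (\<Sum>b\<in>{bs, bf}. H (y b) - H (lab_freq b))"
      by (rule sum.mono_neutral_right) (use finB bsB bfB in \<open>auto simp: y_def\<close>)
    then show ?thesis using bsf(1) by (simp add: sum_subtractf y_def)
  qed
  define f where "f n b = nat \<lfloor>real n * lab_freq b\<rfloor>" for n b
  \<comment> \<open>Degree 1 admits only its full type, so all \<open>N n 1\<close> vertices of
    degree 1 carry tips; no other full type does.\<close>
  define T where "T n = N n 1 + (\<Sum>b\<in>P. f n b * tip_weight b)" for n
  define W where "W n = (\<Sum>b\<in>P - {bs}. f n b * slot_weight b)" for n
  \<comment> \<open>A vertex of type \<open>bs\<close> has one slot and no tip, so this count makes
    the number of slots exactly \<open>T n\<close>.\<close>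
  define q1 where "q1 n b = (if b = bs then T n - W n else f n b)" for n b
  define fib where "fib j = {b \<in> P. fst b = j}" for j
  \<comment> \<open>Full types have no slots and, beyond degree 1, no tips. Giving them the
    remaining vertices of each degree makes the class sizes exact without upsetting the
    balance.\<close>
  define q where "q n b = (if snd b = {1..fst b} then N n (fst b) - (\<Sum>b'\<in>fib (fst b). q1 n b') else q1 n b)" for n b
  have f_lim: "(\<lambda>n. real (f n b) / real n) \<longlonglongrightarrow> lab_freq b" if "b \<in> B" for b
    unfolding f_def using lab_freq_ge_0[OF B1(1)[OF that]] by (rule tendsto_nat_floor)
  have T_lim: "(\<lambda>n. real (T n) / real n) \<longlonglongrightarrow> tips k0"
  proof -
    have "tips k0 = (\<Sum>b\<in>P. lab_freq b * tip_weight b) + (\<Sum>k=1..k0. lab_freq (k, {1..k}) * tip_weight (k, {1..k}))"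
      unfolding tips_def P_def by (rule sum_label_types_full)
    also have "(\<Sum>k=1..k0. lab_freq (k, {1..k}) * tip_weight (k, {1..k})) = (\<Sum>k\<in>{1}. lab_freq (k, {1..k}) * tip_weight (k, {1..k}))"
      by (rule sum.mono_neutral_right) (use k0(5) ks in auto)
    also have "\<dots> = p 1" using beta01 by (simp add: lab_freq_def)
    finally have eq: "tips k0 = p 1 + (\<Sum>b\<in>P. lab_freq b * tip_weight b)" by simp
    have "(\<lambda>n. real (N n 1) / real n + (\<Sum>b\<in>P. real (f n b) / real n * tip_weight b)) \<longlonglongrightarrow> tips k0"
      unfolding eq using PB by (intro tendsto_add tendsto_sum tendsto_mult tendsto_const a_lim f_lim) auto
    then show ?thesis unfolding T_def by (simp add: add_divide_distrib sum_divide_distrib)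
  qed
  have W_lim: "(\<lambda>n. real (W n) / real n) \<longlonglongrightarrow> (\<Sum>b\<in>P - {bs}. lab_freq b * real (slot_weight b))"
  proof -
    have "(\<lambda>n. \<Sum>b\<in>P - {bs}. real (f n b) / real n * real (slot_weight b)) \<longlonglongrightarrow> (\<Sum>b\<in>P - {bs}. lab_freq b * real (slot_weight b))"
      using PB by (intro tendsto_sum tendsto_mult tendsto_const f_lim) auto
    then show ?thesis unfolding W_def by (simp add: sum_divide_distrib)
  qed
  have TW: "tips k0 - (\<Sum>b\<in>P - {bs}. lab_freq b * real (slot_weight b)) = lab_freq bs + ex"
  proof -
    have "(\<Sum>b\<in>B. lab_freq b * real (slot_weight b)) = (\<Sum>b\<in>P. lab_freq b * real (slot_weight b))
       + (\<Sum>k=1..k0. lab_freq (k, {1..k}) * real (slot_weight (k, {1..k})))"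
      unfolding B_def P_def by (rule sum_label_types_full)
    also have "(\<Sum>k=1..k0. lab_freq (k, {1..k}) * real (slot_weight (k, {1..k}))) = 0" using sw0(1) by simp
    also have "(\<Sum>b\<in>P. lab_freq b * real (slot_weight b)) = lab_freq bs * real (slot_weight bs) + (\<Sum>b\<in>P - {bs}. lab_freq b * real (slot_weight b))"
      by (rule sum.remove[OF finP bsP])
    finally show ?thesis unfolding ex_def excess_def B_def[symmetric] using sw0(2) by simp
  qed
  have WT: "\<forall>\<^sub>F n in sequentially. W n < T n"
    by (rule eventually_le_of_lim[OF T_lim W_lim]) (use TW k0(3) in \<open>simp add: ex_def\<close>)
  have q1_lim: "(\<lambda>n. real (q1 n b) / real n) \<longlonglongrightarrow> y b" if "b \<in> P" for b
  proof (cases "b = bs")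
    case True
    have "(\<lambda>n. real (T n - W n) / real n) \<longlonglongrightarrow> lab_freq bs + ex"
      using tendsto_nat_diff[OF T_lim W_lim] WT unfolding TW by (simp add: eventually_mono less_imp_le)
    then show ?thesis unfolding q1_def y_def using True by simp
  next
    case False
    have "b \<noteq> bf" using that bsf(5) unfolding P_def proper_types_def by auto
    then show ?thesis using f_lim[of b] False that PB unfolding q1_def y_def by auto
  qed
  have finfib: "finite (fib j)" for j unfolding fib_def using finP by simp
  have fib_lim: "(\<lambda>n. real (\<Sum>b\<in>fib j. q1 n b) / real n) \<longlonglongrightarrow> (\<Sum>b\<in>fib j. y b)" for j
  proof -
    have "(\<lambda>n. \<Sum>b\<in>fib j. real (q1 n b) / real n) \<longlonglongrightarrow> (\<Sum>b\<in>fib j. y b)"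
      by (intro tendsto_sum q1_lim) (simp add: fib_def)
    then show ?thesis by (simp add: sum_divide_distrib)
  qed
  have fib_y: "(\<Sum>b\<in>fib j. y b) = p j - y (j, {1..j})" if j: "j \<in> {1..k0}" for j
  proof -
    have "p j = (\<Sum>b\<in>{b \<in> B. fst b = j}. lab_freq b)"
      unfolding B_def fibre_label_types[OF j] using sum_lab_freq(1)[of j] j
      by (subst sum.reindex) (auto simp: inj_on_def)
    also have "\<dots> = (\<Sum>b\<in>fib j. lab_freq b) + lab_freq (j, {1..j})"
      unfolding B_def fib_def P_def by (rule sum_fibre_full[OF j])
    finally have pj: "p j = (\<Sum>b\<in>fib j. lab_freq b) + lab_freq (j, {1..j})" .
    have nbf: "b \<noteq> bf" if "b \<in> fib j" for b using that bsf(5) unfolding fib_def P_def proper_types_def by auto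
    have nbs: "(j, {1..j}) \<noteq> bs" using bsf(6) by auto
    show ?thesis
    proof (cases "j = ks")
      case False
      then have "y b = lab_freq b" if "b \<in> fib j" for b using that nbf[OF that] bsf(2) unfolding y_def fib_def by auto
      moreover have "y (j, {1..j}) = lab_freq (j, {1..j})" using False nbs unfolding y_def bf_def by auto
      ultimately show ?thesis using pj by simp
    next
      case True
      then have bsf': "bs \<in> fib j" unfolding fib_def using bsP bsf by simp
      have "(\<Sum>b\<in>fib j. y b) = y bs + (\<Sum>b\<in>fib j - {bs}. y b)" by (rule sum.remove[OF finfib bsf'])
      also have "(\<Sum>b\<in>fib j - {bs}. y b) = (\<Sum>b\<in>fib j - {bs}. lab_freq b)"
        using nbf by (intro sum.cong) (auto simp: y_def)
      also have "y bs = lab_freq bs + ex" unfolding y_def by simp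
      finally have "(\<Sum>b\<in>fib j. y b) = (\<Sum>b\<in>fib j. lab_freq b) + ex"
        using sum.remove[OF finfib bsf', of lab_freq] by simp
      moreover have "y (j, {1..j}) = lab_freq (j, {1..j}) - ex" using True nbs unfolding y_def bf_def by auto
      ultimately show ?thesis using pj by simp
    qed
  qed
  have fibN: "\<forall>\<^sub>F n in sequentially. \<forall>j\<in>{1..k0}. (\<Sum>b\<in>fib j. q1 n b) \<le> N n j"
  proof (rule eventually_ball_finite)
    show "\<forall>j\<in>{1..k0}. \<forall>\<^sub>F n in sequentially. (\<Sum>b\<in>fib j. q1 n b) \<le> N n j"
    proof
      fix j assume j: "j \<in> {1..k0}"
      show "\<forall>\<^sub>F n in sequentially. (\<Sum>b\<in>fib j. q1 n b) \<le> N n j"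
      \<comment> \<open>Limits cannot compare the two sides when both tend to 0; but then all
        rounded frequencies of this degree are 0, and \<open>bs\<close> has a different
        degree.\<close>
      proof (cases "p j = 0")
        case True
        then have "j \<noteq> ks" using ks by auto
        then have "q1 n b = 0" if "b \<in> fib j" for n b
          using that True bsf(2) unfolding q1_def fib_def f_def lab_freq_def by auto
        then show ?thesis by simp
      next
        case False
        then have pj: "0 < p j" using p_ge_0[of j] j by force
        have "0 < lab_freq (j, {1..j})" using pj j by (intro lab_freq_pos) auto
        then have "0 < y (j, {1..j})" using k0 unfolding y_def ex_def by auto
        then have "(\<Sum>b\<in>fib j. y b) < p j" using fib_y[OF j] by simp
        then have "\<forall>\<^sub>F n in sequentially. (\<Sum>b\<in>fib j. q1 n b) < N n j"
          using eventually_le_of_lim[OF a_lim fib_lim[of j], of j] j by simp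
        then show ?thesis by (rule eventually_mono) simp
      qed
    qed
  qed simp
  have q_lim: "(\<lambda>n. real (q n b) / real n) \<longlonglongrightarrow> y b" if b: "b \<in> B" for b
  proof (cases "snd b = {1..fst b}")
    case True
    have j: "fst b \<in> {1..k0}" using B1 b by blast
    have "\<forall>\<^sub>F n in sequentially. (\<Sum>b'\<in>fib (fst b). q1 n b') \<le> N n (fst b)"
      using fibN by (rule eventually_mono) (use j in blast)
    then have "(\<lambda>n. real (N n (fst b) - (\<Sum>b'\<in>fib (fst b). q1 n b')) / real n) \<longlonglongrightarrow> p (fst b) - (\<Sum>b'\<in>fib (fst b). y b')"
      using j by (intro tendsto_nat_diff a_lim fib_lim) auto
    moreover have "p (fst b) - (\<Sum>b'\<in>fib (fst b). y b') = y b" using fib_y[OF j] True by (metis diff_diff_eq2 diff_add_cancel add_diff_cancel_left' prod.collapse)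
    ultimately show ?thesis unfolding q_def using True by simp
  next
    case False
    then have "b \<in> P" using b unfolding P_def B_def proper_types_def by simp
    then show ?thesis using q1_lim False unfolding q_def by simp
  qed
  \<comment> \<open>Tips and slots use \<open>2 * T n\<close> half-edges; the remaining
    \<open>2 * (kk n + 1)\<close> belong to the core.\<close>
  define kk where "kk n = half_ell n - (T n + 1)" for n
  have T1_lim: "(\<lambda>n. real (T n + 1) / real n) \<longlonglongrightarrow> tips k0"
  proof -
    have "(\<lambda>n. real (T n) / real n + 1 / real n) \<longlonglongrightarrow> tips k0 + 0" by (intro tendsto_add T_lim lim_1_over_n)
    then show ?thesis by (simp add: add_divide_distrib add.commute)
  qed
  have half: "\<forall>\<^sub>F n in sequentially. T n + 1 < half_ell n"
    by (rule eventually_le_of_lim[OF half_ell_lim T1_lim]) (use k0(2) in simp)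
  define y0 where "y0 = \<mu> / 2 - tips k0"
  have y0: "0 < y0" using k0(2) unfolding y0_def by simp
  have kk_lim: "(\<lambda>n. real (kk n) / real n) \<longlonglongrightarrow> y0"
    unfolding kk_def y0_def using half by (intro tendsto_nat_diff half_ell_lim T1_lim) (auto elim!: eventually_mono)
  have shift1: "(\<lambda>n. real (g n - 1) / real n) \<longlonglongrightarrow> z" if g: "(\<lambda>n. real (g n) / real n) \<longlonglongrightarrow> z" "0 < z" for g :: "nat \<Rightarrow> nat" and z
  proof -
    have "(\<lambda>n. real (g n - 1) / real n) \<longlonglongrightarrow> z - 0"
    proof (rule tendsto_nat_diff[OF g(1)])
      show "(\<lambda>n. real 1 / real n) \<longlonglongrightarrow> 0" using lim_1_over_n by simp
      show "\<forall>\<^sub>F n in sequentially. 1 \<le> g n" using eventually_pos_of_lim[OF g] by (auto elim!: eventually_mono)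
    qed
    then show ?thesis by simp
  qed
  have tips_pos: "0 < tips k0" using tips_ge_p1[of k0] p1 ks k0(5) by simp
  define lb :: "nat \<Rightarrow> real" where "lb n = (\<Prod>j=1..k0. fact (N n j)) * (fact (T n - 1) * (2 ^ (kk n - 1) * fact (kk n))) / (\<Prod>b\<in>B. fact (q n b))" for n
  define L where "L = (\<Sum>j=1..k0. xlnx (p j) - p j) + ((xlnx (tips k0) - tips k0) + (y0 * ln 2 + (xlnx y0 - y0)))
    - (\<Sum>b\<in>B. xlnx (y b) - y b)"
  have rate_lb: "rate lb (\<lambda>n. (\<Sum>j=1..k0. real (N n j)) + (real (T n - 1) + (0 + real (kk n))) - (\<Sum>b\<in>B. real (q n b))) L"
    unfolding lb_def L_def
    by (intro rate_divide rate_mult rate_prod rate_fact rate_power2 q_lim shift1 kk_lim T_lim y0 tips_pos finB a_lim) auto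
  have sumB_p: "(\<Sum>b\<in>B. lab_freq b) = (\<Sum>j=1..k0. p j)"
    unfolding B_def sum_label_types using sum_lab_freq(1) by (intro sum.cong) auto
  have Leq: "L - (xlnx \<mu> / 2 - \<mu> / 2) = low k0"
  proof -
    have 1: "(\<Sum>b\<in>B. xlnx (y b)) = (\<Sum>b\<in>B. xlnx (lab_freq b)) + (xlnx (lab_freq bs + ex) - xlnx (lab_freq bs))
     + (xlnx (lab_freq bf - ex) - xlnx (lab_freq bf))" by (rule sum_y)
    have 2: "(\<Sum>b\<in>B. y b) = (\<Sum>j=1..k0. p j)" using sum_y[of "\<lambda>x. x"] sumB_p by simp
    have "xlnx (y0 * 2) = 2 * xlnx y0 + y0 * 2 * ln 2" using y0 by (intro xlnx_mult) auto
    then have 3: "y0 * ln 2 + (xlnx y0 - y0) = xlnx (\<mu> - 2 * tips k0) / 2 - y0"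
      unfolding y0_def by (simp add: algebra_simps)
    show ?thesis unfolding L_def low_def base_rate_def 3 sum_subtractf 1 2 ex_def[symmetric] B_def[symmetric]
      unfolding y0_def by simp
  qed
  have T_pos: "\<forall>\<^sub>F n in sequentially. 1 \<le> T n" using eventually_pos_of_lim[OF T_lim tips_pos] by (auto elim!: eventually_mono)
  have fibre_q: "(\<Sum>b\<in>{b \<in> B. fst b = j}. q n b) = N n j" if j: "j \<in> {1..k0}" and le: "(\<Sum>b\<in>fib j. q1 n b) \<le> N n j" for n j
  proof -
    have "(\<Sum>b\<in>{b \<in> B. fst b = j}. q n b) = (\<Sum>b\<in>fib j. q n b) + q n (j, {1..j})"
      unfolding B_def fib_def P_def by (rule sum_fibre_full[OF j])
    also have "(\<Sum>b\<in>fib j. q n b) = (\<Sum>b\<in>fib j. q1 n b)"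
      by (rule sum.cong) (auto simp: q_def fib_def P_def proper_types_def)
    also have "q n (j, {1..j}) = N n j - (\<Sum>b\<in>fib j. q1 n b)" unfolding q_def by simp
    finally show ?thesis using le by simp
  qed
  have sum_q: "\<forall>\<^sub>F n in sequentially. (\<Sum>b\<in>B. q n b) = (\<Sum>j=1..k0. N n j)"
    using fibN
  proof eventually_elim
    case (elim n)
    have "(\<Sum>b\<in>B. q n b) = (\<Sum>j=1..k0. \<Sum>b\<in>{b \<in> B. fst b = j}. q n b)"
      by (rule sum.group[symmetric]) (use finB B1 in auto)
    also have "\<dots> = (\<Sum>j=1..k0. N n j)" using fibre_q elim by (intro sum.cong) auto
    finally show ?case .
  qed
  show ?thesis
  \<comment> \<open>The bound 2 arises because the factorials of \<open>T n - 1\<close> and of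
    \<open>kk n\<close>, which is \<open>half_ell n - T n - 1\<close>, each lower the exponent of n
    by one.\<close>
  proof (rule rate_lower[OF rate_lb rate_configurations, where C = 2])
    show "c < L - (xlnx \<mu> / 2 - \<mu> / 2)" unfolding Leq by (rule k0(1))
    show "\<forall>\<^sub>F n in sequentially. \<bar>(\<Sum>j=1..k0. real (N n j)) + (real (T n - 1) + (0 + real (kk n))) - (\<Sum>b\<in>B. real (q n b)) - real (half_ell n)\<bar> \<le> 2"
      using sum_q T_pos half
    proof eventually_elim
      case (elim n)
      have "(\<Sum>b\<in>B. real (q n b)) = (\<Sum>j=1..k0. real (N n j))" using elim(1) by (metis of_nat_sum)
      moreover have "real (T n - 1) = real (T n) - 1" "real (kk n) = real (half_ell n) - real (T n) - 1"
        using elim(2,3) unfolding kk_def by (auto simp: of_nat_diff)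
      ultimately show ?case by simp
    qed
    have "(\<lambda>n. real (q n bs) / real n) \<longlonglongrightarrow> lab_freq bs + ex" using q_lim[OF bsB] unfolding y_def by simp
    then have q_bs: "\<forall>\<^sub>F n in sequentially. 0 < q n bs"
      using eventually_pos_of_lim k0(3) unfolding ex_def by fastforce
    have kk_ge: "\<forall>\<^sub>F n in sequentially. y0 / 2 * real n \<le> real (kk n)"
    proof -
      have "\<forall>\<^sub>F n in sequentially. y0 / 2 < real (kk n) / real n"
        by (rule order_tendstoD(1)[OF kk_lim]) (use y0 in simp)
      then show ?thesis using eventually_gt_at_top[of 0] by eventually_elim (simp add: less_divide_eq)
    qed
    have "0 < y0 / 2" using y0 by simp
    note X' = X[OF this]
    show "\<forall>\<^sub>F n in sequentially. lb n \<le> real (card {M \<in> perfect_matchings (darts (vertices (N n)) (tdegree (N n))).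
        linked fst (vertices (N n)) M \<and> defect fst M \<le> D n})"
      using fibN T_pos half WT q_bs kk_ge X'
    proof eventually_elim
      case (elim n)
      have "(\<Prod>j=1..k0. fact (N n j)) * (fact (T n - 1) * (2 ^ (kk n - 1) * fact (kk n)))
        \<le> card {M \<in> perfect_matchings (darts (vertices (N n)) (tdegree (N n))). linked fst (vertices (N n)) M \<and> defect fst M \<le> D n}
          * (\<Prod>b\<in>label_types k0. fact (q n b))"
      proof (rule card_linked_ge_profile[OF finite_supp])
        show "1 \<le> k0" using ks k0 by simp
        show "(\<Sum>b\<in>{b \<in> label_types k0. fst b = j}. q n b) = N n j" if "j \<in> {1..k0}" for j
          using fibre_q[OF that] elim(1) that unfolding B_def by blast
        have ST: "Suc (T n - 1) = T n" using elim(2) by simp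
        have "(\<Sum>b\<in>label_types k0. q n b * tip_weight b) = (\<Sum>b\<in>P. q n b * tip_weight b) + (\<Sum>k=1..k0. q n (k, {1..k}) * tip_weight (k, {1..k}))"
          unfolding P_def by (rule sum_label_types_full)
        also have "(\<Sum>k=1..k0. q n (k, {1..k}) * tip_weight (k, {1..k})) = (\<Sum>k\<in>{1}. q n (k, {1..k}) * tip_weight (k, {1..k}))"
          by (rule sum.mono_neutral_right) (use k0(5) ks in auto)
        also have "\<dots> = N n 1"
        proof -
          have "fib 1 = {}"
          proof (rule equals0I)
            fix b assume "b \<in> fib 1"
            then have "snd b \<subseteq> {1..1}" "snd b \<noteq> {}" "snd b \<noteq> {1..1}"
              unfolding fib_def P_def proper_types_def label_types_def by auto
            then show False by auto
          qed
          then show ?thesis unfolding q_def by simp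
        qed
        also have "(\<Sum>b\<in>P. q n b * tip_weight b) = (\<Sum>b\<in>P. f n b * tip_weight b)"
          by (rule sum.cong) (use tw0 in \<open>auto simp: q_def q1_def P_def proper_types_def\<close>)
        finally have "(\<Sum>b\<in>label_types k0. q n b * of_bool (card (snd b) = 1)) = T n"
          unfolding T_def by simp
        then show "(\<Sum>b\<in>label_types k0. q n b * of_bool (card (snd b) = 1)) = Suc (T n - 1)"
          using ST by (rule trans[OF _ sym])
        have "(\<Sum>b\<in>label_types k0. q n b * slot_weight b) = (\<Sum>b\<in>P. q n b * slot_weight b) + (\<Sum>k=1..k0. q n (k, {1..k}) * slot_weight (k, {1..k}))"
          unfolding P_def by (rule sum_label_types_full)
        also have "(\<Sum>k=1..k0. q n (k, {1..k}) * slot_weight (k, {1..k})) = 0" using sw0(1) by simp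
        also have "(\<Sum>b\<in>P. q n b * slot_weight b) = q n bs * slot_weight bs + (\<Sum>b\<in>P - {bs}. q n b * slot_weight b)"
          by (rule sum.remove[OF finP bsP])
        also have "(\<Sum>b\<in>P - {bs}. q n b * slot_weight b) = W n" unfolding W_def
          by (rule sum.cong) (auto simp: q_def q1_def P_def proper_types_def)
        also have "q n bs * slot_weight bs = T n - W n" using sw0(2) bsf(6) by (simp add: q_def q1_def)
        finally show "(\<Sum>b\<in>label_types k0. q n b * (fst b - card (snd b))) = Suc (T n - 1)"
          using elim(4) unfolding ST by simp
        show "tell (N n) = 2 * Suc (T n - 1) + 2 * Suc (kk n)"
          unfolding ST tell_half kk_def using elim(3) by simp
        show "bs \<in> label_types k0" using bsB unfolding B_def .
        show "2 \<le> card (snd bs)" "card (snd bs) < fst bs" using bsf(2,4) ks by simp_all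
        show "q n bs \<noteq> 0" using elim(5) by simp
        show "2 ^ (kk n - 1) * fact (kk n) \<le> card {C \<in> perfect_matchings (core_he (vertices (N n)) L).
            linked fst (core_vs (vertices (N n)) L) C \<and> defect fst C \<le> D n}"
          if "labelling (vertices (N n)) (tdegree (N n)) L" "card (core_he (vertices (N n)) L) = 2 * Suc (kk n)" for L
          using elim(6,7) that by blast
      qed
      then have "real ((\<Prod>j=1..k0. fact (N n j)) * (fact (T n - 1) * (2 ^ (kk n - 1) * fact (kk n))))
        \<le> real (card {M \<in> perfect_matchings (darts (vertices (N n)) (tdegree (N n))). linked fst (vertices (N n)) M \<and> defect fst M \<le> D n}
          * (\<Prod>b\<in>B. fact (q n b)))"
        unfolding B_def by (rule of_nat_mono)
      moreover have "0 < (\<Prod>b\<in>B. fact (q n b) :: real)" by (intro prod_pos) auto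
      ultimately show ?case unfolding lb_def by (simp add: divide_le_eq)
    qed
  qed
qed

end

subsection \<open>Simple configurations\<close>

lemma odd_fact_pos: "0 < odd_fact k"
  by (induction k) auto

lemma odd_fact_le:
  "real (odd_fact (Suc k)) \<le> 2 ^ k * fact k * sqrt (real (2 * k + 1))"
proof -
  have "(real (odd_fact (Suc k)))\<^sup>2 \<le> real (2 * k + 1) * (2 ^ k * fact k)\<^sup>2"
    using of_nat_mono[OF odd_fact_sq_le[of k], where ?'a = real]
    by (simp only: of_nat_power of_nat_mult of_nat_fact of_nat_numeral)
  then have "sqrt ((real (odd_fact (Suc k)))\<^sup>2) \<le> sqrt (real (2 * k + 1) * (2 ^ k * fact k)\<^sup>2)"
    by (rule real_sqrt_le_mono)
  then show ?thesis by (simp add: real_sqrt_mult mult.commute)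
qed

text \<open>
  A linked matching is only of order \<open>1 / sqrt k\<close> likely, while the mean defect is bounded;
  so Markov's inequality at any level well above \<open>sqrt n\<close> keeps most linked matchings.
\<close>

lemma card_linked_small_defect:
  assumes L: "labelling V d L" and c: "card (core_he V L) = 2 * Suc k"
    and S2: "real (\<Sum>v\<in>V. (d v)\<^sup>2) \<le> C * real n" and C: "0 \<le> C"
    and k: "c0 * real n \<le> real k" "0 < c0" "1 \<le> k" "0 < n"
    and D: "2 * (C * real n / sqrt (c0 * real n) + (C * real n)\<^sup>2 / (c0 * real n * sqrt (c0 * real n))) \<le> real D" "0 < D"
  shows "2 ^ (k - 1) * fact k \<le> card {M \<in> perfect_matchings (core_he V L). linked fst (core_vs V L) M \<and> defect fst M \<le> D}"
proof -
  define H where "H = core_he V L"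
  define Y where "Y = (2 ^ k * fact k :: real)"
  obtain j where j: "k = Suc j" using k(3) by (cases k) auto
  have fin: "finite H" unfolding H_def using c by (intro card_ge_0_finite) simp
  have cH: "card H = 2 * Suc (Suc j)" unfolding H_def c j ..
  define P where "P = card {(a, b) \<in> H \<times> H. fst a = fst b}"
  have "real P \<le> real (\<Sum>v\<in>V. (d v)\<^sup>2)" unfolding P_def H_def by (rule of_nat_mono[OF card_core_pairs_le[OF L]])
  then have P: "real P \<le> C * real n" using S2 by linarith
  define bad where "bad = card {M \<in> perfect_matchings H. D < defect fst M}"
  have "D * bad \<le> P * odd_fact (Suc j) + P\<^sup>2 * odd_fact j"
    unfolding bad_def P_def by (rule card_defect_gt_le[OF fin cH])
  then have "real D * real bad \<le> real P * real (odd_fact (Suc j)) + (real P)\<^sup>2 * real (odd_fact j)"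
    by (metis (mono_tags, lifting) of_nat_add of_nat_le_iff of_nat_mult of_nat_power)
  define s where "s = sqrt (c0 * real n)"
  have cn: "0 < c0 * real n" using k by simp
  have s: "0 < s" "s \<le> sqrt (real (2 * k + 1))" unfolding s_def using cn k(1) by auto
  \<comment> \<open>Dividing the bound on (2k+1)!! by 2k+1 gives (2k-1)!! \<le> Y / sqrt(2k+1). As
    \<open>k = Suc j\<close>, the left side is the number of matchings containing a given
    edge.\<close>
  have of1: "real (odd_fact (Suc j)) \<le> Y / s"
  proof -
    have "real (2 * k + 1) * real (odd_fact k) = real (odd_fact (Suc k))" by (simp add: algebra_simps)
    also have "\<dots> \<le> Y * sqrt (real (2 * k + 1))" unfolding Y_def by (rule odd_fact_le)
    finally have le: "real (2 * k + 1) * real (odd_fact k) \<le> Y * sqrt (real (2 * k + 1))" .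
    have sq: "sqrt (real (2 * k + 1)) * sqrt (real (2 * k + 1)) = real (2 * k + 1)" by simp
    have "sqrt (real (2 * k + 1)) * (sqrt (real (2 * k + 1)) * real (odd_fact k)) \<le> sqrt (real (2 * k + 1)) * Y"
      unfolding mult.assoc[symmetric] sq using le by (simp only: mult.commute)
    then have "sqrt (real (2 * k + 1)) * real (odd_fact k) \<le> Y" by (rule mult_left_le_imp_le) simp
    moreover have "s * real (odd_fact k) \<le> sqrt (real (2 * k + 1)) * real (odd_fact k)"
      using s by (intro mult_right_mono) auto
    ultimately show ?thesis using s j by (simp add: le_divide_eq mult.commute)
  qed
  have of2: "real (odd_fact j) \<le> Y / (c0 * real n * s)"
  proof -
    have "c0 * real n * real (odd_fact j) \<le> real (2 * j + 1) * real (odd_fact j)"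
      using k(1) j by (intro mult_right_mono) auto
    also have "\<dots> = real (odd_fact (Suc j))" by (simp add: algebra_simps)
    also have "\<dots> \<le> Y / s" by (rule of1)
    finally have "c0 * real n * real (odd_fact j) * s \<le> Y" using s by (simp add: pos_le_divide_eq)
    moreover have "0 < c0 * real n * s" using cn s by simp
    ultimately show ?thesis by (simp add: pos_le_divide_eq mult_ac)
  qed
  have "real D * real bad \<le> C * real n * (Y / s) + (C * real n)\<^sup>2 * (Y / (c0 * real n * s))"
  proof -
    have "real P * real (odd_fact (Suc j)) \<le> C * real n * (Y / s)"
      using P of1 C by (intro mult_mono) auto
    moreover have "(real P)\<^sup>2 * real (odd_fact j) \<le> (C * real n)\<^sup>2 * (Y / (c0 * real n * s))"
      using P of2 by (intro mult_mono power_mono) auto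
    ultimately show ?thesis using \<open>real D * real bad \<le> _\<close> by linarith
  qed
  also have "\<dots> = (C * real n / s + (C * real n)\<^sup>2 / (c0 * real n * s)) * Y"
    by (simp add: field_simps)
  also have "\<dots> \<le> real D / 2 * Y"
  proof (rule mult_right_mono)
    have half: "x \<le> real D / 2" if "2 * x \<le> real D" for x using that by simp
    show "C * real n / s + (C * real n)\<^sup>2 / (c0 * real n * s) \<le> real D / 2"
      using D(1) unfolding s_def[symmetric] by (rule half)
  qed (simp add: Y_def)
  \<comment> \<open>Matchings of large defect number at most half of the guaranteed connected ones,
    which explains \<open>2 ^ (k - 1)\<close> in place of \<open>2 ^ k\<close>.\<close>
  finally have bad: "2 * real bad \<le> Y" using D(2) by simp
  define A where "A = {M \<in> perfect_matchings H. linked fst (core_vs V L) M}"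
  have fA: "finite (perfect_matchings H)" using finite_perfect_matchings[OF fin] .
  have "2 ^ k * fact k \<le> card A" unfolding A_def H_def by (rule card_linked_core_ge[OF L c])
  from of_nat_mono[OF this, where ?'a = real] have A: "Y \<le> real (card A)"
    unfolding Y_def by (simp only: of_nat_power of_nat_mult of_nat_fact of_nat_numeral)
  have "A \<subseteq> {M \<in> perfect_matchings H. linked fst (core_vs V L) M \<and> defect fst M \<le> D} \<union> {M \<in> perfect_matchings H. D < defect fst M}"
    unfolding A_def by auto
  then have "card A \<le> card ({M \<in> perfect_matchings H. linked fst (core_vs V L) M \<and> defect fst M \<le> D} \<union> {M \<in> perfect_matchings H. D < defect fst M})"
    using fA by (intro card_mono) auto
  also have "\<dots> \<le> card {M \<in> perfect_matchings H. linked fst (core_vs V L) M \<and> defect fst M \<le> D} + bad"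
    unfolding bad_def by (rule card_Un_le)
  finally have "Y \<le> 2 * real (card {M \<in> perfect_matchings H. linked fst (core_vs V L) M \<and> defect fst M \<le> D})"
    using A bad by linarith
  moreover have "Y = 2 * real (2 ^ (k - 1) * fact k)" unfolding Y_def j by (simp add: algebra_simps)
  ultimately have "real (2 ^ (k - 1) * fact k) \<le> real (card {M \<in> perfect_matchings H. linked fst (core_vs V L) M \<and> defect fst M \<le> D})"
    by linarith
  then show ?thesis unfolding H_def by (simp only: of_nat_le_iff)
qed

section \<open>The two asymptotic formulas\<close>

context degree_limit
begin

text \<open>A core matching is a set of subsets of the half-edges, so its defect is at most
  \<open>2 ^ tell (N n)\<close>; at this level the restriction on the defect in
  \<open>linked_lower\<close> is void.\<close>

lemma connected_lower:
  assumes c: "c < - K_of p"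
  shows "\<forall>\<^sub>F n in sequentially. exp (c * real n) * real (card (configurations (N n)))
    \<le> real (card (connected_configurations (N n)))"
proof -
  have "\<forall>\<^sub>F n in sequentially. exp (c * real n) * real (card (configurations (N n)))
    \<le> real (card {M \<in> perfect_matchings (darts (vertices (N n)) (tdegree (N n))). linked fst (vertices (N n)) M \<and> defect fst M \<le> 2 ^ tell (N n)})"
  proof (rule linked_lower[OF c])
    fix c0 :: real assume "0 < c0"
    show "\<forall>\<^sub>F n in sequentially. \<forall>k L. c0 * real n \<le> real k \<longrightarrow>
      labelling (vertices (N n)) (tdegree (N n)) L \<longrightarrow> card (core_he (vertices (N n)) L) = 2 * Suc k \<longrightarrow>
      2 ^ (k - 1) * fact k \<le> card {C \<in> perfect_matchings (core_he (vertices (N n)) L).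
        linked fst (core_vs (vertices (N n)) L) C \<and> defect fst C \<le> 2 ^ tell (N n)}"
    proof (intro always_eventually allI impI)
      fix n k L assume L: "labelling (vertices (N n)) (tdegree (N n)) L" and cH: "card (core_he (vertices (N n)) L) = 2 * Suc k"
      have sub: "core_he (vertices (N n)) L \<subseteq> darts (vertices (N n)) (tdegree (N n))" by (rule core_subset_darts[OF L])
      have fin: "finite (darts (vertices (N n)) (tdegree (N n)))" by (intro finite_darts finite_vertices)
      have "defect fst C \<le> 2 ^ tell (N n)" if C: "C \<in> perfect_matchings (core_he (vertices (N n)) L)" for C
      proof -
        have "C \<subseteq> Pow (darts (vertices (N n)) (tdegree (N n)))" using perfect_matchings_edge_subset[OF C] sub by blast
        then have "card C \<le> card (Pow (darts (vertices (N n)) (tdegree (N n))))" using fin by (intro card_mono) auto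
        also have "\<dots> = 2 ^ tell (N n)" using fin by (simp add: card_Pow card_darts_type finite_supp)
        finally show ?thesis unfolding defect_def by simp
      qed
      then have "{C \<in> perfect_matchings (core_he (vertices (N n)) L). linked fst (core_vs (vertices (N n)) L) C \<and> defect fst C \<le> 2 ^ tell (N n)}
        = {C \<in> perfect_matchings (core_he (vertices (N n)) L). linked fst (core_vs (vertices (N n)) L) C}" by blast
      moreover have "2 ^ k * fact k \<le> card {C \<in> perfect_matchings (core_he (vertices (N n)) L). linked fst (core_vs (vertices (N n)) L) C}"
        by (rule card_linked_core_ge[OF L cH])
      moreover have "(2::nat) ^ (k - 1) * fact k \<le> 2 ^ k * fact k" by (intro mult_right_mono power_increasing) auto
      ultimately show "2 ^ (k - 1) * fact k \<le> card {C \<in> perfect_matchings (core_he (vertices (N n)) L).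
        linked fst (core_vs (vertices (N n)) L) C \<and> defect fst C \<le> 2 ^ tell (N n)}" by (metis (no_types, lifting) le_trans)
    qed
  qed
  then show ?thesis
  proof (rule eventually_mono)
    fix n
    assume le: "exp (c * real n) * real (card (configurations (N n)))
      \<le> real (card {M \<in> perfect_matchings (darts (vertices (N n)) (tdegree (N n))). linked fst (vertices (N n)) M \<and> defect fst M \<le> 2 ^ tell (N n)})"
    have "card {M \<in> perfect_matchings (darts (vertices (N n)) (tdegree (N n))). linked fst (vertices (N n)) M \<and> defect fst M \<le> 2 ^ tell (N n)}
      \<le> card (connected_configurations (N n))"
      unfolding connected_configurations_perfect_matchings
      using finite_perfect_matchings[OF finite_darts[OF finite_vertices, of "N n" "tdegree (N n)"]] by (intro card_mono) auto
    then show "exp (c * real n) * real (card (configurations (N n))) \<le> real (card (connected_configurations (N n)))"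
      using le by linarith
  qed
qed

lemma configurations_pos: "0 < card (configurations (N n))"
  unfolding card_configurations by (rule odd_fact_pos)

lemma exp_asymp_connected:
  "exp_asymp (K_of p) (\<lambda>n. real (card (connected_configurations (N n)))) (\<lambda>n. real (card (configurations (N n))))"
  by (rule exp_asympI) (use configurations_pos connected_upper connected_lower in auto)

lemma simple_le_connected:
  "card (simple_connected_configurations (N n)) \<le> card (connected_configurations (N n))"
proof (rule card_mono)
  show "finite (connected_configurations (N n))"
    unfolding connected_configurations_perfect_matchings using finite_perfect_matchings[OF finite_darts[OF finite_vertices, of "N n" "tdegree (N n)"]] by simp
qed (simp add: simple_connected_configurations_def)

context
  assumes sq_summable: "(\<lambda>i. (real i)\<^sup>2 * p i) summable_on {1..}"
    and sq_lim: "(\<lambda>n. real (\<Sum>i\<in>tsupp (N n). i\<^sup>2 * N n i) / real n)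
      \<longlonglongrightarrow> (\<Sum>\<^sub>\<infinity>i\<in>{1..}. (real i)\<^sup>2 * p i)"
begin

definition "sq n = (\<Sum>i\<in>tsupp (N n). i\<^sup>2 * N n i)"
definition "second_moment = (\<Sum>\<^sub>\<infinity>i\<in>{1..}. (real i)\<^sup>2 * p i)"

lemma sq_bound: "\<exists>C>0. \<forall>\<^sub>F n in sequentially. real (sq n) \<le> C * real n"
proof -
  have pos: "0 \<le> second_moment" unfolding second_moment_def using p_ge_0 by (intro infsum_nonneg) auto
  have "\<forall>\<^sub>F n in sequentially. real (sq n) / real n < second_moment + 1"
    using order_tendstoD(2)[OF sq_lim, of "second_moment + 1"] unfolding sq_def second_moment_def by simp
  then have "\<forall>\<^sub>F n in sequentially. real (sq n) \<le> (second_moment + 1) * real n"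
    using eventually_gt_at_top[of 0] by eventually_elim (simp add: divide_less_eq)
  then show ?thesis using pos by (intro exI[of _ "second_moment + 1"]) auto
qed

text \<open>Convergence of the second moment to that of \<open>p\<close> leaves less than
  \<open>e * n\<close> for the degrees above a suitable \<open>K\<close>, and a single vertex of
  degree \<open>i\<close> already contributes the square of \<open>i\<close>. Degrees up to
  \<open>K\<close> are covered by taking n large.\<close>

lemma max_degree:
  assumes e: "0 < e"
  shows "\<forall>\<^sub>F n in sequentially. \<forall>i. 1 \<le> i \<longrightarrow> N n i \<noteq> 0 \<longrightarrow> (real i)\<^sup>2 \<le> e * real n"
proof -
  have part: "(\<lambda>K. \<Sum>i=1..K. (real i)\<^sup>2 * p i) \<longlonglongrightarrow> second_moment"
    unfolding second_moment_def by (intro has_sum_partial_sums has_sum_infsum sq_summable)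
  then obtain K where K: "second_moment - e < (\<Sum>i=1..K. (real i)\<^sup>2 * p i)"
    using order_tendstoD(1)[OF part, of "second_moment - e"] e unfolding eventually_sequentially by auto
  have "(\<lambda>n. real (sq n) / real n - (\<Sum>i=1..K. (real i)\<^sup>2 * (real (N n i) / real n)))
     \<longlonglongrightarrow> second_moment - (\<Sum>i=1..K. (real i)\<^sup>2 * p i)"
    unfolding sq_def second_moment_def by (intro tendsto_diff sq_lim tendsto_sum tendsto_mult tendsto_const a_lim) auto
  then have "\<forall>\<^sub>F n in sequentially. real (sq n) / real n - (\<Sum>i=1..K. (real i)\<^sup>2 * (real (N n i) / real n)) < e"
    by (rule order_tendstoD(2)) (use K in linarith)
  moreover have "\<forall>\<^sub>F n in sequentially. (real K)\<^sup>2 / e \<le> real n"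
    using filterlim_real_sequentially unfolding filterlim_at_top by blast
  ultimately show ?thesis using eventually_gt_at_top[of 0]
  proof eventually_elim
    case (elim n)
    show ?case
    proof (intro allI impI)
      fix i assume i: "1 \<le> i" "N n i \<noteq> 0"
      show "(real i)\<^sup>2 \<le> e * real n"
      proof (cases "i \<le> K")
        case True
        then have "(real i)\<^sup>2 \<le> (real K)\<^sup>2" by (intro power_mono) auto
        also have "\<dots> \<le> e * real n" using elim(2) e by (simp add: pos_divide_le_eq mult.commute)
        finally show ?thesis .
      next
        case False
        have fin: "finite (tsupp (N n))" by (rule finite_supp)
        have "(\<Sum>j=1..K. j\<^sup>2 * N n j) = (\<Sum>j\<in>{1..K} \<inter> tsupp (N n). j\<^sup>2 * N n j)"
          by (rule sum.mono_neutral_right) (auto simp: tsupp_def)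
        moreover have "(\<Sum>j\<in>insert i ({1..K} \<inter> tsupp (N n)). j\<^sup>2 * N n j) \<le> sq n"
          unfolding sq_def by (rule sum_mono2) (use fin i in \<open>auto simp: tsupp_def\<close>)
        moreover have "(\<Sum>j\<in>insert i ({1..K} \<inter> tsupp (N n)). j\<^sup>2 * N n j)
          = i\<^sup>2 * N n i + (\<Sum>j\<in>{1..K} \<inter> tsupp (N n). j\<^sup>2 * N n j)"
          using fin False by (intro sum.insert) auto
        ultimately have "i\<^sup>2 * N n i + (\<Sum>j=1..K. j\<^sup>2 * N n j) \<le> sq n" by simp
        moreover have "i\<^sup>2 \<le> i\<^sup>2 * N n i" using i by simp
        ultimately have "i\<^sup>2 + (\<Sum>j=1..K. j\<^sup>2 * N n j) \<le> sq n" by linarith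
        then have "real (i\<^sup>2 + (\<Sum>j=1..K. j\<^sup>2 * N n j)) \<le> real (sq n)" by (rule of_nat_mono)
        then have "(real i)\<^sup>2 \<le> real (sq n) - (\<Sum>j=1..K. (real j)\<^sup>2 * real (N n j))" by simp
        also have "\<dots> = (real (sq n) / real n - (\<Sum>j=1..K. (real j)\<^sup>2 * (real (N n j) / real n))) * real n"
          using elim(3) by (simp add: left_diff_distrib sum_distrib_right)
        also have "\<dots> \<le> e * real n" using elim(1) by (intro mult_right_mono) auto
        finally show ?thesis .
      qed
    qed
  qed
qed

lemma tdegree_supp: "v \<in> vertices (N n) \<Longrightarrow> 1 \<le> tdegree (N n) v \<and> N n (tdegree (N n) v) \<noteq> 0"
proof -
  assume v: "v \<in> vertices (N n)"
  then have 1: "1 \<le> tdegree (N n) v" by (rule tdegree_ge_1[OF finite_supp])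
  have "v \<in> {w \<in> vertices (N n). tdegree (N n) w = tdegree (N n) v}" using v by simp
  then have "card {w \<in> vertices (N n). tdegree (N n) w = tdegree (N n) v} \<noteq> 0"
    using card_0_eq[of "{w \<in> vertices (N n). tdegree (N n) w = tdegree (N n) v}"] by auto
  then show ?thesis using 1 card_tdegree[OF finite_supp, of n "tdegree (N n) v"] by simp
qed

lemma simple_lower:
  assumes c: "c < - K_of p"
  shows "\<forall>\<^sub>F n in sequentially. exp (c * real n) * real (card (configurations (N n)))
    \<le> real (card (simple_connected_configurations (N n)))"
proof -
  \<comment> \<open>The gap \<open>c' - c\<close> pays for the subexponential factor lost in
    switchings.\<close>
  obtain c' where c': "c < c'" "c' < - K_of p" using dense[OF c] by blast
  obtain C where C: "0 < C" and Cev: "\<forall>\<^sub>F n in sequentially. real (sq n) \<le> C * real n" using sq_bound by blast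
  \<comment> \<open>The exponent lies strictly between 1/2, as Markov's inequality demands, and 1,
    so that the power \<open>D n\<close> of a polynomial in n is still subexponential.\<close>
  define D where "D n = nat \<lceil>real n powr (3/4)\<rceil>" for n
  have low: "\<forall>\<^sub>F n in sequentially. exp (c' * real n) * real (card (configurations (N n)))
    \<le> real (card {M \<in> perfect_matchings (darts (vertices (N n)) (tdegree (N n))). linked fst (vertices (N n)) M \<and> defect fst M \<le> D n})"
  proof (rule linked_lower[OF c'(2)])
    fix c0 :: real assume c0: "0 < c0"
    have "\<forall>\<^sub>F n in sequentially. 2 * (C * real n / sqrt (c0 * real n) + (C * real n)\<^sup>2 / (c0 * real n * sqrt (c0 * real n))) \<le> real n powr (3/4)"
      using C c0 by real_asymp
    moreover have "\<forall>\<^sub>F n in sequentially. 1 \<le> c0 * real n" using c0 by real_asymp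
    ultimately show "\<forall>\<^sub>F n in sequentially. \<forall>k L. c0 * real n \<le> real k \<longrightarrow>
      labelling (vertices (N n)) (tdegree (N n)) L \<longrightarrow> card (core_he (vertices (N n)) L) = 2 * Suc k \<longrightarrow>
      2 ^ (k - 1) * fact k \<le> card {C \<in> perfect_matchings (core_he (vertices (N n)) L).
        linked fst (core_vs (vertices (N n)) L) C \<and> defect fst C \<le> D n}"
      using Cev eventually_gt_at_top[of 0]
    proof eventually_elim
      case (elim n)
      show ?case
      proof (intro allI impI)
        fix k L assume k: "c0 * real n \<le> real k" and L: "labelling (vertices (N n)) (tdegree (N n)) L"
          and cH: "card (core_he (vertices (N n)) L) = 2 * Suc k"
        have "(\<Sum>v\<in>vertices (N n). (tdegree (N n) v)\<^sup>2) = sq n"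
          using sum_tdegree[OF finite_supp, of "\<lambda>i. i\<^sup>2" n] unfolding sq_def by (simp add: mult.commute)
        then have S2: "real (\<Sum>v\<in>vertices (N n). (tdegree (N n) v)\<^sup>2) \<le> C * real n" using elim(3) by simp
        have "1 \<le> real n powr (3/4)" using elim(4) by (intro ge_one_powr_ge_zero) auto
        then have D1: "real n powr (3/4) \<le> real (D n)" "0 < D n" unfolding D_def by linarith+
        show "2 ^ (k - 1) * fact k \<le> card {C \<in> perfect_matchings (core_he (vertices (N n)) L).
            linked fst (core_vs (vertices (N n)) L) C \<and> defect fst C \<le> D n}"
        proof (rule card_linked_small_defect[OF L cH S2 _ k c0 _ elim(4)])
          show "0 \<le> C" using C by simp
          show "1 \<le> k" using k elim(2) by simp
          show "2 * (C * real n / sqrt (c0 * real n) + (C * real n)\<^sup>2 / (c0 * real n * sqrt (c0 * real n))) \<le> real (D n)"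
            using elim(1) D1 by linarith
        qed (rule D1)
      qed
    qed
  qed
  have ell: "\<forall>\<^sub>F n in sequentially. real n \<le> real (tell (N n)) \<and> real (tell (N n)) \<le> (\<mu> + 1) * real n"
  proof -
    have "\<forall>\<^sub>F n in sequentially. 1 < real (tell (N n)) / real n" by (rule order_tendstoD(1)[OF tell_lim]) (use mu_gt_2 in simp)
    moreover have "\<forall>\<^sub>F n in sequentially. real (tell (N n)) / real n < \<mu> + 1" by (rule order_tendstoD(2)[OF tell_lim]) simp
    ultimately show ?thesis using eventually_gt_at_top[of 0]
      by eventually_elim (simp add: less_divide_eq divide_less_eq)
  qed
  \<comment> \<open>Degrees up to sqrt(n) / 4 give 2 (\<Delta> + 1) \<Delta> \<le> n / 4, below the
    number of half-edges, as switchings require.\<close>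
  have sixteenth: "0 < (1 / 16 :: real)" by simp
  have switch: "\<forall>\<^sub>F n in sequentially. card {M \<in> perfect_matchings (darts (vertices (N n)) (tdegree (N n))). linked fst (vertices (N n)) M \<and> defect fst M \<le> D n}
      \<le> (1 + tell (N n) ^ 8) ^ D n * card (simple_connected_configurations (N n))"
    using ell max_degree[OF sixteenth] eventually_gt_at_top[of 16]
  proof eventually_elim
    case (elim n)
    define V d where "V = vertices (N n)" and "d = tdegree (N n)"
    define \<Delta> where "\<Delta> = nat \<lfloor>sqrt (real n / 16)\<rfloor>"
    have deg: "d v \<le> \<Delta>" if "v \<in> V" for v
    proof -
      have "(real (d v))\<^sup>2 \<le> real n / 16" using elim(2) tdegree_supp[of v n] that unfolding V_def d_def by auto
      then have "real (d v) \<le> sqrt (real n / 16)" by (rule real_le_rsqrt)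
      then show ?thesis unfolding \<Delta>_def by linarith
    qed
    have fin: "finite (darts V d)" unfolding V_def by (intro finite_darts finite_vertices)
    have fib: "card {h \<in> darts V d. fst h = v} \<le> \<Delta>" for v
    proof (cases "v \<in> V")
      case True
      then have "{h \<in> darts V d. fst h = v} = Pair v ` {1..d v}" by (auto simp: darts_def)
      then have "card {h \<in> darts V d. fst h = v} = d v" by (simp add: card_image inj_on_def)
      then show ?thesis using deg[OF True] by simp
    next
      case False
      then have "{h \<in> darts V d. fst h = v} = {}" by (auto simp: darts_def)
      then show ?thesis by (metis card.empty zero_le)
    qed
    have cHE: "card (darts V d) = tell (N n)" unfolding V_def d_def by (rule card_darts_type[OF finite_supp])
    have "real (2 * ((\<Delta> + 1) * \<Delta>)) < real (tell (N n))"
    proof -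
      define x where "x = sqrt (real n / 16)"
      have x: "1 < x" "x\<^sup>2 = real n / 16" unfolding x_def using elim(3) by auto
      have "real \<Delta> \<le> x" unfolding \<Delta>_def x_def by simp
      then have "real \<Delta> * (real \<Delta> + 1) \<le> x * (x + 1)" using x by (intro mult_mono) auto
      also have "\<dots> \<le> x * (2 * x)" using x by (intro mult_left_mono) auto
      also have "\<dots> = real n / 8" using x(2) by (simp add: power2_eq_square)
      finally have "real (2 * ((\<Delta> + 1) * \<Delta>)) \<le> real n / 4" by (simp add: algebra_simps)
      also have "\<dots> < real n" using elim(3) by simp
      also have "\<dots> \<le> real (tell (N n))" using elim(1) by simp
      finally show ?thesis .
    qed
    then have large: "2 * ((\<Delta> + 1) * \<Delta>) < card (darts V d)" unfolding cHE by (simp only: of_nat_less_iff)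
    have "card {M \<in> perfect_matchings (darts V d). linked fst V M \<and> defect fst M \<le> D n}
      \<le> (1 + tell (N n) ^ 8) ^ D n * card {M \<in> perfect_matchings (darts V d). linked fst V M \<and> defect fst M = 0}"
      using card_defect_le[OF fin fib large, of V "D n"] unfolding cHE .
    also have "\<dots> \<le> (1 + tell (N n) ^ 8) ^ D n * card (simple_connected_configurations (N n))"
      unfolding V_def d_def by (intro mult_left_mono card_simple_connected_ge) simp
    finally show ?case unfolding V_def d_def by simp
  qed
  have small: "\<forall>\<^sub>F n in sequentially. real ((1 + tell (N n) ^ 8) ^ D n) \<le> exp ((c' - c) * real n)"
  proof -
    define M where "M = \<mu> + 1"
    have M: "0 < M" using mu_gt_2 unfolding M_def by simp
    have "0 < c' - c" using c' by simp
    then have "\<forall>\<^sub>F n in sequentially. (real n powr (3/4) + 1) * ln (1 + (M * real n) ^ 8) \<le> (c' - c) * real n"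
      using M by real_asymp
    then show ?thesis using ell
    proof eventually_elim
      case (elim n)
      have "real (1 + tell (N n) ^ 8) \<le> 1 + (M * real n) ^ 8"
        using elim(2) unfolding M_def by (auto intro!: power_mono)
      then have "ln (real (1 + tell (N n) ^ 8)) \<le> ln (1 + (M * real n) ^ 8)"
        by (subst ln_le_cancel_iff) (auto intro: add_pos_nonneg)
      moreover have "real (D n) \<le> real n powr (3/4) + 1" 
      unfolding D_def using of_int_ceiling_le_add_one[of "real n powr (3/4)"] by simp
      ultimately have "real (D n) * ln (real (1 + tell (N n) ^ 8)) \<le> (real n powr (3/4) + 1) * ln (1 + (M * real n) ^ 8)"
        by (intro mult_mono) auto
      then have "real (D n) * ln (real (1 + tell (N n) ^ 8)) \<le> (c' - c) * real n" using elim(1) by linarith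
      moreover have "real ((1 + tell (N n) ^ 8) ^ D n) = exp (real (D n) * ln (real (1 + tell (N n) ^ 8)))"
        by (simp add: exp_of_nat_mult exp_ln add_pos_nonneg)
      ultimately show ?case by simp
    qed
  qed
  show ?thesis using low switch small
  proof eventually_elim
    case (elim n)
    define s where "s = real (card (simple_connected_configurations (N n)))"
    have "exp (c' * real n) * real (card (configurations (N n))) \<le> real ((1 + tell (N n) ^ 8) ^ D n * card (simple_connected_configurations (N n)))"
      using elim(1) of_nat_mono[OF elim(2), where ?'a = real] by linarith
    also have "\<dots> = real ((1 + tell (N n) ^ 8) ^ D n) * s" unfolding s_def by (rule of_nat_mult)
    also have "\<dots> \<le> exp ((c' - c) * real n) * s" using elim(3) unfolding s_def by (intro mult_right_mono) auto
    also have "c' * real n = (c' - c) * real n + c * real n" by (simp add: algebra_simps)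
    finally have "exp ((c' - c) * real n) * (exp (c * real n) * real (card (configurations (N n)))) \<le> exp ((c' - c) * real n) * s"
      by (simp add: exp_add mult.assoc)
    then show ?case unfolding s_def by (rule mult_left_le_imp_le) simp
  qed
qed

lemma exp_asymp_simple_connected:
  "exp_asymp (K_of p) (\<lambda>n. real (card (simple_connected_configurations (N n)))) (\<lambda>n. real (card (configurations (N n))))"
proof (rule exp_asympI)
  show "\<forall>\<^sub>F n in sequentially. 0 < real (card (configurations (N n)))" using configurations_pos by simp
  fix c assume "- K_of p < c"
  then have "\<forall>\<^sub>F n in sequentially. real (card (connected_configurations (N n))) \<le> exp (c * real n) * real (card (configurations (N n)))"
    by (rule connected_upper)
  then show "\<forall>\<^sub>F n in sequentially. real (card (simple_connected_configurations (N n))) \<le> exp (c * real n) * real (card (configurations (N n)))"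
  proof (rule eventually_mono)
    fix n assume "real (card (connected_configurations (N n))) \<le> exp (c * real n) * real (card (configurations (N n)))"
    then show "real (card (simple_connected_configurations (N n))) \<le> exp (c * real n) * real (card (configurations (N n)))"
      using simple_le_connected[of n] by linarith
  qed
qed (rule simple_lower)

end

end

theorem theorem4p1:
  fixes N :: "nat \<Rightarrow> nat \<Rightarrow> nat" and p :: "nat \<Rightarrow> real"
  assumes type_seq: "\<And>n. type_sequence (N n)"
    and size: "\<And>n. tsize (N n) = n"
    and a_lim: "\<And>i. 1 \<le> i \<Longrightarrow> (\<lambda>n. real (N n i) / real n) \<longlonglongrightarrow> p i"
    and a_sum: "(p has_sum 1) {1..}"
    and b_summable: "(\<lambda>i. real i * p i) summable_on {1..}"
    and b_lim: "(\<lambda>n. real (tell (N n)) / real n) \<longlonglongrightarrow> (\<Sum>\<^sub>\<infinity>i\<in>{1..}. real i * p i)"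
    and p1_pos: "p 1 > 0"
    and mean_gt_2: "(\<Sum>\<^sub>\<infinity>i\<in>{1..}. real i * p i) > 2"
  shows "exp_asymp (K_of p)
           (\<lambda>n. real (card (connected_configurations (N n))))
           (\<lambda>n. real (card (configurations (N n))))
       \<and> ((\<lambda>i. (real i)\<^sup>2 * p i) summable_on {1..} \<and>
          (\<lambda>n. real (\<Sum>i\<in>tsupp (N n). i\<^sup>2 * N n i) / real n)
             \<longlonglongrightarrow> (\<Sum>\<^sub>\<infinity>i\<in>{1..}. (real i)\<^sup>2 * p i)
          \<longrightarrow> exp_asymp (K_of p)
                (\<lambda>n. real (card (simple_connected_configurations (N n))))
                (\<lambda>n. real (card (configurations (N n)))))"
proof -
  interpret degree_limit N p
    by unfold_locales (use assms in auto)
  show ?thesis using exp_asymp_connected exp_asymp_simple_connected by blast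
qed

end
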